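(* Let $\mathcal I\subset\mathbb K[x^*,y]$ be an $N$-admissible ideal and let $\phi=(c_1x^{\alpha^{(1)}},\dots,c_Mx^{\alpha^{(M)}})$ with $c_i\in\mathbb K$, $\alpha^{(i)}\in\mathbb Q^N$. Then $\phi$ is the first term of an $\omega$-solution of $\mathcal I$ (i.e. $\phi=\operatorname{in}_\omega(\varphi)$ for some $\omega$-solution $\varphi$ of $\mathcal I$) if and only if (i) $(\omega,\operatorname{ord}_\omega\phi)\in\tau(\mathcal I)$, and (ii) $\phi$ is an $\omega$-solution of the ideal $\operatorname{In}_{\omega,\operatorname{ord}_\omega\phi}\mathcal I$.
   Context: Let $\mathbb K$ be an algebraically closed field of characteristic zero, $N,M$ positive integers, $\omega\in\mathbb R^N$ with coordinates linearly independent over $\mathbb Q$. $S_\omega$ is the field of $\omega$-positive Puiseux series: formal sums $\phi=\sum_{\alpha\in\mathbb Q^N}c_\alpha x^\alpha$ ($c_\alpha\in\mathbb K$) with exponent set $\mathcal E(\phi)=\{\alpha:c_\alpha\neq0\}$ contained in $\frac1k\mathbb Z^N$ for some $k$ and with $\mathcal E(x^\gamma\phi)\subset\sigma$ for some $\gamma\in\mathbb Q^N$ and some rational polyhedral cone $\sigma$ with $v\cdot\omega\ge0$ on $\sigma$. $\operatorname{ord}_\omega(\phi)=\min_{\alpha\in\mathcal E(\phi)}\omega\cdot\alpha$ and $\operatorname{in}_\omega(\phi)$ the term $c_\alpha x^\alpha$ attaining it ($\operatorname{ord}_\omega0=\infty$, $\operatorname{in}_\omega0=0$), componentwise on $S_\omega^M$.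 Conventions $\infty\cdot a=\infty$ ($a\ne0$), $\infty\cdot0=0$; $\Lambda(\eta)=\{i:\eta_i\ne\infty\}$. Let $\mathbb K[x^*,y]=\mathbb K[x_1^{\pm1},\dots,x_N^{\pm1},y_1,\dots,y_M]\subset S_\omega[y]$. For $\omega'\in\mathbb R^N$, $\eta\in(\mathbb R\cup\{\infty\})^M$ and $f=\sum a_{\alpha,\beta}x^\alpha y^\beta$: $\operatorname{ord}_{\omega',\eta}(f)=\min_{a_{\alpha,\beta}\ne0}(\omega'\cdot\alpha+\eta\cdot\beta)$; $\operatorname{in}_{\omega',\eta}(f)$ is the sum of terms attaining the minimum if finite, else $0$; $\operatorname{In}_{\omega',\eta}\mathcal I$ is the ideal generated by $\{\operatorname{in}_{\omega',\eta}f:f\in\mathcal I\}\cup\{y_i:i\notin\Lambda(\eta)\}$. An $\omega$-solution of an ideal $\mathcal J\subset\mathbb K[x^*,y]$ is $\varphi\in S_\omega^M$ with $f(x,\varphi)=0$ for all $f\in\mathcal J$. $\tau(\mathcal I)=\{(\omega',\eta): \operatorname{In}_{\omega',\eta}\mathcal I\cap\mathbb K[x^*,(y_i)_{i\in\Lambda(\eta)}]\text{ contains no monomial } cx^\alpha y^\beta,\ c\ne0\}$. $\mathcal I$ is $N$-admissible if, for $J=\mathcal I\cap\mathbb K[x_1,\dots,x_N,y]$, the projection $(x,y)\mapsto x$ from the zero set of $J$ in $\mathbb K^{N+M}$ to $\mathbb K^N$ is dominant with finite generic fibre. *)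

theory Defs
  imports "HOL-Library.Extended_Real" "HOL-Library.FuncSet"
          "HOL-Computational_Algebra.Polynomial"
begin

(* Coefficient field: 'k :: {alg_closed_field, field_char_0}.
   x-variables indexed by a finite type 'n (N = CARD('n)),
   y-variables indexed by a finite type 'm (M = CARD('m)). *)

definition lsupp :: "('a \<Rightarrow> 'k::zero) \<Rightarrow> 'a set" where
  "lsupp f = {e. f e \<noteq> 0}"

(* an element is a finitely supported coefficient function on exponents
   (alpha, beta) in Z^N x N^M *)

definition is_lpoly :: "(('n \<Rightarrow> int) \<times> ('m \<Rightarrow> nat) \<Rightarrow> 'k::zero) \<Rightarrow> bool" where
  "is_lpoly f \<longleftrightarrow> finite (lsupp f)"

definition lp_add :: "(('n \<Rightarrow> int) \<times> ('m \<Rightarrow> nat) \<Rightarrow> 'k::comm_ring_1)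
    \<Rightarrow> (('n \<Rightarrow> int) \<times> ('m \<Rightarrow> nat) \<Rightarrow> 'k) \<Rightarrow> (('n \<Rightarrow> int) \<times> ('m \<Rightarrow> nat) \<Rightarrow> 'k)" where
  "lp_add f g = (\<lambda>e. f e + g e)"

definition lp_mult :: "(('n \<Rightarrow> int) \<times> ('m \<Rightarrow> nat) \<Rightarrow> 'k::comm_ring_1)
    \<Rightarrow> (('n \<Rightarrow> int) \<times> ('m \<Rightarrow> nat) \<Rightarrow> 'k) \<Rightarrow> (('n \<Rightarrow> int) \<times> ('m \<Rightarrow> nat) \<Rightarrow> 'k)" where
  "lp_mult f g = (\<lambda>e. \<Sum>p \<in> {(a, b). a \<in> lsupp f \<and> b \<in> lsupp g
        \<and> (\<lambda>j. fst a j + fst b j) = fst e \<and> (\<lambda>i. snd a i + snd b i) = snd e}.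
        f (fst p) * g (snd p))"

definition lp_monom :: "'k::zero \<Rightarrow> ('n \<Rightarrow> int) \<times> ('m \<Rightarrow> nat)
    \<Rightarrow> (('n \<Rightarrow> int) \<times> ('m \<Rightarrow> nat) \<Rightarrow> 'k)" where
  "lp_monom c e = (\<lambda>e'. if e' = e then c else 0)"

definition lp_var_y :: "'m \<Rightarrow> (('n \<Rightarrow> int) \<times> ('m \<Rightarrow> nat) \<Rightarrow> 'k::{zero,one})" where
  "lp_var_y i = lp_monom 1 ((\<lambda>_. 0), (\<lambda>i'. if i' = i then 1 else 0))"

definition lp_ideal :: "(('n \<Rightarrow> int) \<times> ('m \<Rightarrow> nat) \<Rightarrow> 'k::comm_ring_1) set \<Rightarrow> bool" where
  "lp_ideal I \<longleftrightarrow> I \<subseteq> {f. is_lpoly f} \<and> (\<lambda>_. 0) \<in> I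
     \<and> (\<forall>f\<in>I. \<forall>g\<in>I. lp_add f g \<in> I)
     \<and> (\<forall>f\<in>I. \<forall>g. is_lpoly g \<longrightarrow> lp_mult g f \<in> I)"

definition lp_ideal_gen :: "(('n \<Rightarrow> int) \<times> ('m \<Rightarrow> nat) \<Rightarrow> 'k::comm_ring_1) set
    \<Rightarrow> (('n \<Rightarrow> int) \<times> ('m \<Rightarrow> nat) \<Rightarrow> 'k) set" where
  "lp_ideal_gen S = \<Inter> {J. lp_ideal J \<and> S \<subseteq> J}"

(* eta . beta with the conventions inf * a = inf (a <> 0), inf * 0 = 0 *)
definition eta_dot :: "('m::finite \<Rightarrow> ereal) \<Rightarrow> ('m \<Rightarrow> nat) \<Rightarrow> ereal" where
  "eta_dot \<eta> \<beta> = (\<Sum>i\<in>UNIV. if \<beta> i = 0 then 0 else \<eta> i * ereal (real (\<beta> i)))"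

definition lp_wt :: "('n::finite \<Rightarrow> real) \<Rightarrow> ('m::finite \<Rightarrow> ereal)
    \<Rightarrow> ('n \<Rightarrow> int) \<times> ('m \<Rightarrow> nat) \<Rightarrow> ereal" where
  "lp_wt \<omega>' \<eta> e = ereal (\<Sum>j\<in>UNIV. \<omega>' j * real_of_int (fst e j)) + eta_dot \<eta> (snd e)"

(* ord_{omega',eta}(f); equals \<infinity> for f = 0 *)
definition lp_ord :: "('n::finite \<Rightarrow> real) \<Rightarrow> ('m::finite \<Rightarrow> ereal)
    \<Rightarrow> (('n \<Rightarrow> int) \<times> ('m \<Rightarrow> nat) \<Rightarrow> 'k::zero) \<Rightarrow> ereal" where
  "lp_ord \<omega>' \<eta> f = (INF e \<in> lsupp f. lp_wt \<omega>' \<eta> e)"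

definition lp_in :: "('n::finite \<Rightarrow> real) \<Rightarrow> ('m::finite \<Rightarrow> ereal)
    \<Rightarrow> (('n \<Rightarrow> int) \<times> ('m \<Rightarrow> nat) \<Rightarrow> 'k::zero) \<Rightarrow> (('n \<Rightarrow> int) \<times> ('m \<Rightarrow> nat) \<Rightarrow> 'k)" where
  "lp_in \<omega>' \<eta> f = (if lp_ord \<omega>' \<eta> f = \<infinity> then (\<lambda>_. 0)
     else (\<lambda>e. if e \<in> lsupp f \<and> lp_wt \<omega>' \<eta> e = lp_ord \<omega>' \<eta> f then f e else 0))"

definition lp_In :: "('n::finite \<Rightarrow> real) \<Rightarrow> ('m::finite \<Rightarrow> ereal)
    \<Rightarrow> (('n \<Rightarrow> int) \<times> ('m \<Rightarrow> nat) \<Rightarrow> 'k::comm_ring_1) set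
    \<Rightarrow> (('n \<Rightarrow> int) \<times> ('m \<Rightarrow> nat) \<Rightarrow> 'k) set" where
  "lp_In \<omega>' \<eta> I = lp_ideal_gen ({lp_in \<omega>' \<eta> f | f. f \<in> I} \<union> {lp_var_y i | i. \<eta> i = \<infinity>})"

definition Lam :: "('m \<Rightarrow> ereal) \<Rightarrow> 'm set" where
  "Lam \<eta> = {i. \<eta> i \<noteq> \<infinity>}"

definition tau :: "(('n::finite \<Rightarrow> int) \<times> ('m::finite \<Rightarrow> nat) \<Rightarrow> 'k::comm_ring_1) set
    \<Rightarrow> (('n \<Rightarrow> real) \<times> ('m \<Rightarrow> ereal)) set" where
  "tau I = {(\<omega>', \<eta>). \<not> (\<exists>c \<alpha> \<beta>. c \<noteq> 0 \<and> (\<forall>i. i \<notin> Lam \<eta> \<longrightarrow> \<beta> i = 0)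
                          \<and> lp_monom c (\<alpha>, \<beta>) \<in> lp_In \<omega>' \<eta> I)}"

definition rcone :: "('n::finite \<Rightarrow> rat) set \<Rightarrow> ('n \<Rightarrow> real) set" where
  "rcone V = {(\<lambda>j. \<Sum>v\<in>V. c v * real_of_rat (v j)) | c. \<forall>v\<in>V. c v \<ge> 0}"

definition ps_valid :: "('n::finite \<Rightarrow> real) \<Rightarrow> (('n \<Rightarrow> rat) \<Rightarrow> 'k::zero) \<Rightarrow> bool" where
  "ps_valid \<omega> \<phi> \<longleftrightarrow>
     (\<exists>k::nat. k > 0 \<and> (\<forall>\<alpha>\<in>lsupp \<phi>. \<forall>j. of_nat k * \<alpha> j \<in> \<int>)) \<and>
     (\<exists>(\<gamma>::'n \<Rightarrow> rat) (V::('n \<Rightarrow> rat) set). finite V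
        \<and> (\<forall>s\<in>rcone V. (\<Sum>j\<in>UNIV. s j * \<omega> j) \<ge> 0)
        \<and> (\<forall>\<alpha>\<in>lsupp \<phi>. (\<lambda>j. real_of_rat (\<alpha> j + \<gamma> j)) \<in> rcone V))"

definition ps_ord :: "('n::finite \<Rightarrow> real) \<Rightarrow> (('n \<Rightarrow> rat) \<Rightarrow> 'k::zero) \<Rightarrow> ereal" where
  "ps_ord \<omega> \<phi> = (INF \<alpha> \<in> lsupp \<phi>. ereal (\<Sum>j\<in>UNIV. \<omega> j * real_of_rat (\<alpha> j)))"

definition ps_in :: "('n::finite \<Rightarrow> real) \<Rightarrow> (('n \<Rightarrow> rat) \<Rightarrow> 'k::zero) \<Rightarrow> (('n \<Rightarrow> rat) \<Rightarrow> 'k)" where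
  "ps_in \<omega> \<phi> = (\<lambda>\<alpha>. if \<alpha> \<in> lsupp \<phi>
        \<and> ereal (\<Sum>j\<in>UNIV. \<omega> j * real_of_rat (\<alpha> j)) = ps_ord \<omega> \<phi> then \<phi> \<alpha> else 0)"

definition ps_monom :: "'k::zero \<Rightarrow> ('n \<Rightarrow> rat) \<Rightarrow> (('n \<Rightarrow> rat) \<Rightarrow> 'k)" where
  "ps_monom c \<alpha> = (\<lambda>\<alpha>'. if \<alpha>' = \<alpha> then c else 0)"

definition ps_fprod :: "'j set \<Rightarrow> ('j \<Rightarrow> ('n \<Rightarrow> rat) \<Rightarrow> 'k::comm_ring_1) \<Rightarrow> (('n \<Rightarrow> rat) \<Rightarrow> 'k)" where
  "ps_fprod J \<psi> = (\<lambda>\<gamma>. \<Sum>a\<in>{a \<in> PiE J (\<lambda>j. lsupp (\<psi> j)). (\<lambda>k. \<Sum>j\<in>J. a j k) = \<gamma>}.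
                         \<Prod>j\<in>J. \<psi> j (a j))"

definition ps_eval :: "(('n \<Rightarrow> int) \<times> ('m \<Rightarrow> nat) \<Rightarrow> 'k::comm_ring_1)
    \<Rightarrow> ('m \<Rightarrow> ('n \<Rightarrow> rat) \<Rightarrow> 'k) \<Rightarrow> (('n \<Rightarrow> rat) \<Rightarrow> 'k)" where
  "ps_eval f \<phi> = (\<lambda>\<gamma>. \<Sum>e\<in>lsupp f. f e *
       ps_fprod {(i, k). k < snd e i} (\<lambda>(i, k). \<phi> i) (\<lambda>j. \<gamma> j - of_int (fst e j)))"

definition omega_solution :: "('n::finite \<Rightarrow> real)
    \<Rightarrow> (('n \<Rightarrow> int) \<times> ('m \<Rightarrow> nat) \<Rightarrow> 'k::comm_ring_1) set
    \<Rightarrow> ('m \<Rightarrow> ('n \<Rightarrow> rat) \<Rightarrow> 'k) \<Rightarrow> bool" where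
  "omega_solution \<omega> J \<phi> \<longleftrightarrow> (\<forall>i. ps_valid \<omega> (\<phi> i)) \<and> (\<forall>f\<in>J. ps_eval f \<phi> = (\<lambda>_. 0))"

definition poly_part :: "(('n \<Rightarrow> int) \<times> ('m \<Rightarrow> nat) \<Rightarrow> 'k::zero) set
    \<Rightarrow> (('n \<Rightarrow> int) \<times> ('m \<Rightarrow> nat) \<Rightarrow> 'k) set" where
  "poly_part I = {f \<in> I. \<forall>e\<in>lsupp f. \<forall>j. fst e j \<ge> 0}"

definition pt_eval :: "(('n::finite \<Rightarrow> int) \<times> ('m::finite \<Rightarrow> nat) \<Rightarrow> 'k::comm_ring_1)
    \<Rightarrow> ('n \<Rightarrow> 'k) \<Rightarrow> ('m \<Rightarrow> 'k) \<Rightarrow> 'k" where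
  "pt_eval f a b = (\<Sum>e\<in>lsupp f. f e * (\<Prod>j\<in>UNIV. a j ^ nat (fst e j)) * (\<Prod>i\<in>UNIV. b i ^ snd e i))"

definition is_xpoly :: "(('n \<Rightarrow> int) \<times> ('m \<Rightarrow> nat) \<Rightarrow> 'k::zero) \<Rightarrow> bool" where
  "is_xpoly g \<longleftrightarrow> is_lpoly g \<and> (\<forall>e\<in>lsupp g. (\<forall>j. fst e j \<ge> 0) \<and> snd e = (\<lambda>_. 0))"

definition zero_set :: "(('n::finite \<Rightarrow> int) \<times> ('m::finite \<Rightarrow> nat) \<Rightarrow> 'k::comm_ring_1) set
    \<Rightarrow> (('n \<Rightarrow> 'k) \<times> ('m \<Rightarrow> 'k)) set" where
  "zero_set J = {(a, b). \<forall>f\<in>J. pt_eval f a b = 0}"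

(* projection Z(J) -> K^N is dominant (image not contained in a proper
   hypersurface) and has finite generic fibre (finite fibres over a
   nonempty Zariski open set) *)
definition N_admissible :: "(('n::finite \<Rightarrow> int) \<times> ('m::finite \<Rightarrow> nat) \<Rightarrow> 'k::comm_ring_1) set \<Rightarrow> bool" where
  "N_admissible I \<longleftrightarrow>
     (\<forall>g::('n \<Rightarrow> int) \<times> ('m \<Rightarrow> nat) \<Rightarrow> 'k. is_xpoly g \<and> g \<noteq> (\<lambda>_. 0) \<longrightarrow>
          (\<exists>a b. (a, b) \<in> zero_set (poly_part I) \<and> pt_eval g a b \<noteq> 0)) \<and>
     (\<exists>g::('n \<Rightarrow> int) \<times> ('m \<Rightarrow> nat) \<Rightarrow> 'k. is_xpoly g \<and> g \<noteq> (\<lambda>_. 0) \<and>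
          (\<forall>a. pt_eval g a (\<lambda>_. 0) \<noteq> 0 \<longrightarrow> finite {b. (a, b) \<in> zero_set (poly_part I)}))"

end

theory Submission
  imports Defs "HOL-Library.Function_Algebras" "HOL-Library.Product_Plus" "HOL-Library.Poly_Mapping"
begin

text \<open>Since the coordinates of \<open>\<omega>\<close> are rationally independent, \<open>x ^ \<alpha> \<mapsto> t ^ (\<omega> \<cdot> \<alpha>)\<close> embeds the
  \<open>\<omega>\<close>-positive Puiseux series into series in one variable with real exponents. Their supports lie
  in translates of finitely generated monoids of positive exponents; Hensel lifting stays inside
  such a monoid, so after a Tschirnhaus transformation every polynomial has a root.

  Condition (ii) says that no element of \<open>\<I>\<close> is \<^emph>\<open>good\<close>, i.e. has the same valuation at the monomial
  point \<open>\<phi>\<close> as its weighted order, and it implies (i). Finiteness of the generic fibre provides for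
  each \<open>i\<close> a nonzero element of \<open>\<I>\<close> in \<open>x\<close> and \<open>y\<^sub>i\<close> only, which splits over the series field. If no
  common zero of \<open>\<I>\<close> had first term \<open>\<phi>\<close>, then each grid point of roots would yield a good element
  modulo the ideal of that point; products of good elements are good, so the extension of \<open>\<I>\<close> to
  series coefficients would contain a good element, and by Gaussian elimination with valuation
  pivoting so would \<open>\<I>\<close>.\<close>


text \<open>For a fixed \<open>y\<close>-exponent, independence sends different
  \<open>x\<close>-exponents to different powers of t. So at the monomial point the initial form of
  F takes a value \<kappa> t^m, where m is the weighted order of F and \<kappa> is also the
  coefficient of t^m in the value of F itself; it vanishes exactly when F is not good. A solution
  with the prescribed first terms agrees with the point in lowest terms, which settles one
  direction. The obstacle in the other direction is that candidate coordinates are series: relations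
  between \<open>y\<close> and such candidates need series coefficients, and combinations of
  elements of the ideal with series coefficients might cancel lowest terms. The choice of pivot
  bounds the multiplier of the pivot row and thereby excludes this. A root with well-ordered support
  would not suffice, because \<open>ps_valid\<close> asks for a common denominator and a cone. Hence
  supports are tracked in finitely generated monoids; during a Hensel lift the monoid is fixed, and
  it changes only at the finitely many reductions of the degree.\<close>

hide_const (open) Poly_Mapping.degree Poly_Mapping.range

section \<open>Series with left-finite real exponents\<close>

typedef (overloaded) 'a lfs = "{f :: real \<Rightarrow> 'a::zero. \<forall>c. finite {r. r \<le> c \<and> f r \<noteq> 0}}"
  morphisms scoeff Abs_lfs
  by (rule exI[of _ "\<lambda>_. 0"]) simp

setup_lifting type_definition_lfs

lemma finite_scoeff: "finite {r. r \<le> c \<and> scoeff F r \<noteq> 0}"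
  using scoeff[of F] by simp

lemma scoeff_Abs:
  "(\<And>c. finite {r. r \<le> c \<and> f r \<noteq> 0}) \<Longrightarrow> scoeff (Abs_lfs f) = f"
  by (simp add: Abs_lfs_inverse)

lemma lfs_eqI: "(\<And>r. scoeff F r = scoeff G r) \<Longrightarrow> F = G"
  by (simp add: scoeff_inject[symmetric] ext)

text \<open>A lower bound for the valuation, used as a predicate so that the zero series needs no
  infinite value.\<close>

definition vge :: "real \<Rightarrow> 'a::zero lfs \<Rightarrow> bool" where
  "vge c F \<longleftrightarrow> (\<forall>r<c. scoeff F r = 0)"

lemma vgeD: "vge c F \<Longrightarrow> r < c \<Longrightarrow> scoeff F r = 0"
  by (simp add: vge_def)

lemma vge_mono: "vge c F \<Longrightarrow> d \<le> c \<Longrightarrow> vge d F"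
  by (auto simp: vge_def)

lemma vge_exists: "\<exists>m. vge m F"
proof -
  let ?S = "{r. r \<le> 0 \<and> scoeff F r \<noteq> 0}"
  have fin: "finite ?S" by (rule finite_scoeff)
  show ?thesis
  proof (cases "?S = {}")
    case True
    then show ?thesis by (intro exI[of _ 0]) (auto simp: vge_def)
  next
    case False
    have "vge (Min ?S) F"
      unfolding vge_def
    proof (intro allI impI)
      fix r assume r: "r < Min ?S"
      have "Min ?S \<le> 0" using Min_in[OF fin False] by simp
      then show "scoeff F r = 0" using r Min_le[OF fin, of r] by force
    qed
    then show ?thesis by blast
  qed
qed

lemma leading_exponent:
  assumes "F \<noteq> Abs_lfs (\<lambda>_. 0)"
  obtains m where "vge m F" "scoeff F m \<noteq> 0"
proof -
  obtain r where r: "scoeff F r \<noteq> 0"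
  proof -
    have "scoeff F \<noteq> (\<lambda>_. 0)" using assms scoeff_inverse[of F] by auto
    then show ?thesis using that by auto
  qed
  let ?S = "{s. s \<le> r \<and> scoeff F s \<noteq> 0}"
  have fin: "finite ?S" by (rule finite_scoeff)
  have ne: "?S \<noteq> {}" using r by auto
  have "Min ?S \<in> ?S" using Min_in[OF fin ne] .
  moreover have "vge (Min ?S) F"
    unfolding vge_def
  proof (intro allI impI)
    fix s assume s: "s < Min ?S"
    then have "s \<le> r" using \<open>Min ?S \<in> ?S\<close> by auto
    then show "scoeff F s = 0" using s Min_le[OF fin, of s] by force
  qed
  ultimately show ?thesis using that by auto
qed

lift_definition sconst :: "'a::zero \<Rightarrow> real \<Rightarrow> 'a lfs" is "\<lambda>c d r. if r = d then c else 0"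
  subgoal for c d b by (rule finite_subset[of _ "{d}"]) auto
  done

lemma scoeff_sconst [simp]: "scoeff (sconst c d) r = (if r = d then c else 0)"
  by transfer simp

section \<open>Ring structure by convolution\<close>

instantiation lfs :: (comm_ring_1) comm_ring_1
begin

lift_definition zero_lfs :: "'a lfs" is "\<lambda>_. 0" by simp

definition one_lfs :: "'a lfs" where "1 = sconst 1 0"

lift_definition plus_lfs :: "'a lfs \<Rightarrow> 'a lfs \<Rightarrow> 'a lfs" is "\<lambda>f g r. f r + g r"
  subgoal for f g c
    by (rule finite_subset[of _ "{r. r \<le> c \<and> f r \<noteq> 0} \<union> {r. r \<le> c \<and> g r \<noteq> 0}"]) auto
  done

lift_definition uminus_lfs :: "'a lfs \<Rightarrow> 'a lfs" is "\<lambda>f r. - f r" by simp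

lift_definition minus_lfs :: "'a lfs \<Rightarrow> 'a lfs \<Rightarrow> 'a lfs" is "\<lambda>f g r. f r - g r"
  subgoal for f g c
    by (rule finite_subset[of _ "{r. r \<le> c \<and> f r \<noteq> 0} \<union> {r. r \<le> c \<and> g r \<noteq> 0}"]) auto
  done

definition cmul :: "'a lfs \<Rightarrow> 'a lfs \<Rightarrow> real \<Rightarrow> 'a" where
  "cmul F G r = (\<Sum>s\<in>{s. scoeff F s \<noteq> 0 \<and> scoeff G (r - s) \<noteq> 0}. scoeff F s * scoeff G (r - s))"

definition times_lfs :: "'a lfs \<Rightarrow> 'a lfs \<Rightarrow> 'a lfs" where
  "F * G = Abs_lfs (cmul F G)"

text \<open>A lower bound m for the exponents of \<open>G\<close> turns into the upper bound r - m
  for s, below which \<open>F\<close> has finite support.\<close>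

lemma finite_conv: "finite {s. scoeff F s \<noteq> 0 \<and> scoeff G (r - s) \<noteq> (0::'a)}"
proof -
  obtain m where "vge m G" using vge_exists by blast
  then have "{s. scoeff F s \<noteq> 0 \<and> scoeff G (r - s) \<noteq> 0} \<subseteq> {s. s \<le> r - m \<and> scoeff F s \<noteq> 0}"
    unfolding vge_def by (smt (verit) Collect_mono_iff)
  then show ?thesis using finite_scoeff finite_subset by blast
qed

lemma cmul_nonzero:
  assumes "cmul F G r \<noteq> 0"
  shows "\<exists>s. scoeff F s \<noteq> 0 \<and> scoeff G (r - s) \<noteq> 0"
proof (rule ccontr)
  assume "\<not> ?thesis"
  then have "cmul F G r = 0" unfolding cmul_def by (intro sum.neutral) auto
  then show False using assms by simp
qed

lemma scoeff_times: "scoeff (F * G) = cmul F (G::'a lfs)"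
  unfolding times_lfs_def
proof (rule scoeff_Abs)
  fix c
  obtain m n where m: "vge m F" and n: "vge n G" using vge_exists by metis
  have "{r. r \<le> c \<and> cmul F G r \<noteq> 0} \<subseteq>
      (\<lambda>(s,t). s + t) ` ({s. s \<le> c - n \<and> scoeff F s \<noteq> 0} \<times> {t. t \<le> c - m \<and> scoeff G t \<noteq> 0})"
  proof
    fix r assume r: "r \<in> {r. r \<le> c \<and> cmul F G r \<noteq> 0}"
    then obtain s where s: "scoeff F s \<noteq> 0" "scoeff G (r - s) \<noteq> 0"
      using cmul_nonzero by blast
    have "s \<ge> m" "r - s \<ge> n" using m n s by (auto simp: vge_def not_less[symmetric])
    then show "r \<in> (\<lambda>(s,t). s + t) ` ({s. s \<le> c - n \<and> scoeff F s \<noteq> 0} \<times> {t. t \<le> c - m \<and> scoeff G t \<noteq> 0})"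
      using s r by (intro image_eqI[of _ _ "(s, r - s)"]) auto
  qed
  then show "finite {r. r \<le> c \<and> cmul F G r \<noteq> 0}"
    by (rule finite_subset) (intro finite_imageI finite_cartesian_product finite_scoeff)
qed

lemma scoeff_times_sum:
  assumes "finite A" "\<And>s. scoeff F s \<noteq> 0 \<Longrightarrow> scoeff G (r - s) \<noteq> 0 \<Longrightarrow> s \<in> A"
  shows "scoeff (F * G) r = (\<Sum>s\<in>A. scoeff F s * scoeff (G::'a lfs) (r - s))"
  unfolding scoeff_times cmul_def
  by (rule sum.mono_neutral_left) (use assms in auto)

lemma scoeff_times_commute: "scoeff (F * G) r = scoeff (G * (F::'a lfs)) r"
  unfolding scoeff_times cmul_def
  by (rule sum.reindex_bij_witness[where i="\<lambda>s. r - s" and j="\<lambda>s. r - s"])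
     (auto simp: mult.commute)

text \<open>With \<open>H\<close> kept last, both sides are the same double sum over exponents of
  \<open>F\<close> and \<open>G\<close>, so a single exchange of summation suffices. Together with
  commutativity this yields associativity.\<close>

lemma times_left_commute_lfs: "(F::'a lfs) * (G * H) = G * (F * H)"
proof (rule lfs_eqI)
  fix r
  obtain m n k where m: "vge m F" and n: "vge n G" and k: "vge k H"
    using vge_exists by metis
  \<comment> \<open>Truncations: a contribution to the exponent r from \<open>F\<close> leaves at
    least n + k to \<open>G\<close> and \<open>H\<close>, and one from \<open>G\<close> leaves at
    least m + k to \<open>F\<close> and \<open>H\<close>.\<close>
  let ?A = "{s. s \<le> r - n - k \<and> scoeff F s \<noteq> 0}"
  let ?B = "{s. s \<le> r - m - k \<and> scoeff G s \<noteq> 0}"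
  have fin: "finite ?A" "finite ?B" by (rule finite_scoeff)+
  have ge: "\<And>s. scoeff F s \<noteq> 0 \<Longrightarrow> s \<ge> m" "\<And>s. scoeff G s \<noteq> 0 \<Longrightarrow> s \<ge> n"
      "\<And>s. scoeff H s \<noteq> 0 \<Longrightarrow> s \<ge> k"
    using m n k by (auto simp: vge_def not_less[symmetric])
  have GH: "scoeff (G * H) (r - s) = (\<Sum>t\<in>?B. scoeff G t * scoeff H (r - s - t))"
    if "scoeff F s \<noteq> 0" for s
    using ge[of s] ge(3) that by (intro scoeff_times_sum fin) fastforce
  have FH: "scoeff (F * H) (r - s) = (\<Sum>t\<in>?A. scoeff F t * scoeff H (r - s - t))"
    if "scoeff G s \<noteq> 0" for s
    using ge(2)[of s] ge(3) that by (intro scoeff_times_sum fin) fastforce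
  have "scoeff (F * (G * H)) r = (\<Sum>s\<in>?A. scoeff F s * scoeff (G * H) (r - s))"
  proof (rule scoeff_times_sum[OF fin(1)])
    fix s assume s: "scoeff F s \<noteq> 0" "scoeff (G * H) (r - s) \<noteq> 0"
    then obtain t where "scoeff G t \<noteq> 0" "scoeff H (r - s - t) \<noteq> 0"
      using cmul_nonzero scoeff_times by metis
    then show "s \<in> ?A" using s ge by fastforce
  qed
  also have "\<dots> = (\<Sum>s\<in>?A. \<Sum>t\<in>?B. scoeff F s * scoeff G t * scoeff H (r - s - t))"
    by (intro sum.cong refl) (simp add: GH sum_distrib_left mult.assoc)
  also have "\<dots> = (\<Sum>t\<in>?B. \<Sum>s\<in>?A. scoeff F s * scoeff G t * scoeff H (r - s - t))"
    by (rule sum.swap)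
  also have "\<dots> = (\<Sum>t\<in>?B. scoeff G t * scoeff (F * H) (r - t))"
    by (intro sum.cong refl) (simp add: FH sum_distrib_left algebra_simps)
  also have "\<dots> = scoeff (G * (F * H)) r"
  proof (rule scoeff_times_sum[OF fin(2), symmetric])
    fix s assume s: "scoeff G s \<noteq> 0" "scoeff (F * H) (r - s) \<noteq> 0"
    then obtain t where "scoeff F t \<noteq> 0" "scoeff H (r - s - t) \<noteq> 0"
      using cmul_nonzero scoeff_times by metis
    then show "s \<in> ?B" using s ge by fastforce
  qed
  finally show "scoeff (F * (G * H)) r = scoeff (G * (F * H)) r" .
qed

lemma times_commute_lfs: "(F::'a lfs) * G = G * F"
  by (rule lfs_eqI) (rule scoeff_times_commute)

lemma times_add_lfs: "((F::'a lfs) + G) * H = F * H + G * H"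
proof (rule lfs_eqI)
  fix r
  let ?A = "{s. scoeff F s \<noteq> 0 \<and> scoeff H (r - s) \<noteq> 0} \<union> {s. scoeff G s \<noteq> 0 \<and> scoeff H (r - s) \<noteq> 0}"
  have fin: "finite ?A" using finite_conv by blast
  have *: "scoeff (F + G) s = scoeff F s + scoeff G s" for s by transfer simp
  have "scoeff ((F + G) * H) r = (\<Sum>s\<in>?A. scoeff (F + G) s * scoeff H (r - s))"
    by (rule scoeff_times_sum[OF fin]) (auto simp: *)
  also have "\<dots> = (\<Sum>s\<in>?A. scoeff F s * scoeff H (r - s)) + (\<Sum>s\<in>?A. scoeff G s * scoeff H (r - s))"
    by (simp add: * algebra_simps sum.distrib)
  also have "(\<Sum>s\<in>?A. scoeff F s * scoeff H (r - s)) = scoeff (F * H) r"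
    by (rule scoeff_times_sum[OF fin, symmetric]) auto
  also have "(\<Sum>s\<in>?A. scoeff G s * scoeff H (r - s)) = scoeff (G * H) r"
    by (rule scoeff_times_sum[OF fin, symmetric]) auto
  finally show "scoeff ((F + G) * H) r = scoeff (F * H + G * H) r"
    by (simp add: plus_lfs.rep_eq)
qed

lemma one_times_lfs: "(1::'a lfs) * F = F"
proof (rule lfs_eqI)
  fix r
  have "scoeff (1 * F) r = (\<Sum>s\<in>{0}. scoeff 1 s * scoeff F (r - s))"
    by (rule scoeff_times_sum) (auto simp: one_lfs_def split: if_splits)
  then show "scoeff (1 * F) r = scoeff F r" by (simp add: one_lfs_def)
qed

instance
proof
  fix a b c :: "'a lfs"
  show "a * b * c = a * (b * c)"
    by (metis times_commute_lfs times_left_commute_lfs)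
  show "a * b = b * a" by (rule times_commute_lfs)
  show "1 * a = a" by (rule one_times_lfs)
  show "(a + b) * c = a * c + b * c" by (rule times_add_lfs)
  show "a + b + c = a + (b + c)" by transfer (simp add: add.assoc)
  show "a + b = b + a" by transfer (simp add: add.commute)
  show "0 + a = a" by transfer simp
  show "- a + a = 0" by transfer simp
  show "a - b = a + - b" by transfer simp
  have "scoeff (1::'a lfs) 0 \<noteq> scoeff 0 0" by (simp add: one_lfs_def zero_lfs.rep_eq)
  then show "(0::'a lfs) \<noteq> 1" by metis
qed

end

lemma scoeff_0 [simp]: "scoeff 0 r = 0" by transfer simp
lemma scoeff_add [simp]: "scoeff (F + G) r = scoeff F r + scoeff G r" by transfer simp
lemma scoeff_minus [simp]: "scoeff (- F) r = - scoeff F r" by transfer simp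
lemma scoeff_diff [simp]: "scoeff (F - G) r = scoeff F r - scoeff G r" by transfer simp
lemma scoeff_1: "scoeff 1 r = (if r = 0 then 1 else 0)" by (simp add: one_lfs_def)
lemma scoeff_sum: "scoeff (sum f A) r = (\<Sum>x\<in>A. scoeff (f x) r)"
  by (induction A rule: infinite_finite_induct) auto

lemma leading_exponentE:
  fixes F :: "'a::comm_ring_1 lfs"
  assumes "F \<noteq> 0"
  obtains m where "vge m F" "scoeff F m \<noteq> 0"
  using assms leading_exponent[of F] unfolding zero_lfs_def by blast

lemma scoeff_times_nonzero:
  assumes "scoeff (F * G) r \<noteq> 0"
  obtains s where "scoeff F s \<noteq> 0" "scoeff G (r - s) \<noteq> (0::'a::comm_ring_1)"
  using cmul_nonzero assms scoeff_times by metis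

lemma scoeff_sconst_times [simp]: "scoeff (sconst c d * F) r = c * scoeff F (r - d)"
proof -
  have "scoeff (sconst c d * F) r = (\<Sum>s\<in>{d}. scoeff (sconst c d) s * scoeff F (r - s))"
    by (rule scoeff_times_sum) (auto split: if_splits)
  then show ?thesis by simp
qed

lemma sconst_0 [simp]: "sconst 0 d = 0"
  by (rule lfs_eqI) simp

lemma sconst_1: "sconst 1 0 = 1" by (simp add: one_lfs_def)

lemma sconst_mult: "sconst a c * sconst b d = sconst (a * b :: 'a::comm_ring_1) (c + d)"
  by (rule lfs_eqI) auto

lemma sconst_add: "sconst (a + b) d = sconst a d + sconst (b :: 'a::comm_ring_1) d"
  by (rule lfs_eqI) auto

lemma sconst_power: "sconst a c ^ n = sconst (a ^ n :: 'a::comm_ring_1) (of_nat n * c)"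
  by (induction n) (simp_all add: sconst_1 sconst_mult algebra_simps)

lemma vge_0 [simp]: "vge c 0" by (simp add: vge_def)
lemma vge_diff: "vge c F \<Longrightarrow> vge c G \<Longrightarrow> vge c (F - G)" by (simp add: vge_def)
lemma vge_sum: "(\<And>x. x \<in> A \<Longrightarrow> vge c (f x)) \<Longrightarrow> vge c (sum f A)"
  by (simp add: vge_def scoeff_sum)
lemma vge_sconst: "c \<le> d \<Longrightarrow> vge c (sconst a d)" by (simp add: vge_def)

lemma vge_times:
  fixes F G :: "'a::comm_ring_1 lfs"
  assumes "vge a F" "vge b G" shows "vge (a + b) (F * G)"
  unfolding vge_def
proof (intro allI impI)
  fix r assume r: "r < a + b"
  show "scoeff (F * G) r = 0"
  proof (rule ccontr)
    assume "scoeff (F * G) r \<noteq> 0"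
    then obtain s where "scoeff F s \<noteq> 0" "scoeff G (r - s) \<noteq> 0"
      by (rule scoeff_times_nonzero)
    then have "s \<ge> a" "r - s \<ge> b" using assms by (auto simp: vge_def not_less[symmetric])
    then show False using r by simp
  qed
qed

lemma scoeff_times_leading:
  fixes F G :: "'a::comm_ring_1 lfs"
  assumes "vge a F" "vge b G"
  shows "scoeff (F * G) (a + b) = scoeff F a * scoeff G b"
proof -
  have "scoeff (F * G) (a + b) = (\<Sum>s\<in>{a}. scoeff F s * scoeff G (a + b - s))"
  proof (rule scoeff_times_sum)
    fix s assume "scoeff F s \<noteq> 0" "scoeff G (a + b - s) \<noteq> 0"
    then have "s \<ge> a" "a + b - s \<ge> b" using assms by (auto simp: vge_def not_less[symmetric])
    then show "s \<in> {a}" by simp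
  qed simp
  then show ?thesis by simp
qed

text \<open>Leading coefficients multiply, so the product of two nonzero series has a nonzero
  leading coefficient.\<close>

instance lfs :: (idom) idom
proof
  fix F G :: "'a lfs"
  assume "F \<noteq> 0" "G \<noteq> 0"
  then obtain m n where "vge m F" "scoeff F m \<noteq> 0" "vge n G" "scoeff G n \<noteq> 0"
    by (metis leading_exponentE)
  then have "scoeff (F * G) (m + n) \<noteq> 0" by (simp add: scoeff_times_leading)
  then show "F * G \<noteq> 0" by auto
qed

lemma vge_gt_times:
  fixes F G :: "'a::comm_ring_1 lfs"
  assumes "vge a F" "vge b G" "scoeff G b = 0"
  shows "scoeff (F * G) (a + b) = 0"
  using scoeff_times_leading[OF assms(1,2)] assms(3) by simp

section \<open>Hensel lifting of factorizations\<close>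

definition supp_in :: "real set \<Rightarrow> 'a::zero lfs \<Rightarrow> bool" where
  "supp_in M F \<longleftrightarrow> (\<forall>r. scoeff F r \<noteq> 0 \<longrightarrow> r \<in> M)"

text \<open>The coefficient of t^r of a polynomial over series. For nonnegative exponents the slice
  at 0 is the reduction to the residue field.\<close>

definition slice :: "real \<Rightarrow> 'a::comm_ring_1 lfs poly \<Rightarrow> 'a poly" where
  "slice r f = map_poly (\<lambda>F. scoeff F r) f"

lemma coeff_slice [simp]: "coeff (slice r f) i = scoeff (coeff f i) r"
  by (simp add: slice_def coeff_map_poly)

lemma degree_slice_le: "degree (slice r f) \<le> degree f"
  by (rule degree_le) (simp add: coeff_eq_0)

lemma degree_le_coeff: "(\<And>i. i > n \<Longrightarrow> coeff p i = 0) \<Longrightarrow> degree p \<le> n"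
  by (simp add: degree_le)

text \<open>The linearized factorization problem: \<open>E\<close> is the error to be absorbed by
  corrections of both factors. Bezout times \<open>E\<close> solves it; reducing the cofactor of
  \<open>h0\<close> modulo \<open>g0\<close> keeps its degree below that of \<open>g0\<close>, so
  that the lifted first factor stays monic, and then \<open>g0 * b = E - h0 * a\<close> bounds the
  degree of \<open>b\<close>.\<close>

lemma bezout_division:
  fixes g0 h0 E :: "'k::field poly"
  assumes bez: "u * g0 + v * h0 = 1" and lead: "lead_coeff g0 = 1"
    and dg: "degree (g0 * h0) \<le> n" and dE: "degree E \<le> n"
  shows "\<exists>a b. g0 * b + h0 * a = E \<and> (a = 0 \<or> degree a < degree g0) \<and> degree b \<le> n - degree g0"
proof -
  have g0: "g0 \<noteq> 0" using lead by auto
  define a where "a = (v * E) mod g0"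
  have "E - h0 * a = (u * g0 + v * h0) * E - h0 * a" by (simp add: bez)
  also have "\<dots> = g0 * (u * E + h0 * (v * E div g0))"
  proof -
    have "v * E = g0 * (v * E div g0) + a" unfolding a_def by simp
    then have "v * h0 * E = h0 * (g0 * (v * E div g0) + a)" by (metis mult.assoc mult.commute)
    then show ?thesis by (simp add: algebra_simps)
  qed
  finally obtain b where b: "E - h0 * a = g0 * b" by blast
  have a: "a = 0 \<or> degree a < degree g0" unfolding a_def by (rule degree_mod_less[OF g0])
  have ha: "degree (h0 * a) \<le> n"
  proof (cases "h0 = 0 \<or> a = 0")
    case False
    then show ?thesis using a dg g0 by (simp add: degree_mult_eq)
  qed auto
  have "degree b \<le> n - degree g0"
  proof (cases "b = 0")
    case False
    have "degree (g0 * b) \<le> n"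
      unfolding b[symmetric] using dE ha by (rule degree_diff_le)
    then show ?thesis using False g0 by (simp add: degree_mult_eq)
  qed simp
  moreover have "g0 * b + h0 * a = E" using b by (simp add: algebra_simps)
  ultimately show ?thesis using a by blast
qed

section \<open>Lifting along a left-finite monoid of exponents\<close>

locale left_finite_monoid =
  fixes M :: "real set"
  assumes zero_mem: "0 \<in> M"
    and add_mem: "a \<in> M \<Longrightarrow> b \<in> M \<Longrightarrow> a + b \<in> M"
    and nonneg: "a \<in> M \<Longrightarrow> 0 \<le> a"
    and finite_below: "finite {a \<in> M. a \<le> c}"
begin

definition splits :: "real \<Rightarrow> real set" where
  "splits r = {s \<in> M. s \<le> r \<and> r - s \<in> M}"

lemma finite_splits: "finite (splits r)"
  by (rule finite_subset[OF _ finite_below[of r]]) (auto simp: splits_def)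

lemma slice_mult:
  fixes f g :: "'a::comm_ring_1 lfs poly"
  assumes "\<And>i. supp_in M (coeff f i)" "\<And>i. supp_in M (coeff g i)"
  shows "slice r (f * g) = (\<Sum>s\<in>splits r. slice s f * slice (r - s) g)"
proof (rule poly_eqI)
  fix i
  have *: "scoeff (coeff f k * coeff g l) r
      = (\<Sum>s\<in>splits r. scoeff (coeff f k) s * scoeff (coeff g l) (r - s))" for k l
  proof (rule scoeff_times_sum[OF finite_splits])
    fix s assume "scoeff (coeff f k) s \<noteq> 0" "scoeff (coeff g l) (r - s) \<noteq> 0"
    then have "s \<in> M" "r - s \<in> M" using assms by (auto simp: supp_in_def)
    then show "s \<in> splits r" using nonneg[of "r - s"] by (auto simp: splits_def)
  qed
  show "coeff (slice r (f * g)) i = coeff (\<Sum>s\<in>splits r. slice s f * slice (r - s) g) i"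
    by (simp add: coeff_mult coeff_sum scoeff_sum *) (rule sum.swap)
qed

text \<open>Comparing coefficients of t^r in a product leaves the linear equation g0 * H r + h0 * G
  r = F r - (products of earlier slices). It is solved by recursion over \<open>M\<close>, which is
  well-founded because only finitely many elements lie below each one.\<close>

lemma hensel_coefficients:
  fixes F :: "real \<Rightarrow> 'k::field poly"
  assumes bez: "u * g0 + v * h0 = 1" and lead: "lead_coeff g0 = 1"
    and F0: "F 0 = g0 * h0" and dF: "\<And>r. degree (F r) \<le> n"
  obtains G H where "G 0 = g0" "H 0 = h0" "\<And>r. r \<notin> M \<Longrightarrow> G r = 0" "\<And>r. r \<notin> M \<Longrightarrow> H r = 0"
    "\<And>r. r \<noteq> 0 \<Longrightarrow> G r = 0 \<or> degree (G r) < degree g0" "\<And>r. degree (H r) \<le> n - degree g0"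
    "\<And>r. r \<in> M \<Longrightarrow> (\<Sum>s\<in>splits r. G s * H (r - s)) = F r"
proof -
  have "\<forall>E. \<exists>p. degree E \<le> n \<longrightarrow> g0 * snd p + h0 * fst p = E
      \<and> (fst p = 0 \<or> degree (fst p) < degree g0) \<and> degree (snd p) \<le> n - degree g0"
    using bezout_division[OF bez lead] dF[of 0] F0 by fastforce
  then obtain sol where sol: "\<And>E. degree E \<le> n \<Longrightarrow> g0 * snd (sol E) + h0 * fst (sol E) = E
      \<and> (fst (sol E) = 0 \<or> degree (fst (sol E)) < degree g0) \<and> degree (snd (sol E)) \<le> n - degree g0"
    by metis
  define R where "R = {(s, r). s \<in> M \<and> r \<in> M \<and> s < r}"
  have wfR: "wf R"
  proof (rule wf_subset)
    show "wf (measure (\<lambda>r. card {a \<in> M. a \<le> r}))" by simp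
    show "R \<subseteq> measure (\<lambda>r. card {a \<in> M. a \<le> r})"
    proof (clarsimp simp: R_def)
      fix s r assume "s \<in> M" "r \<in> M" "s < r"
      then show "card {a \<in> M. a \<le> s} < card {a \<in> M. a \<le> r}"
        by (intro psubset_card_mono finite_below) force
    qed
  qed
  \<comment> \<open>The splittings s = 0 and s = r contain the unknown slices and are left out; for
    the others both s and r - s are smaller than r, so the recursion only consults known
    values.\<close>
  define \<Phi> where "\<Phi> = (\<lambda>P r. if r = 0 then (g0, h0) else if r \<in> M then
      sol (F r - (\<Sum>s\<in>splits r - {0, r}. fst (P s) * snd (P (r - s)))) else (0, 0))"
  define P where "P = wfrec R \<Phi>"
  have P: "P r = \<Phi> P r" for r
  proof -
    have "P r = \<Phi> (cut P R r) r" unfolding P_def by (rule wfrec[OF wfR])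
    also have "\<dots> = \<Phi> P r"
    proof (cases "r = 0 \<or> r \<notin> M")
      case True then show ?thesis by (auto simp: \<Phi>_def)
    next
      case False
      have "s \<in> splits r - {0, r} \<Longrightarrow> (s, r) \<in> R \<and> (r - s, r) \<in> R" for s
        using False nonneg[of s] by (auto simp: splits_def R_def)
      then have "(\<Sum>s\<in>splits r - {0, r}. fst (cut P R r s) * snd (cut P R r (r - s)))
        = (\<Sum>s\<in>splits r - {0, r}. fst (P s) * snd (P (r - s)))"
        by (intro sum.cong refl) (simp add: cut_apply)
      then show ?thesis by (simp add: \<Phi>_def)
    qed
    finally show ?thesis .
  qed
  define G where "G r = fst (P r)" for r
  define H where "H r = snd (P r)" for r
  define E where "E r = F r - (\<Sum>s\<in>splits r - {0, r}. G s * H (r - s))" for r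
  have G0: "G 0 = g0" and H0: "H 0 = h0" by (simp_all add: G_def H_def P[of 0] \<Phi>_def)
  have out: "G r = 0" "H r = 0" if "r \<notin> M" for r
    using that zero_mem P[of r] by (auto simp: G_def H_def \<Phi>_def)
  have step: "G r = fst (sol (E r))" "H r = snd (sol (E r))" if "r \<in> M" "r \<noteq> 0" for r
    using that P[of r] by (simp_all add: G_def H_def \<Phi>_def E_def)
  have g0: "g0 \<noteq> 0" using lead by auto
  have dh0: "degree h0 \<le> n - degree g0"
  proof (cases "h0 = 0")
    case False
    then show ?thesis using dF[of 0] F0 g0 by (simp add: degree_mult_eq)
  qed simp
  have dg0n: "degree g0 \<le> n" if "h0 \<noteq> 0"
    using dF[of 0] F0 g0 that by (simp add: degree_mult_eq)
  \<comment> \<open>Natural subtraction: \<open>n - degree g0\<close> must be a true difference for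
    the degree count. If \<open>h0 = 0\<close>, the Bezout identity makes \<open>g0\<close> a unit,
    hence of degree 0.\<close>
  have n_le: "degree g0 \<le> n \<or> degree g0 = 0"
  proof (cases "h0 = 0")
    case True
    then have "u * g0 = 1" using bez by simp
    then have "g0 dvd 1" by (metis dvd_triv_right)
    then show ?thesis using g0 by (simp add: is_unit_iff_degree)
  qed (use dg0n in simp)
  have dGH: "(r = 0 \<or> G r = 0 \<or> degree (G r) < degree g0) \<and> degree (H r) \<le> n - degree g0
      \<and> (r \<in> M \<longrightarrow> r \<noteq> 0 \<longrightarrow> degree (E r) \<le> n)" for r
  proof (induction r rule: wf_induct_rule[OF wfR])
    case (1 r)
    show ?case
    proof (cases "r = 0 \<or> r \<notin> M")
      case True then show ?thesis using out H0 dh0 by auto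
    next
      case False
      have "degree (G s * H (r - s)) \<le> n" if s: "s \<in> splits r - {0, r}" for s
      proof -
        have "(s, r) \<in> R" "(r - s, r) \<in> R"
          using s False nonneg[of s] by (auto simp: splits_def R_def)
        then have "G s = 0 \<or> degree (G s) < degree g0" "degree (H (r - s)) \<le> n - degree g0"
          using 1 s by auto
        then show ?thesis
          using degree_mult_le[of "G s" "H (r - s)"] n_le by (cases "G s = 0") auto
      qed
      then have "degree (E r) \<le> n"
        unfolding E_def by (intro degree_diff_le dF degree_sum_le finite_Diff finite_splits) auto
      then show ?thesis using sol[of "E r"] step[of r] False by auto
    qed
  qed
  have "(\<Sum>s\<in>splits r. G s * H (r - s)) = F r" if r: "r \<in> M" for r
  proof (cases "r = 0")
    case True
    have "splits 0 = {0}" using zero_mem nonneg by (force simp: splits_def)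
    then show ?thesis using True G0 H0 F0 by simp
  next
    case False
    have "splits r = insert 0 (insert r (splits r - {0, r}))"
      using r zero_mem nonneg[of r] by (auto simp: splits_def)
    then have "(\<Sum>s\<in>splits r. G s * H (r - s))
        = (\<Sum>s\<in>insert 0 (insert r (splits r - {0, r})). G s * H (r - s))" by simp
    also have "\<dots> = g0 * H r + (G r * h0 + (\<Sum>s\<in>splits r - {0, r}. G s * H (r - s)))"
      using False finite_splits[of r] G0 H0 by simp
    also have "\<dots> = E r + (\<Sum>s\<in>splits r - {0, r}. G s * H (r - s))"
      using sol[of "E r"] dGH[of r] step[OF r False] r False by (simp add: algebra_simps)
    finally show ?thesis by (simp add: E_def)
  qed
  then show ?thesis using that[of G H] G0 H0 out dGH by blast
qed

text \<open>The slices are reassembled coefficientwise into series. Among the slices of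
  \<open>g\<close> only the one at 0 reaches \<open>degree g0\<close>, which makes \<open>g\<close>
  monic; \<open>h\<close> takes up the leading coefficient of \<open>f\<close>.\<close>

lemma hensel:
  fixes f :: "'k::field lfs poly"
  assumes f: "\<And>i. supp_in M (coeff f i)" and deg: "degree f \<le> n"
    and fac: "slice 0 f = g0 * h0" and lead: "lead_coeff g0 = 1" and bez: "u * g0 + v * h0 = 1"
  obtains g h where "f = g * h" "\<And>i. supp_in M (coeff g i)" "\<And>i. supp_in M (coeff h i)"
    "degree g = degree g0" "lead_coeff g = 1" "degree h \<le> n - degree g0"
proof -
  have dF: "degree (slice r f) \<le> n" for r
    using degree_slice_le deg le_trans by blast
  obtain G H where G0: "G 0 = g0" and H0: "H 0 = h0"
    and out: "\<And>r. r \<notin> M \<Longrightarrow> G r = 0" "\<And>r. r \<notin> M \<Longrightarrow> H r = 0"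
    and dG: "\<And>r. r \<noteq> 0 \<Longrightarrow> G r = 0 \<or> degree (G r) < degree g0"
    and dH: "\<And>r. degree (H r) \<le> n - degree g0"
    and conv: "\<And>r. r \<in> M \<Longrightarrow> (\<Sum>s\<in>splits r. G s * H (r - s)) = slice r f"
    using hensel_coefficients[of u g0 v h0 "\<lambda>r. slice r f", OF bez lead fac dF] by blast
  have fin: "finite {r. r \<le> c \<and> coeff (X r) i \<noteq> 0}"
    if "\<And>r. r \<notin> M \<Longrightarrow> X r = 0" for X :: "real \<Rightarrow> 'k poly" and c i
    by (rule finite_subset[OF _ finite_below[of c]]) (use that in force)
  define asm where "asm X m = Abs_poly (\<lambda>i. if i \<le> m then Abs_lfs (\<lambda>r. coeff (X r) i) else 0)"
    for X :: "real \<Rightarrow> 'k poly" and m :: nat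
  have asm: "scoeff (coeff (asm X m) i) r = coeff (X r) i"
    if "\<And>r. r \<notin> M \<Longrightarrow> X r = 0" "\<And>r. degree (X r) \<le> m" for X m i r
  proof -
    have "coeff (asm X m) = (\<lambda>i. if i \<le> m then Abs_lfs (\<lambda>r. coeff (X r) i) else 0)"
      unfolding asm_def by (rule coeff_Abs_poly[of m]) auto
    moreover have "coeff (X r) i = 0" if "\<not> i \<le> m"
      using that \<open>degree (X r) \<le> m\<close> by (intro coeff_eq_0) simp
    ultimately show ?thesis using fin[OF that(1)] by (auto simp: scoeff_Abs)
  qed
  have dG': "degree (G r) \<le> degree g0" for r
    using dG[of r] G0 by (cases "r = 0") auto
  define g where "g = asm G (degree g0)"
  define h where "h = asm H (n - degree g0)"
  have cg: "scoeff (coeff g i) r = coeff (G r) i" for i r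
    unfolding g_def by (rule asm) (use out dG' in auto)
  have ch: "scoeff (coeff h i) r = coeff (H r) i" for i r
    unfolding h_def by (rule asm) (use out dH in auto)
  have sg: "supp_in M (coeff g i)" and sh: "supp_in M (coeff h i)" for i
    using out by (force simp: supp_in_def cg ch)+
  have slg: "slice r g = G r" and slh: "slice r h = H r" for r
    by (simp_all add: poly_eq_iff cg ch)
  have "f = g * h"
  proof (rule poly_eqI, rule lfs_eqI)
    fix i r
    have "slice r f = slice r (g * h)"
    proof (cases "r \<in> M")
      case True
      then show ?thesis by (simp add: slice_mult[OF sg sh] slg slh conv)
    next
      case False
      then have "splits r = {}" using add_mem by (force simp: splits_def)
      moreover have "slice r f = 0" using f False by (auto simp: poly_eq_iff supp_in_def)
      ultimately show ?thesis by (simp add: slice_mult[OF sg sh])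
    qed
    then show "scoeff (coeff f i) r = scoeff (coeff (g * h) i) r" by (metis coeff_slice)
  qed
  moreover have deg_g: "degree g \<le> degree g0"
  proof (rule degree_le_coeff, rule lfs_eqI)
    fix i r assume i: "i > degree g0"
    then have "coeff (G r) i = 0" using dG'[of r] by (intro coeff_eq_0) simp
    then show "scoeff (coeff g i) r = scoeff 0 r" by (simp add: cg)
  qed
  moreover have lead_g: "coeff g (degree g0) = 1"
  proof (rule lfs_eqI)
    fix r
    have "coeff (G r) (degree g0) = 0" if "r \<noteq> 0"
      using dG[OF that] by (auto intro: coeff_eq_0)
    then show "scoeff (coeff g (degree g0)) r = scoeff 1 r"
      using lead by (cases "r = 0") (simp_all add: cg G0 scoeff_1)
  qed
  moreover have "degree h \<le> n - degree g0"
  proof (rule degree_le_coeff, rule lfs_eqI)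
    fix i r assume i: "i > n - degree g0"
    then have "coeff (H r) i = 0" using dH[of r] by (intro coeff_eq_0) simp
    then show "scoeff (coeff h i) r = scoeff 0 r" by (simp add: ch)
  qed
  moreover have "degree g = degree g0"
    using deg_g lead_g le_degree[of g "degree g0"] by simp
  ultimately show ?thesis using that[of g h] sg sh by simp
qed

end

section \<open>An algebraically closed field of series\<close>

inductive_set mon :: "real set \<Rightarrow> real set" for V where
  zero: "0 \<in> mon V"
| add: "x \<in> mon V \<Longrightarrow> v \<in> V \<Longrightarrow> x + v \<in> mon V"

lemma mon_generator: "v \<in> V \<Longrightarrow> v \<in> mon V"
  using mon.add[OF mon.zero, of v V] by simp

lemma mon_add: "y \<in> mon V \<Longrightarrow> x \<in> mon V \<Longrightarrow> x + y \<in> mon V"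
  by (induction rule: mon.induct) (auto simp: add.assoc[symmetric] intro: mon.add)

lemma mon_mono: "x \<in> mon V \<Longrightarrow> V \<subseteq> W \<Longrightarrow> x \<in> mon W"
  by (induction rule: mon.induct) (auto intro: mon.zero mon.add)

lemma mon_nonneg: "x \<in> mon V \<Longrightarrow> V \<subseteq> {0<..} \<Longrightarrow> 0 \<le> x"
  by (induction rule: mon.induct) (auto simp: subset_iff intro!: add_nonneg_nonneg less_imp_le)

text \<open>Every generator is at least the minimum \<open>e\<close>, so an element below (k+1) e is
  either 0 or a generator added to an element below k e.\<close>

lemma finite_mon_below:
  assumes "finite V" "V \<subseteq> {0<..}"
  shows "finite {x \<in> mon V. x \<le> c}"
proof (cases "V = {}")
  case True
  have "x = 0" if "x \<in> mon V" for x using that True by (induction rule: mon.induct) auto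
  then have "{x \<in> mon V. x \<le> c} \<subseteq> {0}" by auto
  then show ?thesis using finite_subset by blast
next
  case False
  define e where "e = Min V"
  have e: "e > 0" "\<And>v. v \<in> V \<Longrightarrow> e \<le> v"
    using assms False by (auto simp: e_def)
  have *: "finite {x \<in> mon V. x < real k * e}" for k
  proof (induction k)
    case 0
    have "\<not> x < 0" if "x \<in> mon V" for x using mon_nonneg[OF that assms(2)] by simp
    then have "{x \<in> mon V. x < real 0 * e} = {}" by auto
    then show ?case by (simp only: finite.emptyI)
  next
    case (Suc k)
    have "{x \<in> mon V. x < real (Suc k) * e}
        \<subseteq> insert 0 ((\<lambda>(x, v). x + v) ` ({x \<in> mon V. x < real k * e} \<times> V))"
    proof
      fix x assume x: "x \<in> {x \<in> mon V. x < real (Suc k) * e}"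
      then have "x \<in> mon V" by simp
      then show "x \<in> insert 0 ((\<lambda>(x, v). x + v) ` ({x \<in> mon V. x < real k * e} \<times> V))"
      proof cases
        case (add y v)
        then have "y < real k * e" using x e(2)[of v] by (simp add: algebra_simps)
        then show ?thesis using add by (intro insertI2 image_eqI[of _ _ "(y, v)"]) auto
      qed simp
    qed
    moreover have "finite \<dots>" using Suc assms(1) by auto
    ultimately show ?case by (rule finite_subset)
  qed
  obtain k :: nat where "c < real k * e" using reals_Archimedean3[OF e(1)] by blast
  then have "{x \<in> mon V. x \<le> c} \<subseteq> {x \<in> mon V. x < real k * e}" by auto
  then show ?thesis using * finite_subset by blast
qed

lemma left_finite_monoid_mon:
  "finite V \<Longrightarrow> V \<subseteq> {0<..} \<Longrightarrow> left_finite_monoid (mon V)"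
  by unfold_locales (auto intro: mon.zero mon_add mon_nonneg finite_mon_below)

section \<open>Series supported in translates of finitely generated monoids\<close>

lemma supp_in_mono: "supp_in M F \<Longrightarrow> M \<subseteq> N \<Longrightarrow> supp_in N F"
  by (auto simp: supp_in_def)

text \<open>Modelled on the group of all weights \<omega>\<cdot>\<alpha> with rational \<alpha>.
  Divisibility is what keeps the slopes of a Newton polygon inside \<open>D\<close>; a positive
  element provides elements below any bound.\<close>

locale divisible_group =
  fixes D :: "real set"
  assumes D_zero: "0 \<in> D" and D_add: "a \<in> D \<Longrightarrow> b \<in> D \<Longrightarrow> a + b \<in> D"
    and D_uminus: "a \<in> D \<Longrightarrow> - a \<in> D"
    and D_divide: "a \<in> D \<Longrightarrow> n > 0 \<Longrightarrow> a / real n \<in> D"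
    and D_pos: "\<exists>d\<in>D. d > 0"
begin

lemma D_diff: "a \<in> D \<Longrightarrow> b \<in> D \<Longrightarrow> a - b \<in> D"
  using D_add[of a "- b"] D_uminus[of b] by simp

lemma D_mult_nat: "a \<in> D \<Longrightarrow> real n * a \<in> D"
  by (induction n) (auto simp: D_zero algebra_simps intro: D_add)

lemma D_below: "\<exists>d\<in>D. d < c"
proof -
  obtain d where d: "d \<in> D" "d > 0" using D_pos by blast
  obtain n :: nat where "- c < real n * d" using reals_Archimedean3[OF d(2)] by blast
  then show ?thesis using D_uminus[OF D_mult_nat[OF d(1), of n]] by (intro bexI[of _ "- (real n * d)"]) auto
qed

lemma mon_D: "x \<in> mon V \<Longrightarrow> V \<subseteq> D \<Longrightarrow> x \<in> D"
  by (induction rule: mon.induct) (auto intro: D_zero D_add)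

text \<open>Series of this form come back from Puiseux series: the shift \<gamma> becomes a monomial
  factor, and lifts of the finitely many generators span the cone and have a common
  denominator.\<close>

definition T :: "'a::comm_ring_1 lfs set" where
  "T = {F. \<exists>\<gamma>\<in>D. \<exists>V. finite V \<and> V \<subseteq> D \<and> V \<subseteq> {0<..} \<and> (\<forall>r. scoeff F r \<noteq> 0 \<longrightarrow> r - \<gamma> \<in> mon V)}"

lemma TI:
  assumes "\<gamma> \<in> D" "finite V" "V \<subseteq> D" "V \<subseteq> {0<..}" "\<And>r. scoeff F r \<noteq> 0 \<Longrightarrow> r - \<gamma> \<in> mon V"
  shows "F \<in> T"
  using assms unfolding T_def by blast

lemma TE:
  assumes "F \<in> T"
  obtains \<gamma> V where "\<gamma> \<in> D" "finite V" "V \<subseteq> D" "V \<subseteq> {0<..}" "\<And>r. scoeff F r \<noteq> 0 \<Longrightarrow> r - \<gamma> \<in> mon V"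
  using assms unfolding T_def by blast

lemma T_supp: "F \<in> T \<Longrightarrow> scoeff F r \<noteq> 0 \<Longrightarrow> r \<in> D"
  by (metis TE D_add diff_add_cancel mon_D)

lemma T_sconst: "d \<in> D \<Longrightarrow> sconst c d \<in> T"
  by (rule TI[of d "{}"]) (auto intro: mon.zero split: if_splits)

lemma T_0: "0 \<in> T" and T_1: "1 \<in> T"
  using T_sconst[OF D_zero, of 0] T_sconst[OF D_zero, of 1] by (simp_all add: sconst_1)

lemma T_mult:
  assumes "F \<in> T" "G \<in> T" shows "F * G \<in> T"
proof -
  obtain \<gamma> V where V: "\<gamma> \<in> D" "finite V" "V \<subseteq> D" "V \<subseteq> {0<..}" "\<And>r. scoeff F r \<noteq> 0 \<Longrightarrow> r - \<gamma> \<in> mon V"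
    using TE[OF assms(1)] by blast
  obtain \<delta> W where W: "\<delta> \<in> D" "finite W" "W \<subseteq> D" "W \<subseteq> {0<..}" "\<And>r. scoeff G r \<noteq> 0 \<Longrightarrow> r - \<delta> \<in> mon W"
    using TE[OF assms(2)] by blast
  show ?thesis
  proof (rule TI[of "\<gamma> + \<delta>" "V \<union> W"])
    fix r assume "scoeff (F * G) r \<noteq> 0"
    then obtain s where "scoeff F s \<noteq> 0" "scoeff G (r - s) \<noteq> 0" by (rule scoeff_times_nonzero)
    then have "s - \<gamma> \<in> mon (V \<union> W)" "r - s - \<delta> \<in> mon (V \<union> W)"
      using V W mon_mono by (metis Un_upper1, metis Un_upper2)
    then have "(s - \<gamma>) + (r - s - \<delta>) \<in> mon (V \<union> W)" by (intro mon_add)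
    then show "r - (\<gamma> + \<delta>) \<in> mon (V \<union> W)" by (simp add: algebra_simps)
  qed (use V W D_add in auto)
qed

text \<open>Both supports are referred to a base \<open>e\<close> below the two shifts; the gaps
  \<gamma> - e and \<delta> - e become additional positive generators.\<close>

lemma T_add:
  assumes "F \<in> T" "G \<in> T" shows "F + G \<in> T"
proof -
  obtain \<gamma> V where V: "\<gamma> \<in> D" "finite V" "V \<subseteq> D" "V \<subseteq> {0<..}" "\<And>r. scoeff F r \<noteq> 0 \<Longrightarrow> r - \<gamma> \<in> mon V"
    using TE[OF assms(1)] by blast
  obtain \<delta> W where W: "\<delta> \<in> D" "finite W" "W \<subseteq> D" "W \<subseteq> {0<..}" "\<And>r. scoeff G r \<noteq> 0 \<Longrightarrow> r - \<delta> \<in> mon W"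
    using TE[OF assms(2)] by blast
  obtain e where e: "e \<in> D" "e < \<gamma>" "e < \<delta>" using D_below[of "min \<gamma> \<delta>"] by auto
  let ?U = "V \<union> W \<union> {\<gamma> - e, \<delta> - e}"
  show ?thesis
  proof (rule TI[of e ?U])
    fix r assume "scoeff (F + G) r \<noteq> 0"
    then have "scoeff F r \<noteq> 0 \<or> scoeff G r \<noteq> 0" by auto
    then have "\<exists>g\<in>{\<gamma> - e, \<delta> - e}. r - e - g \<in> mon (V \<union> W)"
    proof
      assume "scoeff F r \<noteq> 0"
      then have "r - e - (\<gamma> - e) \<in> mon (V \<union> W)" using V mon_mono[of "r - \<gamma>" V "V \<union> W"] by simp
      then show ?thesis by blast
    next
      assume "scoeff G r \<noteq> 0"
      then have "r - e - (\<delta> - e) \<in> mon (V \<union> W)" using W mon_mono[of "r - \<delta>" W "V \<union> W"] by simp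
      then show ?thesis by blast
    qed
    then obtain g where "g \<in> {\<gamma> - e, \<delta> - e}" "r - e - g \<in> mon (V \<union> W)" by blast
    then have "(r - e - g) + g \<in> mon ?U" by (intro mon.add) (auto intro: mon_mono)
    then show "r - e \<in> mon ?U" by simp
  qed (use e V W D_diff in auto)
qed

lemma T_uminus: "F \<in> T \<Longrightarrow> - F \<in> T"
  unfolding T_def by auto

lemma T_sum: "(\<And>x. x \<in> A \<Longrightarrow> f x \<in> T) \<Longrightarrow> sum f A \<in> T"
  by (induction A rule: infinite_finite_induct) (auto intro: T_0 T_add)

text \<open>If removing generators one at a time keeps the exponent \<open>\<gamma> + x\<close> nonnegative, one can
  stop at one of the finitely many nonnegative exponents below a generator; adding these
  exponents to the generators absorbs the shift \<open>\<gamma>\<close>.\<close>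
lemma T_nonneg_supp:
  assumes "F \<in> T" "vge 0 F"
  shows "\<exists>V. finite V \<and> V \<subseteq> D \<and> V \<subseteq> {0<..} \<and> supp_in (mon V) F"
proof -
  obtain \<gamma> V where V: "\<gamma> \<in> D" "finite V" "V \<subseteq> D" "V \<subseteq> {0<..}" "\<And>r. scoeff F r \<noteq> 0 \<Longrightarrow> r - \<gamma> \<in> mon V"
    using TE[OF assms(1)] by blast
  \<comment> \<open>\<open>B\<close> bounds \<gamma> itself as well as every exponent reached from a
    negative one by adding a single generator.\<close>
  define B where "B = Max (insert \<gamma> V)"
  have B: "\<gamma> \<le> B" "\<And>v. v \<in> V \<Longrightarrow> v \<le> B" using V(2) by (auto simp: B_def)
  define N where "N = (\<lambda>x. \<gamma> + x) ` {x \<in> mon V. x \<le> B - \<gamma>}"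
  define W where "W = V \<union> {n \<in> N. n > 0}"
  have N: "n \<in> mon W" if "n \<in> N" "n \<ge> 0" for n
    using that mon_generator[of n W] mon.zero by (cases "n = 0") (auto simp: W_def)
  have *: "\<gamma> + x \<in> mon W" if "x \<in> mon V" "\<gamma> + x \<ge> 0" for x
    using that
  proof (induction rule: mon.induct)
    case zero
    have "\<gamma> \<in> N" unfolding N_def using B(1) mon.zero by (intro image_eqI[of _ _ 0]) auto
    then show ?case using N zero by simp
  next
    case (add x v)
    show ?case
    proof (cases "\<gamma> + x \<ge> 0")
      case True
      then have "\<gamma> + x \<in> mon W" using add by blast
      then have "\<gamma> + x + v \<in> mon W" by (rule mon.add) (use add in \<open>simp add: W_def\<close>)
      then show ?thesis by (simp add: add.assoc)
    next
      case False
      then have "\<gamma> + (x + v) \<in> N"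
        unfolding N_def using B(2)[of v] add by (intro imageI) (auto intro: mon.add)
      then show ?thesis using N add by simp
    qed
  qed
  have "supp_in (mon W) F"
    unfolding supp_in_def
  proof (intro allI impI)
    fix r assume r: "scoeff F r \<noteq> 0"
    then have "r \<ge> 0" using assms(2) by (auto simp: vge_def not_less[symmetric])
    then show "r \<in> mon W" using *[OF V(5)[OF r]] by simp
  qed
  moreover have "finite W"
    unfolding W_def N_def using V finite_mon_below by auto
  moreover have "W \<subseteq> D" "W \<subseteq> {0<..}"
    using V mon_D D_add by (auto simp: W_def N_def)
  ultimately show ?thesis by blast
qed

lemma supp_in_T: "finite V \<Longrightarrow> V \<subseteq> D \<Longrightarrow> V \<subseteq> {0<..} \<Longrightarrow> supp_in (mon V) F \<Longrightarrow> F \<in> T"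
  by (rule TI[of 0 V]) (auto simp: supp_in_def D_zero)

lemma common_monoid:
  assumes "finite A" "\<And>F. F \<in> A \<Longrightarrow> F \<in> T \<and> vge 0 F"
  obtains V where "finite V" "V \<subseteq> D" "V \<subseteq> {0<..}" "\<And>F. F \<in> A \<Longrightarrow> supp_in (mon V) F"
proof -
  have "\<forall>F\<in>A. \<exists>V. finite V \<and> V \<subseteq> D \<and> V \<subseteq> {0<..} \<and> supp_in (mon V) F"
    using assms(2) T_nonneg_supp by blast
  then obtain V where V: "\<forall>F\<in>A. finite (V F) \<and> V F \<subseteq> D \<and> V F \<subseteq> {0<..} \<and> supp_in (mon (V F)) F"
    by metis
  show ?thesis
  proof (rule that[of "\<Union>(V ` A)"])
    fix F assume F: "F \<in> A"
    then show "supp_in (mon (\<Union>(V ` A))) F"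
      using V mon_mono by (metis (no_types, lifting) UN_upper supp_in_mono subsetI)
  qed (use V assms(1) in auto)
qed

text \<open>Inversion as a Hensel lift. After division by the leading power of t, the polynomial F'
  y - 1 reduces to c (y - 1/c) with c nonzero. The lifted monic factor y + u leaves a constant
  cofactor equal to F', so -u inverts F', with support in the same monoid.\<close>

lemma T_inverse:
  fixes F :: "'k::field lfs"
  assumes "F \<in> T" "F \<noteq> 0"
  obtains G where "G \<in> T" "F * G = 1"
proof -
  obtain m where m: "vge m F" "scoeff F m \<noteq> 0" using leading_exponentE[OF assms(2)] .
  have mD: "m \<in> D" using T_supp assms(1) m(2) by blast
  define F' where "F' = sconst 1 (- m) * F"
  have F': "F' \<in> T" unfolding F'_def by (intro T_mult T_sconst D_uminus mD assms)
  have v: "vge 0 F'" using m by (auto simp: F'_def vge_def)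
  define c where "c = scoeff F' 0"
  have c: "c \<noteq> 0" using m by (simp add: c_def F'_def)
  obtain V where V: "finite V" "V \<subseteq> D" "V \<subseteq> {0<..}" "supp_in (mon V) F'"
    using T_nonneg_supp[OF F' v] by blast
  interpret left_finite_monoid "mon V" using V left_finite_monoid_mon by blast
  define f where "f = [:-1, F':]"
  have sf: "supp_in (mon V) (coeff f i)" for i
    using V(4) mon.zero by (auto simp: f_def supp_in_def coeff_pCons scoeff_1 split: nat.splits if_splits)
  have sl: "slice 0 f = [:- (1 / c), 1:] * [:c:]"
    using c by (auto simp: poly_eq_iff f_def coeff_pCons scoeff_1 c_def split: nat.splits)
  have bz: "0 * [:- (1 / c), 1:] + [:1 / c:] * [:c:] = 1" using c by (simp add: one_pCons)
  have df: "degree f \<le> 1" by (simp add: f_def)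
  have l1: "lead_coeff [:- (1 / c), 1:] = 1" by simp
  obtain g h where gh: "f = g * h" "\<And>i. supp_in (mon V) (coeff g i)"
      "degree g = 1" "lead_coeff g = 1" "degree h \<le> 0"
    using hensel[OF sf df sl l1 bz] by (metis degree_pCons_eq_if diff_self_eq_0 one_neq_zero One_nat_def degree_1 pCons_eq_0_iff)
  have "g = [:coeff g 0, 1:]"
    using gh(3,4) by (intro poly_eqI) (auto simp: coeff_pCons coeff_eq_0 split: nat.splits)
  then obtain u where u: "g = [:u, 1:]" by blast
  obtain w where w: "h = [:w:]" using gh(5) degree_eq_zeroE by blast
  have "- 1 = w * u" "F' = w" using gh(1) by (simp_all add: u w f_def)
  then have "F' * - u = 1" by (metis minus_minus mult_minus_right)
  moreover have "u \<in> T" using gh(2)[of 0] supp_in_T V by (simp add: u)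
  ultimately have "F * (sconst 1 (- m) * - u) = 1" "sconst 1 (- m) * - u \<in> T"
    by (auto simp: F'_def mult_ac intro!: T_mult T_sconst D_uminus mD T_uminus)
  then show ?thesis using that by blast
qed

section \<open>Polynomials over these series and their roots\<close>

definition polyT :: "'a::comm_ring_1 lfs poly \<Rightarrow> bool" where
  "polyT p \<longleftrightarrow> (\<forall>i. coeff p i \<in> T)"

lemma polyT_pCons: "polyT (pCons a p) \<longleftrightarrow> a \<in> T \<and> polyT p"
proof
  assume *: "polyT (pCons a p)"
  have "a \<in> T" using *[unfolded polyT_def, rule_format, of 0] by simp
  moreover have "coeff p i \<in> T" for i using *[unfolded polyT_def, rule_format, of "Suc i"] by simp
  ultimately show "a \<in> T \<and> polyT p" by (simp add: polyT_def)
qed (auto simp: polyT_def coeff_pCons split: nat.splits)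

lemma polyT_0: "polyT 0" by (simp add: polyT_def T_0)

lemma polyT_add: "polyT p \<Longrightarrow> polyT q \<Longrightarrow> polyT (p + q)"
  by (simp add: polyT_def T_add)

lemma polyT_mult: "polyT p \<Longrightarrow> polyT q \<Longrightarrow> polyT (p * q)"
  by (simp add: polyT_def coeff_mult T_sum T_mult)

lemma polyT_smult: "a \<in> T \<Longrightarrow> polyT p \<Longrightarrow> polyT (smult a p)"
  by (simp add: polyT_def T_mult)

lemma polyT_pcompose: "polyT p \<Longrightarrow> polyT q \<Longrightarrow> polyT (pcompose p q)"
  by (induction p) (auto simp: polyT_0 pcompose_pCons polyT_pCons intro!: polyT_add polyT_mult)

end

text \<open>The two top coefficients of p(y + s), as needed for the Tschirnhaus shift: the one below
  the top depends affinely on s.\<close>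

lemma coeff_translate:
  fixes p :: "'a::comm_ring_1 poly"
  assumes "degree p \<le> Suc n"
  shows "coeff (pcompose p [:s, 1:]) n = coeff p n + of_nat (Suc n) * s * coeff p (Suc n)
    \<and> coeff (pcompose p [:s, 1:]) (Suc n) = coeff p (Suc n)"
  using assms
proof (induction n arbitrary: p)
  case 0
  then have "p = [:coeff p 0, coeff p 1:]"
    by (intro poly_eqI) (auto simp: coeff_pCons coeff_eq_0 split: nat.splits)
  then obtain a b where "p = [:a, b:]" by blast
  then show ?case by (simp add: pcompose_pCons algebra_simps)
next
  case (Suc n)
  obtain a q where p: "p = pCons a q" by (cases p)
  have dq: "degree q \<le> Suc n" using Suc.prems p by (cases "q = 0") auto
  have "degree (pcompose q [:s, 1:]) \<le> degree q * 1"
    using degree_pcompose_le[of q "[:s, 1:]"] by simp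
  then have z: "coeff (pcompose q [:s, 1:]) (Suc (Suc n)) = 0"
    using dq by (intro coeff_eq_0) simp
  show ?case
    using Suc.IH[OF dq] z by (simp add: p pcompose_pCons algebra_simps)
qed

text \<open>Let w be \<open>h\<close> scaled to the value 1 at \<open>c\<close>. Then y - c divides
  1 - w, so its k-th power divides (1 - w)^k, while 1 - (1 - w)^k is a multiple of w.\<close>

lemma bezout_power_linear:
  fixes h :: "'k::field poly"
  assumes "poly h c \<noteq> 0"
  shows "\<exists>u v. u * [:-c, 1:] ^ k + v * h = 1"
proof -
  define w where "w = smult (1 / poly h c) h"
  have "poly (1 - w) c = 0" using assms by (simp add: w_def)
  then obtain s where s: "1 - w = [:-c, 1:] * s" using poly_eq_0_iff_dvd by blast
  have "1 - (1 - w) ^ k = w * (\<Sum>i<k. (1 - w) ^ i)"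
    using one_diff_power_eq[of "1 - w" k] by simp
  moreover have "(1 - w) ^ k = s ^ k * [:-c, 1:] ^ k"
    unfolding s power_mult_distrib by (rule mult.commute)
  ultimately have "s ^ k * [:-c, 1:] ^ k + (\<Sum>i<k. (1 - w) ^ i) * w = 1"
    by (metis add_diff_cancel_left' diff_add_cancel mult.commute add.commute)
  then have "s ^ k * [:-c, 1:] ^ k + smult (1 / poly h c) (\<Sum>i<k. (1 - w) ^ i) * h = 1"
    unfolding w_def by (simp only: mult_smult_left mult_smult_right)
  then show ?thesis by blast
qed

context divisible_group
begin

text \<open>The coefficient of degree \<open>n - 1\<close> vanishes and the reduction is not a power of the variable,
  hence the reduction has two different roots and splits into coprime factors.\<close>
lemma hensel_split:
  fixes q :: "'k::{alg_closed_field, field_char_0} lfs poly"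
  assumes q: "polyT q" "\<forall>i. vge 0 (coeff q i)" "lead_coeff q = 1" "degree q = Suc m"
    and sub: "coeff q m = 0" and nz: "i0 \<le> m" "scoeff (coeff q i0) 0 \<noteq> 0"
  obtains g h where "q = g * h" "polyT g" "0 < degree g" "degree g \<le> m"
proof -
  obtain V where V: "finite V" "V \<subseteq> D" "V \<subseteq> {0<..}" and sV: "\<And>F. F \<in> coeff q ` {..Suc m} \<Longrightarrow> supp_in (mon V) F"
    using common_monoid[of "coeff q ` {..Suc m}"] q(1,2) unfolding polyT_def by blast
  have sq: "supp_in (mon V) (coeff q i)" for i
  proof (cases "i \<le> Suc m")
    case False
    then show ?thesis using q(4) by (simp add: coeff_eq_0 supp_in_def)
  qed (use sV in auto)
  interpret left_finite_monoid "mon V" using V left_finite_monoid_mon by blast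
  define p where "p = slice 0 q"
  have cp: "coeff p (Suc m) = 1" using q(3,4) by (simp add: p_def scoeff_1)
  have dp: "degree p = Suc m"
    using cp degree_slice_le[of 0 q] q(4) le_degree[of p "Suc m"] by (simp add: p_def)
  have cm: "coeff p m = 0" using sub by (simp add: p_def)
  have p0: "p \<noteq> 0" using dp by auto
  obtain c where c: "poly p c = 0" using alg_closed_imp_poly_has_root[of p] dp by auto
  define k where "k = order c p"
  obtain h0 where h0: "p = [:-c, 1:] ^ k * h0" "\<not> [:-c, 1:] dvd h0"
    using order_decomp[OF p0] unfolding k_def by blast
  have k: "k > 0" using c p0 by (simp add: k_def order_gt_0_iff)
  have h0c: "poly h0 c \<noteq> 0" using h0(2) by (simp add: poly_eq_0_iff_dvd)
  have h00: "h0 \<noteq> 0" using h0c by auto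
  have dk: "degree ([:-c, 1:] ^ k) = k" by (simp add: degree_power_eq)
  have ph: "[:-c, 1:] ^ k \<noteq> 0" by simp
  have dsum: "k + degree h0 = Suc m"
    using dp dk h00 unfolding h0(1) by (simp add: degree_mult_eq)
  have lk: "lead_coeff ([:-c, 1:] ^ k) = 1" by (simp add: lead_coeff_power)
  \<comment> \<open>With a single root the reduction is (y - c)^(m+1), whose coefficient of degree m
    is -(m+1) c. Characteristic zero forces c = 0, and then no lower coefficient survives.\<close>
  have km: "k \<le> m"
  proof (rule ccontr)
    assume "\<not> k \<le> m"
    then have dh: "degree h0 = 0" and kk: "k = Suc m" using dsum by auto
    then obtain b where b: "h0 = [:b:]" using degree_eq_zeroE by blast
    have "lead_coeff p = b" unfolding h0(1) b by (simp add: lead_coeff_mult lk lead_coeff_power)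
    then have "b = 1" using cp dp by simp
    then have pp: "p = [:-c, 1:] ^ Suc m" using h0(1) b kk by simp
    have "pcompose (monom 1 (Suc m)) [:-c, 1:] = [:-c, 1:] ^ Suc m"
      by (simp add: pcompose_altdef poly_monom map_poly_monom)
    then have "p = pcompose (monom 1 (Suc m)) [:-c, 1:]" using pp by simp
    then have "coeff p m = of_nat (Suc m) * (- c)"
      using coeff_translate[of "monom 1 (Suc m)" m "-c"] by (simp add: degree_monom_eq)
    then have "c = 0" using cm by (metis mult_eq_0_iff neg_equal_0_iff_equal of_nat_neq_0)
    then have "p = monom 1 (Suc m)" using pp by (simp add: monom_altdef)
    then show False using nz by (metis coeff_monom coeff_slice not_less_eq_eq order_refl p_def)
  qed
  obtain u v where bz: "u * [:-c, 1:] ^ k + v * h0 = 1" using bezout_power_linear[OF h0c] by blast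
  obtain g h where gh: "q = g * h" "\<And>i. supp_in (mon V) (coeff g i)" "degree g = k"
    using hensel[OF sq eq_imp_le[OF q(4)] h0(1)[unfolded p_def] lk bz] unfolding dk by blast
  then have "polyT g" using supp_in_T[OF V gh(2)] by (simp add: polyT_def)
  then show ?thesis using that[of g h] gh k km by simp
qed

text \<open>The least slope of the Newton polygon: \<gamma> is the minimum of v i / (m + 1 - i) over
  the nonzero lower coefficients, v i being their orders, and q'(z) = t^(-(m+1)\<gamma>)
  q(t^\<gamma> z). Minimality makes all orders nonnegative, and an index attaining it has order
  0.\<close>

lemma scaled_polynomial:
  fixes q :: "'k::field lfs poly"
  assumes "polyT q" "lead_coeff q = 1" "degree q = Suc m" "coeff q m = 0" "q \<noteq> monom 1 (Suc m)"
  obtains a q' i where "a \<in> T" "polyT q'" "\<forall>i. vge 0 (coeff q' i)" "lead_coeff q' = 1" "degree q' = Suc m"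
    "coeff q' m = 0" "i \<le> m" "scoeff (coeff q' i) 0 \<noteq> 0"
    "\<forall>z. poly q' z = 0 \<longrightarrow> poly q (a * z) = 0"
proof -
  define S where "S = {i. i \<le> m \<and> coeff q i \<noteq> 0}"
  have "S \<noteq> {}"
  proof
    assume S: "S = {}"
    have "q = monom 1 (Suc m)"
    proof (rule poly_eqI)
      fix i
      consider "i \<le> m" | "i = Suc m" | "i > Suc m" by linarith
      then show "coeff q i = coeff (monom 1 (Suc m)) i"
        using S assms(2,3) by cases (auto simp: S_def coeff_eq_0)
    qed
    then show False using assms by simp
  qed
  have finS: "finite S" by (simp add: S_def)
  have "\<forall>i\<in>S. \<exists>r. vge r (coeff q i) \<and> scoeff (coeff q i) r \<noteq> 0"
    using leading_exponentE by (metis (mono_tags, lifting) S_def mem_Collect_eq)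
  then obtain v where v: "\<And>i. i \<in> S \<Longrightarrow> vge (v i) (coeff q i) \<and> scoeff (coeff q i) (v i) \<noteq> 0" by metis
  define sl where "sl i = v i / real (Suc m - i)" for i
  define \<gamma> where "\<gamma> = Min (sl ` S)"
  have "\<gamma> \<in> sl ` S" unfolding \<gamma>_def using finS \<open>S \<noteq> {}\<close> by (intro Min_in) auto
  then obtain i0 where i0: "i0 \<in> S" "\<gamma> = sl i0" by blast
  have le: "\<gamma> \<le> sl i" if "i \<in> S" for i unfolding \<gamma>_def using finS that by (intro Min_le) auto
  have vD: "v i0 \<in> D" using v[OF i0(1)] T_supp assms(1) unfolding polyT_def by blast
  have \<gamma>D: "\<gamma> \<in> D" unfolding i0(2) sl_def using i0(1) by (intro D_divide vD) (simp add: S_def)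
  define a where "a = sconst (1::'k) \<gamma>"
  define cf where "cf i = (if i \<le> Suc m then sconst 1 (- (real (Suc m - i) * \<gamma>)) * coeff q i else 0)" for i
  define q' where "q' = Abs_poly cf"
  have cq': "coeff q' = cf" unfolding q'_def by (rule coeff_Abs_poly[of "Suc m"]) (simp add: cf_def)
  have lead: "coeff q' (Suc m) = 1" using assms(2,3) by (simp add: cq' cf_def sconst_1)
  have deg: "degree q' = Suc m"
  proof (rule antisym)
    show "degree q' \<le> Suc m" by (rule degree_le) (simp add: cq' cf_def)
    show "Suc m \<le> degree q'" using lead by (intro le_degree) simp
  qed
  have "sconst (1::'k) (- (real (Suc m - i) * \<gamma>)) \<in> T" for i
    by (intro T_sconst D_uminus D_mult_nat \<gamma>D)
  then have "polyT q'"
    using assms(1) T_mult T_0 unfolding polyT_def cq' cf_def by metis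
  moreover have "vge 0 (coeff q' i)" for i
  proof (cases "i \<in> S")
    case True
    then have "\<gamma> * real (Suc m - i) \<le> v i"
      using le[OF True] by (simp add: sl_def S_def pos_le_divide_eq)
    then have "- (real (Suc m - i) * \<gamma>) + v i \<ge> 0" by (simp add: mult.commute)
    moreover have "vge (- (real (Suc m - i) * \<gamma>) + v i) (coeff q' i)"
    proof -
      have "coeff q' i = sconst 1 (- (real (Suc m - i) * \<gamma>)) * coeff q i"
        using True by (simp add: cq' cf_def S_def)
      then show ?thesis using v[OF True] by (simp only: vge_times vge_sconst order_refl)
    qed
    ultimately show ?thesis using vge_mono by blast
  next
    case False
    then have "coeff q' i = 0 \<or> i = Suc m"
      using assms(2,3) by (auto simp: cq' cf_def S_def)
    then show ?thesis using lead by (auto simp: vge_def scoeff_1)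
  qed
  moreover have "coeff q' m = 0" using assms(4) by (simp add: cq' cf_def)
  moreover have "i0 \<le> m" using i0 by (simp add: S_def)
  moreover have "scoeff (coeff q' i0) 0 \<noteq> 0"
  proof -
    have "real (Suc m - i0) * \<gamma> = v i0" using i0 by (simp add: sl_def S_def)
    then show ?thesis using v[OF i0(1)] i0(1) by (simp add: cq' cf_def S_def)
  qed
  moreover have "poly q (a * z) = 0" if "poly q' z = 0" for z
  proof -
    have *: "coeff q i * a ^ i = sconst 1 (real (Suc m) * \<gamma>) * coeff q' i" if "i \<le> Suc m" for i
    proof -
      have "sconst (1::'k) (real (Suc m) * \<gamma>) * sconst 1 (- (real (Suc m - i) * \<gamma>)) = a ^ i"
        using that by (simp add: a_def sconst_mult sconst_power of_nat_diff algebra_simps)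
      then show ?thesis using that by (simp add: cq' cf_def mult.assoc[symmetric] mult.commute)
    qed
    have "poly q (a * z) = (\<Sum>i\<le>Suc m. coeff q i * a ^ i * z ^ i)"
      by (simp only: poly_altdef assms(3) power_mult_distrib mult.assoc)
    also have "\<dots> = (\<Sum>i\<le>Suc m. sconst 1 (real (Suc m) * \<gamma>) * (coeff q' i * z ^ i))"
      by (intro sum.cong refl) (simp add: * mult.assoc del: of_nat_Suc)
    also have "\<dots> = sconst 1 (real (Suc m) * \<gamma>) * poly q' z"
      by (simp only: sum_distrib_left[symmetric] poly_altdef deg)
    finally show ?thesis using that by simp
  qed
  ultimately show ?thesis
    using that[of a q' i0] T_sconst[OF \<gamma>D, of "1::'k"] lead deg by (simp add: a_def)
qed

lemma T_root:
  fixes p :: "'k::{alg_closed_field, field_char_0} lfs poly"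
  assumes "polyT p" "degree p > 0"
  shows "\<exists>r\<in>T. poly p r = 0"
  using assms
proof (induction "degree p" arbitrary: p rule: less_induct)
  case less
  define m where "m = degree p - 1"
  have dp: "degree p = Suc m" using less.prems by (simp add: m_def)
  have "lead_coeff p \<in> T" "lead_coeff p \<noteq> 0" using less.prems by (auto simp: polyT_def)
  then obtain b where b: "b \<in> T" "lead_coeff p * b = 1" using T_inverse by blast
  have b0: "b \<noteq> 0" using b by auto
  \<comment> \<open>The Tschirnhaus shift: \<open>b\<close> makes the polynomial monic, and -1/(m+1)
    times its coefficient of degree m cancels that coefficient.\<close>
  define s where "s = - (sconst (1 / of_nat (Suc m)) 0 * (b * coeff p m))"
  have sT: "s \<in> T" unfolding s_def
    using less.prems(1) b by (auto intro!: T_uminus T_mult T_sconst D_zero simp: polyT_def)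
  define p1 where "p1 = smult b p"
  define q where "q = pcompose p1 [:s, 1:]"
  have dp1: "degree p1 = Suc m" using dp b0 by (simp add: p1_def)
  have lp1: "coeff p1 (Suc m) = 1" using b dp by (simp add: p1_def mult.commute)
  have qT: "polyT q" unfolding q_def p1_def
    by (intro polyT_pcompose polyT_smult b less.prems) (simp add: polyT_pCons polyT_0 sT T_1)
  have dq: "degree q = Suc m" by (simp add: q_def degree_pcompose dp1)
  have lq: "lead_coeff q = 1" using coeff_translate[of p1 m s] dp1 lp1 dq by (simp add: q_def)
  have ns: "of_nat (Suc m) * s = - (b * coeff p m)"
  proof -
    have "(of_nat n :: 'k lfs) = sconst (of_nat n) 0" for n
      by (induction n) (simp_all only: of_nat_0 of_nat_Suc sconst_0 sconst_add sconst_1)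
    then have "of_nat (Suc m) * sconst (1 / of_nat (Suc m)) 0 = (1 :: 'k lfs)"
      using of_nat_neq_0[of m, where 'a='k] by (simp only: sconst_mult) (simp add: sconst_1)
    then show ?thesis by (simp only: s_def mult_minus_right mult.assoc[symmetric]) simp
  qed
  have cq: "coeff q m = 0"
    using coeff_translate[of p1 m s] dp1 lp1 ns by (simp add: q_def) (simp add: p1_def)
  have "\<exists>r\<in>T. poly q r = 0"
  proof (cases "q = monom 1 (Suc m)")
    case True
    then show ?thesis using T_0 by (auto simp: poly_monom intro!: bexI[of _ 0])
  next
    case False
    obtain a q' i where q': "a \<in> T" "polyT q'" "\<forall>i. vge 0 (coeff q' i)" "lead_coeff q' = 1"
        "degree q' = Suc m" "coeff q' m = 0" "i \<le> m" "scoeff (coeff q' i) 0 \<noteq> 0"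
        and root: "\<forall>z. poly q' z = 0 \<longrightarrow> poly q (a * z) = 0"
      by (rule scaled_polynomial[OF qT lq dq cq False])
    obtain g h where gh: "q' = g * h" "polyT g" "0 < degree g" "degree g \<le> m"
      by (rule hensel_split[OF q'(2-8)])
    then obtain z where "z \<in> T" "poly g z = 0" using less.hyps[of g] dp by auto
    then have "poly q' z = 0" by (simp add: gh)
    then show ?thesis using root T_mult[OF q'(1) \<open>z \<in> T\<close>] by blast
  qed
  then obtain r where r: "r \<in> T" "poly q r = 0" by blast
  then have "b * poly p (s + r) = 0" by (simp add: q_def poly_pcompose p1_def)
  then have "poly p (s + r) = 0" using b0 by simp
  then show ?case using T_add[OF sT r(1)] by blast
qed

end

section \<open>Extending points along ring extensions\<close>

definition subring :: "'a::comm_ring_1 set \<Rightarrow> bool" where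
  "subring R \<longleftrightarrow> 1 \<in> R \<and> (\<forall>a\<in>R. \<forall>b\<in>R. a - b \<in> R \<and> a * b \<in> R)"

definition ring_ideal :: "'a::comm_ring_1 set \<Rightarrow> bool" where
  "ring_ideal P \<longleftrightarrow> 0 \<in> P \<and> (\<forall>a\<in>P. \<forall>b\<in>P. a + b \<in> P) \<and> (\<forall>a. \<forall>b\<in>P. a * b \<in> P)"

definition prime_ideal :: "'a::comm_ring_1 set \<Rightarrow> bool" where
  "prime_ideal P \<longleftrightarrow> ring_ideal P \<and> 1 \<notin> P \<and> (\<forall>a b. a * b \<in> P \<longrightarrow> a \<in> P \<or> b \<in> P)"

definition poly_over :: "'a::comm_ring_1 set \<Rightarrow> 'a poly \<Rightarrow> bool" where
  "poly_over R p \<longleftrightarrow> (\<forall>i. coeff p i \<in> R)"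

definition adj :: "'a::comm_ring_1 set \<Rightarrow> 'a \<Rightarrow> 'a set" where
  "adj R z = {poly p z | p. poly_over R p}"

lemma subring_closed:
  assumes "subring R"
  shows "1 \<in> R" "0 \<in> R" "a \<in> R \<Longrightarrow> b \<in> R \<Longrightarrow> a + b \<in> R" "a \<in> R \<Longrightarrow> b \<in> R \<Longrightarrow> a - b \<in> R"
    "a \<in> R \<Longrightarrow> b \<in> R \<Longrightarrow> a * b \<in> R" "a \<in> R \<Longrightarrow> - a \<in> R"
proof -
  have d: "\<And>a b. a \<in> R \<Longrightarrow> b \<in> R \<Longrightarrow> a - b \<in> R" and o: "1 \<in> R"
    using assms by (auto simp: subring_def)
  have z: "0 \<in> R" using d[OF o o] by simp
  have m: "- a \<in> R" if "a \<in> R" for a using d[OF z that] by simp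
  show "1 \<in> R" "0 \<in> R" "a \<in> R \<Longrightarrow> b \<in> R \<Longrightarrow> a - b \<in> R" "a \<in> R \<Longrightarrow> - a \<in> R"
    by (rule o z d m; assumption)+
  show "a \<in> R \<Longrightarrow> b \<in> R \<Longrightarrow> a + b \<in> R" using d[of a "- b"] m[of b] by simp
  show "a \<in> R \<Longrightarrow> b \<in> R \<Longrightarrow> a * b \<in> R" using assms by (auto simp: subring_def)
qed

lemma subring_sum: "subring R \<Longrightarrow> (\<And>x. x \<in> A \<Longrightarrow> f x \<in> R) \<Longrightarrow> sum f A \<in> R"
  by (induction A rule: infinite_finite_induct) (auto simp: subring_closed)

lemma subring_prod: "subring R \<Longrightarrow> (\<And>x. x \<in> A \<Longrightarrow> f x \<in> R) \<Longrightarrow> prod f A \<in> R"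
  by (induction A rule: infinite_finite_induct) (auto simp: subring_closed)

lemma subring_power: "subring R \<Longrightarrow> a \<in> R \<Longrightarrow> a ^ n \<in> R"
  by (induction n) (auto simp: subring_closed)

lemma ideal_closed:
  assumes "ring_ideal P"
  shows "0 \<in> P" "a \<in> P \<Longrightarrow> b \<in> P \<Longrightarrow> a + b \<in> P" "b \<in> P \<Longrightarrow> a * b \<in> P" "b \<in> P \<Longrightarrow> b * a \<in> P"
    "b \<in> P \<Longrightarrow> - b \<in> P" "a \<in> P \<Longrightarrow> b \<in> P \<Longrightarrow> a - b \<in> P"
proof -
  have m: "\<And>a b. b \<in> P \<Longrightarrow> a * b \<in> P" and p: "\<And>a b. a \<in> P \<Longrightarrow> b \<in> P \<Longrightarrow> a + b \<in> P" and z: "0 \<in> P"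
    using assms by (auto simp: ring_ideal_def)
  have n: "- b \<in> P" if "b \<in> P" for b using m[OF that, of "-1"] by simp
  show "0 \<in> P" "a \<in> P \<Longrightarrow> b \<in> P \<Longrightarrow> a + b \<in> P" "b \<in> P \<Longrightarrow> a * b \<in> P" "b \<in> P \<Longrightarrow> - b \<in> P"
    by (rule m p z n; assumption)+
  show "b \<in> P \<Longrightarrow> b * a \<in> P" using m[of b a] by (simp add: mult.commute)
  show "a \<in> P \<Longrightarrow> b \<in> P \<Longrightarrow> a - b \<in> P" using p[of a "- b"] n[of b] by simp
qed

lemma ideal_sum: "ring_ideal P \<Longrightarrow> (\<And>x. x \<in> A \<Longrightarrow> f x \<in> P) \<Longrightarrow> sum f A \<in> P"
  by (induction A rule: infinite_finite_induct) (auto simp: ideal_closed)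

lemma ideal_adjoin:
  fixes z :: "'a::comm_ring_1"
  assumes Q: "ring_ideal Q"
  defines "X \<equiv> {x + y * z | x y. x \<in> Q}"
  shows "ring_ideal X" "Q \<subseteq> X" "z \<in> X"
proof -
  have XI: "x + y * z \<in> X" if "x \<in> Q" for x y using that by (auto simp: X_def)
  show "ring_ideal X"
    unfolding ring_ideal_def
  proof (intro conjI ballI allI)
    show "0 \<in> X" using XI[OF ideal_closed(1)[OF Q], of 0] by simp
    fix a b assume "a \<in> X" "b \<in> X"
    then obtain x y x' y' where ab: "a = x + y * z" "b = x' + y' * z" "x \<in> Q" "x' \<in> Q" by (auto simp: X_def)
    have "a + b = (x + x') + (y + y') * z" unfolding ab(1,2) by (simp add: algebra_simps)
    then show "a + b \<in> X" using XI[OF ideal_closed(2)[OF Q ab(3,4)]] by simp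
  next
    fix a b assume "b \<in> X"
    then obtain x y where b: "b = x + y * z" "x \<in> Q" by (auto simp: X_def)
    have "a * b = a * x + (a * y) * z" unfolding b(1) by (simp only: distrib_left mult.assoc)
    then show "a * b \<in> X" using XI[OF ideal_closed(3)[OF Q b(2)]] by simp
  qed
  show "Q \<subseteq> X" using XI[of _ 0] by auto
  show "z \<in> X" using XI[OF ideal_closed(1)[OF Q], of 1] by simp
qed

lemma prime_ideal_power: "prime_ideal P \<Longrightarrow> a ^ n \<in> P \<Longrightarrow> a \<in> P"
  by (induction n) (auto simp: prime_ideal_def)

lemma poly_over_closed:
  assumes "subring R"
  shows "poly_over R 0" "poly_over R p \<Longrightarrow> poly_over R q \<Longrightarrow> poly_over R (p + q)"
    "poly_over R p \<Longrightarrow> poly_over R q \<Longrightarrow> poly_over R (p - q)"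
    "poly_over R p \<Longrightarrow> poly_over R q \<Longrightarrow> poly_over R (p * q)"
    "a \<in> R \<Longrightarrow> poly_over R p \<Longrightarrow> poly_over R (smult a p)" "a \<in> R \<Longrightarrow> poly_over R (monom a n)"
    "a \<in> R \<Longrightarrow> poly_over R [:a:]" "poly_over R p \<Longrightarrow> poly_over R (- p)"
  using assms by (auto simp: poly_over_def subring_closed coeff_mult coeff_pCons
      intro!: subring_sum split: nat.splits)

lemma poly_mem_ideal: "ring_ideal P \<Longrightarrow> (\<And>i. coeff p i \<in> P) \<Longrightarrow> poly p z \<in> P"
  unfolding poly_altdef by (intro ideal_sum) (auto simp: ideal_closed)

lemma adj_properties:
  assumes "subring R"
  shows "subring (adj R z)" "R \<subseteq> adj R z" "z \<in> adj R z"
    "subring S \<Longrightarrow> R \<subseteq> S \<Longrightarrow> z \<in> S \<Longrightarrow> adj R z \<subseteq> S"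
proof -
  show sub: "R \<subseteq> adj R z"
  proof
    fix a assume "a \<in> R"
    then show "a \<in> adj R z"
      unfolding adj_def using poly_over_closed(7)[OF assms] by (intro CollectI exI[of _ "[:a:]"]) auto
  qed
  show "subring (adj R z)"
    unfolding subring_def
  proof (intro conjI ballI)
    show "1 \<in> adj R z" using sub subring_closed(1)[OF assms] by blast
    fix a b assume "a \<in> adj R z" "b \<in> adj R z"
    then obtain p q where "a = poly p z" "b = poly q z" "poly_over R p" "poly_over R q"
      by (auto simp: adj_def)
    then show "a - b \<in> adj R z" "a * b \<in> adj R z"
      unfolding adj_def using poly_over_closed[OF assms]
      by (metis (mono_tags, lifting) mem_Collect_eq poly_diff, metis (mono_tags, lifting) mem_Collect_eq poly_mult)
  qed
  have "poly_over R (monom 1 1)" using poly_over_closed(6)[OF assms] subring_closed(1)[OF assms] .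
  then show "z \<in> adj R z" unfolding adj_def by (intro CollectI exI[of _ "monom 1 1"]) (auto simp: poly_monom)
  assume S: "subring S" "R \<subseteq> S" "z \<in> S"
  then show "adj R z \<subseteq> S"
    unfolding adj_def poly_over_def
    by (auto simp: poly_altdef intro!: subring_sum[OF S(1)] subring_closed(5)[OF S(1)] subring_power[OF S(1)])
qed

text \<open>A homomorphism on R/(R \<inter> P), encoded as a total function of which only the values
  on \<open>R\<close> matter. Subrings are sets, so adjoining generators does not change
  types.\<close>

definition ring_hom_on :: "'a::comm_ring_1 set \<Rightarrow> 'a set \<Rightarrow> ('a \<Rightarrow> 'k::comm_ring_1) \<Rightarrow> bool" where
  "ring_hom_on P R \<phi> \<longleftrightarrow> \<phi> 1 = 1 \<and> (\<forall>a\<in>R. \<forall>b\<in>R. \<phi> (a + b) = \<phi> a + \<phi> b \<and> \<phi> (a * b) = \<phi> a * \<phi> b)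
    \<and> (\<forall>a\<in>R \<inter> P. \<phi> a = 0)"

context
  fixes P R :: "'a::comm_ring_1 set" and \<phi> :: "'a \<Rightarrow> 'k::comm_ring_1"
  assumes hom: "ring_hom_on P R \<phi>" and R: "subring R"
begin

lemma hom_basic:
  shows "\<phi> 0 = 0" "\<phi> 1 = 1" "a \<in> R \<Longrightarrow> b \<in> R \<Longrightarrow> \<phi> (a + b) = \<phi> a + \<phi> b"
    "a \<in> R \<Longrightarrow> b \<in> R \<Longrightarrow> \<phi> (a * b) = \<phi> a * \<phi> b"
    "a \<in> R \<Longrightarrow> a \<in> P \<Longrightarrow> \<phi> a = 0"
  using hom R subring_closed(2)[OF R] unfolding ring_hom_on_def
  by (metis add_cancel_right_right, auto)

lemma hom_sum: "(\<And>x. x \<in> A \<Longrightarrow> f x \<in> R) \<Longrightarrow> \<phi> (sum f A) = (\<Sum>x\<in>A. \<phi> (f x))"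
  by (induction A rule: infinite_finite_induct) (auto simp: hom_basic subring_sum[OF R])

lemma hom_prod: "(\<And>x. x \<in> A \<Longrightarrow> f x \<in> R) \<Longrightarrow> \<phi> (prod f A) = (\<Prod>x\<in>A. \<phi> (f x))"
  by (induction A rule: infinite_finite_induct) (auto simp: hom_basic subring_prod[OF R])

lemma hom_power: "a \<in> R \<Longrightarrow> \<phi> (a ^ n) = \<phi> a ^ n"
  by (induction n) (auto simp: hom_basic subring_power[OF R])

lemma hom_poly:
  shows "coeff (map_poly \<phi> p) i = \<phi> (coeff p i)"
    "poly_over R p \<Longrightarrow> poly_over R q \<Longrightarrow> map_poly \<phi> (p + q) = map_poly \<phi> p + map_poly \<phi> q"
    "poly_over R p \<Longrightarrow> poly_over R q \<Longrightarrow> map_poly \<phi> (p * q) = map_poly \<phi> p * map_poly \<phi> q"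
    "a \<in> R \<Longrightarrow> poly_over R p \<Longrightarrow> map_poly \<phi> (smult a p) = smult (\<phi> a) (map_poly \<phi> p)"
    "poly_over R p \<Longrightarrow> (\<And>i. coeff p i \<in> P) \<Longrightarrow> map_poly \<phi> p = 0"
  by (auto simp: poly_eq_iff coeff_map_poly hom_basic coeff_mult poly_over_def hom_sum
      subring_closed[OF R])

text \<open>Elements of R[z] are values of polynomials at \<open>z\<close>. Sending \<open>z\<close>
  to \<open>b\<close> is well defined as soon as \<open>b\<close> satisfies the image of every
  relation of \<open>z\<close> modulo \<open>P\<close>, since two representatives differ by such a
  relation.\<close>

lemma hom_extend:
  assumes "\<And>q. poly_over R q \<Longrightarrow> poly q z \<in> P \<Longrightarrow> poly (map_poly \<phi> q) b = 0"
    and P: "ring_ideal P"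
  obtains \<psi> where "ring_hom_on P (adj R z) \<psi>"
    "\<And>q. poly_over R q \<Longrightarrow> \<psi> (poly q z) = poly (map_poly \<phi> q) b"
    "\<And>a. a \<in> R \<Longrightarrow> \<psi> a = \<phi> a"
proof -
  have wd: "poly (map_poly \<phi> p) b = poly (map_poly \<phi> q) b"
    if "poly_over R p" "poly_over R q" "poly p z = poly q z" for p q
  proof -
    have r: "poly_over R (p - q)" using that poly_over_closed[OF R] by blast
    have "poly (p - q) z \<in> P" using that ideal_closed(1)[OF P] by simp
    then have "poly (map_poly \<phi> (p - q)) b = 0" using assms(1) r by blast
    moreover have "map_poly \<phi> p = map_poly \<phi> (p - q) + map_poly \<phi> q"
      using hom_poly(2)[OF r that(2)] by simp
    ultimately show ?thesis by simp
  qed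
  define \<psi> where "\<psi> a = poly (map_poly \<phi> (SOME q. poly_over R q \<and> poly q z = a)) b" for a
  have \<psi>: "\<psi> (poly q z) = poly (map_poly \<phi> q) b" if q: "poly_over R q" for q
  proof -
    let ?s = "SOME q'. poly_over R q' \<and> poly q' z = poly q z"
    have "poly_over R ?s \<and> poly ?s z = poly q z" by (rule someI[of _ q]) (use q in simp)
    then show ?thesis unfolding \<psi>_def using wd q by blast
  qed
  have on_R: "\<psi> a = \<phi> a" if "a \<in> R" for a
    using \<psi>[of "[:a:]"] poly_over_closed(7)[OF R that] by (simp add: map_poly_pCons hom_basic)
  have "ring_hom_on P (adj R z) \<psi>"
    unfolding ring_hom_on_def
  proof (intro conjI ballI)
    show "\<psi> 1 = 1" using on_R[of 1] subring_closed(1)[OF R] hom_basic(2) by simp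
    fix a c assume "a \<in> adj R z" "c \<in> adj R z"
    then obtain p q where pq: "a = poly p z" "c = poly q z" "poly_over R p" "poly_over R q"
      by (auto simp: adj_def)
    show "\<psi> (a + c) = \<psi> a + \<psi> c"
      using \<psi>[OF poly_over_closed(2)[OF R pq(3,4)]] hom_poly(2)[OF pq(3,4)] pq \<psi> by simp
    show "\<psi> (a * c) = \<psi> a * \<psi> c"
      using \<psi>[OF poly_over_closed(4)[OF R pq(3,4)]] hom_poly(3)[OF pq(3,4)] pq \<psi> by simp
  next
    fix a assume "a \<in> adj R z \<inter> P"
    then obtain p where "a = poly p z" "poly_over R p" "poly p z \<in> P" by (auto simp: adj_def)
    then show "\<psi> a = 0" using \<psi> assms(1) by simp
  qed
  then show ?thesis using that \<psi> on_R by blast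
qed

end

section \<open>Pseudo-division and extension by one generator\<close>

lemma degree_less_coeff: "degree p \<le> n \<Longrightarrow> coeff p n = 0 \<Longrightarrow> n > 0 \<Longrightarrow> degree p < n"
  by (cases "degree p = n") auto

text \<open>Coefficients stay in a subring, so instead of dividing by the leading coefficient of the
  divisor, the dividend is multiplied by a power of it. The bound on the degree of the quotient lets
  minimality of a relation be applied to it later.\<close>

lemma pseudo_division_over:
  fixes n :: "'a::comm_ring_1 poly"
  assumes R: "subring R" and n: "poly_over R n" "degree n > 0" and m: "poly_over R m"
  shows "\<exists>j s r. smult (lead_coeff n ^ j) m = n * s + r \<and> poly_over R s \<and> poly_over R r
    \<and> degree r < degree n \<and> degree s \<le> degree m - degree n"
  using m
proof (induction "degree m" arbitrary: m rule: less_induct)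
  case less
  let ?e = "lead_coeff n" and ?k = "degree n"
  show ?case
  proof (cases "degree m < ?k")
    case True
    show ?thesis
      by (rule exI[of _ 0], rule exI[of _ 0], rule exI[of _ m])
         (use True less.prems poly_over_closed[OF R] in auto)
  next
    case False
    define w where "w = monom (lead_coeff m) (degree m - ?k)"
    define m' where "m' = smult ?e m - n * w"
    have w: "poly_over R w"
      unfolding w_def using less.prems by (intro poly_over_closed[OF R]) (simp add: poly_over_def)
    have m': "poly_over R m'"
      unfolding m'_def using less.prems n(1) w
      by (intro poly_over_closed[OF R]) (auto simp: poly_over_def)
    have dw: "degree w \<le> degree m - ?k" unfolding w_def by (rule degree_monom_le)
    have "degree (n * w) \<le> degree m" using degree_mult_le[of n w] dw False by simp
    then have dm': "degree m' \<le> degree m"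
      unfolding m'_def by (intro degree_diff_le degree_smult_le)
    have "coeff (n * w) (degree m) = ?e * lead_coeff m"
    proof -
      have "coeff (w * n) ((degree m - ?k) + ?k) = lead_coeff m * ?e"
        unfolding w_def by (subst coeff_monom_mult) simp
      then show ?thesis using False by (simp add: mult.commute)
    qed
    then have "coeff m' (degree m) = 0" by (simp add: m'_def)
    then have "degree m' < degree m"
      using dm' False n(2) by (intro degree_less_coeff) auto
    then obtain j s r where IH: "smult (?e ^ j) m' = n * s + r" "poly_over R s" "poly_over R r"
        "degree r < ?k" "degree s \<le> degree m' - ?k"
      using less.hyps[of m'] m' by blast
    have "smult (?e ^ Suc j) m = smult (?e ^ j) m' + n * smult (?e ^ j) w"
      by (simp add: m'_def smult_diff_right mult.commute)
    also have "\<dots> = n * (s + smult (?e ^ j) w) + r" by (simp add: IH(1) algebra_simps)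
    finally have "smult (?e ^ Suc j) m = n * (s + smult (?e ^ j) w) + r" .
    moreover have "?e ^ j \<in> R" using n(1) by (intro subring_power[OF R]) (simp add: poly_over_def)
    then have "poly_over R (s + smult (?e ^ j) w)" by (intro poly_over_closed(2,5)[OF R] IH(2) w)
    moreover have "degree (s + smult (?e ^ j) w) \<le> degree m - ?k"
      using IH(5) dm' dw by (intro degree_add_le le_trans[OF degree_smult_le]) auto
    ultimately show ?thesis using IH by blast
  qed
qed

text \<open>A leading coefficient in \<open>P\<close> can be discarded without changing the value
  modulo \<open>P\<close>, so relations of least degree have leading coefficient outside
  \<open>P\<close>.\<close>

lemma drop_leading_term:
  assumes P: "ring_ideal P" and R: "subring R"
    and p: "poly_over R p" "lead_coeff p \<in> P" "degree p > 0"
  obtains p' where "poly_over R p'" "degree p' < degree p" "\<forall>i. coeff p' i \<in> P \<longrightarrow> coeff p i \<in> P"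
    "poly p' z - poly p z \<in> P"
proof
  show "poly_over R (p - monom (lead_coeff p) (degree p))"
    using p(1) by (intro poly_over_closed[OF R]) (simp_all add: poly_over_def)
  show "degree (p - monom (lead_coeff p) (degree p)) < degree p"
    using p(3) by (intro degree_less_coeff degree_diff_le degree_monom_le) auto
  show "\<forall>i. coeff (p - monom (lead_coeff p) (degree p)) i \<in> P \<longrightarrow> coeff p i \<in> P"
    using p(2) by auto
  have "- (lead_coeff p * z ^ degree p) \<in> P" by (intro ideal_closed(4,5)[OF P] p)
  then show "poly (p - monom (lead_coeff p) (degree p)) z - poly p z \<in> P" by (simp add: poly_monom)
qed

text \<open>An algebraic generator \<open>z\<close> is sent to a root of its relation \<open>m\<close> of least degree; since \<open>h'\<close> is
  invertible modulo \<open>P\<close> up to a factor \<open>c\<close> from \<open>R\<close>, it suffices to keep \<open>c\<close> and the leading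
  coefficient of \<open>m\<close> alive.\<close>
lemma algebraic_denominator:
  fixes P R :: "'a::comm_ring_1 set"
  assumes P: "prime_ideal P" and R: "subring R"
    and m: "poly_over R m" "poly m z \<in> P" "lead_coeff m \<notin> P" "degree m > 0"
    and m_min: "\<And>n i. poly_over R n \<Longrightarrow> poly n z \<in> P \<Longrightarrow> degree n < degree m \<Longrightarrow> coeff n i \<in> P"
    and q: "poly_over R q" "poly q z \<notin> P"
  shows "\<exists>c\<in>R. \<exists>u. poly_over R u \<and> c \<notin> P \<and> c - poly u z * poly q z \<in> P"
proof -
  have PI: "ring_ideal P" and pr: "\<And>a b. a * b \<in> P \<Longrightarrow> a \<in> P \<or> b \<in> P"
    using P by (auto simp: prime_ideal_def)
  \<comment> \<open>Polynomials over \<open>R\<close> whose value at \<open>z\<close> is, modulo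
    \<open>P\<close>, a multiple of q(z) and lies outside \<open>P\<close>. A member of degree 0 is
    the desired constant.\<close>
  define N where "N n \<longleftrightarrow> poly_over R n \<and> poly n z \<notin> P
      \<and> (\<exists>u. poly_over R u \<and> poly n z - poly u z * poly q z \<in> P)" for n
  have "N q" unfolding N_def
    using q poly_over_closed(7)[OF R subring_closed(1)[OF R]] ideal_closed(1)[OF PI]
    by (intro conjI exI[of _ "[:1:]"]) auto
  then obtain n where n: "N n" and n_min: "\<And>n'. N n' \<Longrightarrow> degree n \<le> degree n'"
    using ex_has_least_nat[of N q degree] by blast
  obtain u where nR: "poly_over R n" and nP: "poly n z \<notin> P" and u: "poly_over R u"
      and nu: "poly n z - poly u z * poly q z \<in> P"
    using n unfolding N_def by blast
  let ?e = "lead_coeff n" and ?d = "lead_coeff m"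
  have eR: "?e \<in> R" and dR: "?d \<in> R" using nR m by (auto simp: poly_over_def)
  have NI: "N r" if r: "poly_over R r" "poly r z \<notin> P" and v: "poly_over R v"
    and rv: "poly r z - poly v z * poly n z \<in> P" for r v
    unfolding N_def
  proof (intro conjI exI[of _ "v * u"])
    have "(poly r z - poly v z * poly n z) + poly v z * (poly n z - poly u z * poly q z) \<in> P"
      using rv nu ideal_closed[OF PI] by blast
    then show "poly r z - poly (v * u) z * poly q z \<in> P" by (simp add: algebra_simps)
  qed (use r v u poly_over_closed[OF R] in auto)
  show ?thesis
  proof (cases "degree n = 0")
    case True
    then obtain a where "n = [:a:]" using degree_eq_zeroE by blast
    then have "poly n z = ?e" by simp
    then show ?thesis using eR u nP nu by auto
  next
    case False
    have e: "?e \<notin> P"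
    proof
      assume eP: "?e \<in> P"
      obtain n' where n': "poly_over R n'" "degree n' < degree n" "poly n' z - poly n z \<in> P"
        using drop_leading_term[OF PI R nR eP] False by blast
      have "poly n' z \<notin> P" using nP n'(3) ideal_closed(6)[OF PI _ n'(3), of "poly n' z"] by auto
      then have "N n'" using NI[OF n'(1) _ poly_over_closed(7)[OF R subring_closed(1)[OF R]]] n'(3) by simp
      then show False using n_min n'(2) by (metis not_less)
    qed
    \<comment> \<open>Otherwise the pseudo-remainder of \<open>n\<close> by \<open>m\<close> would
      be a smaller member: its value is a power of the leading coefficient of \<open>m\<close> times
      n(z), modulo \<open>P\<close>.\<close>
    have k: "degree n \<le> degree m"
    proof (rule ccontr)
      assume k: "\<not> degree n \<le> degree m"
      obtain j s r where d: "smult (?d ^ j) n = m * s + r" "poly_over R s" "poly_over R r" "degree r < degree m"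
        using pseudo_division_over[OF R m(1,4) nR] by blast
      have eq: "poly r z = ?d ^ j * poly n z - poly m z * poly s z"
        using arg_cong[OF d(1), of "\<lambda>p. poly p z"] by (simp add: algebra_simps)
      have ms: "poly m z * poly s z \<in> P" using m ideal_closed[OF PI] by blast
      have "poly r z \<notin> P"
      proof
        assume "poly r z \<in> P"
        then have "?d ^ j * poly n z \<in> P" using eq ms ideal_closed(2)[OF PI, of "poly r z" "poly m z * poly s z"] by simp
        then show False using pr nP m(3) prime_ideal_power[OF P] by blast
      qed
      moreover have "poly r z - poly [:?d ^ j:] z * poly n z \<in> P"
        using eq ms ideal_closed(5)[OF PI ms] by simp
      ultimately have "N r" using NI d(3) poly_over_closed(7)[OF R subring_power[OF R dR]] by blast
      then show False using n_min k d(4) by force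
    qed
    obtain j s r where d: "smult (?e ^ j) m = n * s + r" "poly_over R s" "poly_over R r"
        "degree r < degree n" "degree s \<le> degree m - degree n"
      using pseudo_division_over[OF R nR _ m(1)] False by blast
    have eq: "poly r z = ?e ^ j * poly m z - poly n z * poly s z"
      using arg_cong[OF d(1), of "\<lambda>p. poly p z"] by (simp add: algebra_simps)
    have em: "?e ^ j * poly m z \<in> P" using m ideal_closed[OF PI] by blast
    \<comment> \<open>The remainder is a multiple of n(z) modulo \<open>P\<close> of smaller degree,
      so minimality puts it into \<open>P\<close>. Then n(z) s(z) lies in \<open>P\<close>, hence so
      does s(z), and minimality of \<open>m\<close> puts every coefficient of \<open>s\<close> into
      \<open>P\<close>.\<close>
    have rP: "poly r z \<in> P"
    proof (rule ccontr)
      assume "poly r z \<notin> P"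
      moreover have "poly r z - poly (- s) z * poly n z \<in> P" using eq em by simp
      ultimately have "N r" using NI d(2,3) poly_over_closed(8)[OF R] by blast
      then show False using n_min d(4) by force
    qed
    then have "poly n z * poly s z \<in> P"
      using ideal_closed(6)[OF PI em rP] eq by simp
    then have "poly s z \<in> P" using pr nP by blast
    then have "coeff s i \<in> P" for i using m_min[OF d(2)] d(5) False m(4) by simp
    then have "coeff (n * s) (degree m) \<in> P"
      unfolding coeff_mult by (intro ideal_sum[OF PI]) (auto simp: ideal_closed[OF PI])
    moreover have "coeff r (degree m) = 0" using d(4) k by (intro coeff_eq_0) simp
    ultimately have "?e ^ j * ?d \<in> P" using arg_cong[OF d(1), of "\<lambda>p. coeff p (degree m)"] by simp
    then show ?thesis using pr e m(3) prime_ideal_power[OF P] by blast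
  qed
qed

text \<open>The algebraic core of Chevalley's theorem: the open condition \<psi> h' \<noteq> 0 is
  pulled back to an open condition on \<phi>. Without a relation for \<open>z\<close> modulo
  \<open>P\<close>, some coefficient of a polynomial representing \<open>h'\<close> lies outside
  \<open>P\<close>, and \<open>z\<close> may go to any non-root of its image.\<close>

lemma extension_step:
  fixes P R :: "'a::comm_ring_1 set"
  assumes P: "prime_ideal P" and R: "subring R" and h': "h' \<in> adj R z" "h' \<notin> P"
  shows "\<exists>h\<in>R. h \<notin> P \<and> (\<forall>\<phi>::'a \<Rightarrow> 'k::{alg_closed_field, field_char_0}. ring_hom_on P R \<phi> \<longrightarrow> \<phi> h \<noteq> 0 \<longrightarrow>
    (\<exists>\<psi>. ring_hom_on P (adj R z) \<psi> \<and> \<psi> h' \<noteq> 0 \<and> (\<forall>a\<in>R. \<psi> a = \<phi> a)))"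
proof -
  have PI: "ring_ideal P" and pr: "\<And>a b. a * b \<in> P \<Longrightarrow> a \<in> P \<or> b \<in> P"
    using P by (auto simp: prime_ideal_def)
  obtain q where q: "poly_over R q" "h' = poly q z" using h' by (auto simp: adj_def)
  define B where "B m \<longleftrightarrow> poly_over R m \<and> poly m z \<in> P \<and> (\<exists>i. coeff m i \<notin> P)" for m
  show ?thesis
  proof (cases "\<exists>m. B m")
    case False
    obtain i where i: "coeff q i \<notin> P" using poly_mem_ideal[OF PI, of q z] q(2) h'(2) by auto
    show ?thesis
    proof (intro bexI[of _ "coeff q i"] conjI allI impI)
      fix \<phi> :: "'a \<Rightarrow> 'k"
      assume \<phi>: "ring_hom_on P R \<phi>" "\<phi> (coeff q i) \<noteq> 0"
      have "map_poly \<phi> q \<noteq> 0" using hom_poly(1)[OF \<phi>(1) R, of q i] \<phi>(2) by auto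
      then have "finite {b. poly (map_poly \<phi> q) b = 0}" by (rule poly_roots_finite)
      then obtain b where b: "poly (map_poly \<phi> q) b \<noteq> 0"
        using ex_new_if_finite[OF infinite_UNIV_char_0] by blast
      have ann: "poly (map_poly \<phi> p) b = 0" if "poly_over R p" "poly p z \<in> P" for p
        using hom_poly(5)[OF \<phi>(1) R that(1)] False that by (auto simp: B_def)
      obtain \<psi> where "ring_hom_on P (adj R z) \<psi>" "\<And>p. poly_over R p \<Longrightarrow> \<psi> (poly p z) = poly (map_poly \<phi> p) b"
          "\<And>a. a \<in> R \<Longrightarrow> \<psi> a = \<phi> a"
        using hom_extend[OF \<phi>(1) R ann PI] by blast
      then show "\<exists>\<psi>. ring_hom_on P (adj R z) \<psi> \<and> \<psi> h' \<noteq> 0 \<and> (\<forall>a\<in>R. \<psi> a = \<phi> a)"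
        using q b by auto
    qed (use q i in \<open>auto simp: poly_over_def\<close>)
  next
    case True
    then obtain m where Bm: "B m" and m_min: "\<And>n. B n \<Longrightarrow> degree m \<le> degree n"
      using ex_has_least_nat[of B _ degree] by blast
    have m: "poly_over R m" "poly m z \<in> P" using Bm by (auto simp: B_def)
    let ?d = "lead_coeff m"
    have dR: "?d \<in> R" using m by (simp add: poly_over_def)
    have d0: "degree m > 0"
    proof (rule ccontr)
      assume "\<not> degree m > 0"
      then obtain a where a: "m = [:a:]" using degree_eq_zeroE by blast
      then have "a \<in> P" using m by simp
      then have "coeff m i \<in> P" for i using a ideal_closed(1)[OF PI] by (cases i) auto
      then show False using Bm by (auto simp: B_def)
    qed
    have dP: "?d \<notin> P"
    proof
      assume dP: "?d \<in> P"
      obtain m' where m': "poly_over R m'" "degree m' < degree m"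
          "\<forall>i. coeff m' i \<in> P \<longrightarrow> coeff m i \<in> P" "poly m' z - poly m z \<in> P"
        using drop_leading_term[OF PI R m(1) dP d0] by blast
      have "poly m' z \<in> P" using ideal_closed(2)[OF PI m'(4) m(2)] by simp
      then have "B m'" using m' Bm by (auto simp: B_def)
      then show False using m_min m'(2) by (metis not_less)
    qed
    have m_min': "coeff n i \<in> P" if "poly_over R n" "poly n z \<in> P" "degree n < degree m" for n i
      using m_min[of n] that by (force simp: B_def)
    obtain c u where cu: "c \<in> R" "poly_over R u" "c \<notin> P" "c - poly u z * poly q z \<in> P"
      using algebraic_denominator[OF P R m dP d0 m_min' q(1)] q(2) h'(2) by blast
    show ?thesis
    proof (intro bexI[of _ "c * ?d"] conjI allI impI)
      fix \<phi> :: "'a \<Rightarrow> 'k"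
      assume \<phi>: "ring_hom_on P R \<phi>" "\<phi> (c * ?d) \<noteq> 0"
      have nz: "\<phi> c \<noteq> 0" "\<phi> ?d \<noteq> 0" using \<phi>(2) hom_basic(4)[OF \<phi>(1) R cu(1) dR] by auto
      have "degree (map_poly \<phi> m) > 0"
        using le_degree[of "map_poly \<phi> m" "degree m"] nz(2) hom_poly(1)[OF \<phi>(1) R] d0 by simp
      then obtain b where b: "poly (map_poly \<phi> m) b = 0" using alg_closed_imp_poly_has_root by blast
      \<comment> \<open>Pseudo-division by \<open>m\<close> turns a relation into one of smaller
        degree, whose coefficients all lie in \<open>P\<close> and are killed by \<phi>. A power of
        \<phi> applied to the leading coefficient of \<open>m\<close> remains as a nonzero
        factor.\<close>
      have ann: "poly (map_poly \<phi> p) b = 0" if p: "poly_over R p" "poly p z \<in> P" for p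
      proof -
        obtain j s r where d: "smult (?d ^ j) p = m * s + r" "poly_over R s" "poly_over R r" "degree r < degree m"
          using pseudo_division_over[OF R m(1) d0 p(1)] by blast
        have "poly r z = ?d ^ j * poly p z - poly m z * poly s z"
          using arg_cong[OF d(1), of "\<lambda>p. poly p z"] by (simp add: algebra_simps)
        then have "poly r z \<in> P" using p m ideal_closed[OF PI] by metis
        then have "map_poly \<phi> r = 0" using m_min' d hom_poly(5)[OF \<phi>(1) R d(3)] by blast
        moreover have "smult (\<phi> ?d ^ j) (map_poly \<phi> p) = map_poly \<phi> m * map_poly \<phi> s + map_poly \<phi> r"
          using arg_cong[OF d(1), of "map_poly \<phi>"] hom_poly[OF \<phi>(1) R] d(2,3) m(1) p(1)
            subring_power[OF R dR] hom_power[OF \<phi>(1) R dR] poly_over_closed(4)[OF R] by simp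
        ultimately have "\<phi> ?d ^ j * poly (map_poly \<phi> p) b = 0"
          using b by (metis add.right_neutral mult_zero_left poly_mult poly_smult)
        then show ?thesis using nz by simp
      qed
      obtain \<psi> where \<psi>: "ring_hom_on P (adj R z) \<psi>" "\<And>a. a \<in> R \<Longrightarrow> \<psi> a = \<phi> a"
        using hom_extend[OF \<phi>(1) R ann PI] by blast
      have AR: "subring (adj R z)" "R \<subseteq> adj R z" using adj_properties[OF R] by blast+
      have uz: "poly u z \<in> adj R z" using cu by (auto simp: adj_def)
      have uh: "poly u z * h' \<in> adj R z" using uz h' subring_closed[OF AR(1)] by blast
      have "c - poly u z * h' \<in> adj R z" using uh cu AR subring_closed[OF AR(1)] by blast
      then have "\<psi> (c - poly u z * h') = 0" using hom_basic(5)[OF \<psi>(1) AR(1)] cu q by simp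
      moreover have "\<psi> c = \<psi> (c - poly u z * h') + \<psi> (poly u z * h')"
        using hom_basic(3)[OF \<psi>(1) AR(1) \<open>c - poly u z * h' \<in> adj R z\<close> uh] by simp
      ultimately have "\<phi> c = \<psi> (poly u z) * \<psi> h'"
        using hom_basic(4)[OF \<psi>(1) AR(1) uz h'(1)] \<psi>(2)[OF cu(1)] by simp
      then have "\<psi> h' \<noteq> 0" using nz by auto
      then show "\<exists>\<psi>. ring_hom_on P (adj R z) \<psi> \<and> \<psi> h' \<noteq> 0 \<and> (\<forall>a\<in>R. \<psi> a = \<phi> a)"
        using \<psi> by blast
    qed (use pr dP cu dR subring_closed[OF R] in auto)
  qed
qed

section \<open>Extension by finitely many generators\<close>

fun adjs :: "'a::comm_ring_1 set \<Rightarrow> 'a list \<Rightarrow> 'a set" where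
  "adjs R [] = R"
| "adjs R (z # zs) = adjs (adj R z) zs"

lemma adjs_properties:
  assumes "subring R"
  shows "subring (adjs R zs)" "R \<subseteq> adjs R zs" "set zs \<subseteq> adjs R zs"
    "subring S \<Longrightarrow> R \<subseteq> S \<Longrightarrow> set zs \<subseteq> S \<Longrightarrow> adjs R zs \<subseteq> S"
proof -
  have "subring (adjs R zs) \<and> R \<subseteq> adjs R zs \<and> set zs \<subseteq> adjs R zs
     \<and> (subring S \<longrightarrow> R \<subseteq> S \<longrightarrow> set zs \<subseteq> S \<longrightarrow> adjs R zs \<subseteq> S)"
    using assms
  proof (induction zs arbitrary: R)
    case (Cons z zs)
    note * = adj_properties[OF Cons.prems, where z=z]
    show ?case using Cons.IH[OF *(1)] *(2,3) *(4)[of S] by auto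
  qed simp
  then show "subring (adjs R zs)" "R \<subseteq> adjs R zs" "set zs \<subseteq> adjs R zs"
    "subring S \<Longrightarrow> R \<subseteq> S \<Longrightarrow> set zs \<subseteq> S \<Longrightarrow> adjs R zs \<subseteq> S" by blast+
qed

lemma extension_chain:
  fixes P R :: "'a::comm_ring_1 set"
  assumes P: "prime_ideal P" and R: "subring R" and h': "h' \<in> adjs R zs" "h' \<notin> P"
  shows "\<exists>h\<in>R. h \<notin> P \<and> (\<forall>\<phi>::'a \<Rightarrow> 'k::{alg_closed_field, field_char_0}. ring_hom_on P R \<phi> \<longrightarrow> \<phi> h \<noteq> 0 \<longrightarrow>
    (\<exists>\<psi>. ring_hom_on P (adjs R zs) \<psi> \<and> \<psi> h' \<noteq> 0 \<and> (\<forall>a\<in>R. \<psi> a = \<phi> a)))"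
  using R h'
proof (induction zs arbitrary: R)
  case Nil
  then show ?case by auto
next
  case (Cons z zs)
  have A: "subring (adj R z)" "R \<subseteq> adj R z" using adj_properties[OF Cons.prems(1)] by blast+
  obtain h1 where h1: "h1 \<in> adj R z" "h1 \<notin> P" and
    e1: "\<And>\<phi>::'a \<Rightarrow> 'k. ring_hom_on P (adj R z) \<phi> \<Longrightarrow> \<phi> h1 \<noteq> 0 \<Longrightarrow>
    (\<exists>\<psi>. ring_hom_on P (adjs (adj R z) zs) \<psi> \<and> \<psi> h' \<noteq> 0 \<and> (\<forall>a\<in>adj R z. \<psi> a = \<phi> a))"
    using Cons.IH[OF A(1)] Cons.prems by auto
  obtain h where h: "h \<in> R" "h \<notin> P" and
    e: "\<And>\<phi>::'a \<Rightarrow> 'k. ring_hom_on P R \<phi> \<Longrightarrow> \<phi> h \<noteq> 0 \<Longrightarrow>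
    (\<exists>\<psi>. ring_hom_on P (adj R z) \<psi> \<and> \<psi> h1 \<noteq> 0 \<and> (\<forall>a\<in>R. \<psi> a = \<phi> a))"
    using extension_step[OF P Cons.prems(1) h1, where 'k='k] by blast
  show ?case
  proof (intro bexI[of _ h] conjI allI impI h)
    fix \<phi> :: "'a \<Rightarrow> 'k"
    assume "ring_hom_on P R \<phi>" "\<phi> h \<noteq> 0"
    then obtain \<chi> where \<chi>: "ring_hom_on P (adj R z) \<chi>" "\<chi> h1 \<noteq> 0" "\<forall>a\<in>R. \<chi> a = \<phi> a"
      using e by blast
    then obtain \<psi> where "ring_hom_on P (adjs (adj R z) zs) \<psi>" "\<psi> h' \<noteq> 0" "\<forall>a\<in>adj R z. \<psi> a = \<chi> a"
      using e1 by blast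
    then show "\<exists>\<psi>. ring_hom_on P (adjs R (z # zs)) \<psi> \<and> \<psi> h' \<noteq> 0 \<and> (\<forall>a\<in>R. \<psi> a = \<phi> a)"
      using \<chi> A(2) by (intro exI[of _ \<psi>]) auto
  qed
qed

text \<open>By Zorn there is a maximal ideal among those containing \<open>I\<close> and disjoint
  from \<open>S\<close>. If it omitted a and b but contained ab, adjoining each would reach elements
  of \<open>S\<close> whose product lies both in \<open>S\<close> and in the ideal.\<close>

lemma prime_ideal_avoiding:
  fixes I S :: "'a::comm_ring_1 set"
  assumes I: "ring_ideal I" and S: "1 \<in> S" "\<And>a b. a \<in> S \<Longrightarrow> b \<in> S \<Longrightarrow> a * b \<in> S" and disj: "I \<inter> S = {}"
  obtains P where "prime_ideal P" "I \<subseteq> P" "P \<inter> S = {}"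
proof -
  define A where "A = {Q. ring_ideal Q \<and> I \<subseteq> Q \<and> Q \<inter> S = {}}"
  have "\<exists>M\<in>A. \<forall>X\<in>A. M \<subseteq> X \<longrightarrow> X = M"
  proof (rule subset_Zorn_nonempty)
    show "A \<noteq> {}" using I disj by (auto simp: A_def)
    fix C assume C: "C \<noteq> {}" "subset.chain A C"
    have CA: "\<And>Q. Q \<in> C \<Longrightarrow> ring_ideal Q \<and> I \<subseteq> Q \<and> Q \<inter> S = {}"
      using C(2) by (auto simp: subset.chain_def A_def)
    have "a + b \<in> \<Union>C" if ab: "a \<in> \<Union>C" "b \<in> \<Union>C" for a b
    proof -
      obtain X Y where XY: "X \<in> C" "Y \<in> C" "a \<in> X" "b \<in> Y" using ab by blast
      then have "X \<subseteq> Y \<or> Y \<subseteq> X" using C(2) by (auto simp: subset.chain_def)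
      then show ?thesis using XY CA ideal_closed(2) by (metis UnionI subsetD)
    qed
    moreover have "a * b \<in> \<Union>C" if "b \<in> \<Union>C" for a b
      using that CA ideal_closed(3) by blast
    moreover have "0 \<in> \<Union>C" using C(1) CA ideal_closed(1) by blast
    ultimately have "ring_ideal (\<Union>C)" by (simp add: ring_ideal_def)
    then show "\<Union>C \<in> A" using CA C(1) by (auto simp: A_def)
  qed
  then obtain P where PA: "P \<in> A" and max: "\<And>X. X \<in> A \<Longrightarrow> P \<subseteq> X \<Longrightarrow> X = P" by blast
  have P: "ring_ideal P" "I \<subseteq> P" "P \<inter> S = {}" using PA by (auto simp: A_def)
  have meets: "\<exists>s\<in>S. \<exists>p\<in>P. \<exists>r. s = p + r * a" if a: "a \<notin> P" for a
  proof -
    define X where "X = {p + r * a | p r. p \<in> P}"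
    have "ring_ideal X" "P \<subseteq> X" "a \<in> X" unfolding X_def by (rule ideal_adjoin[OF P(1)])+
    then have "X \<inter> S \<noteq> {}" using max[of X] a P(2) by (auto simp: A_def)
    then show ?thesis by (auto simp: X_def)
  qed
  have "prime_ideal P"
    unfolding prime_ideal_def
  proof (intro conjI allI impI)
    show "ring_ideal P" by fact
    show "1 \<notin> P" using P(3) S(1) by blast
    fix a b assume ab: "a * b \<in> P"
    show "a \<in> P \<or> b \<in> P"
    proof (rule ccontr)
      assume "\<not> ?thesis"
      then obtain s p r s' p' r' where s: "s \<in> S" "p \<in> P" "s = p + r * a" "s' \<in> S" "p' \<in> P" "s' = p' + r' * b"
        using meets by metis
      have "s * s' = (p' + r' * b) * p + (r * a) * p' + (r * r') * (a * b)"
        by (simp add: s algebra_simps)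
      then have "s * s' \<in> P" using s ab ideal_closed[OF P(1)] by metis
      then show False using S(2) s P(3) by blast
    qed
  qed
  then show ?thesis using that P by blast
qed

section \<open>Laurent polynomials as a ring\<close>

abbreviation "lookup \<equiv> Poly_Mapping.lookup"
abbreviation "keys \<equiv> Poly_Mapping.keys"
abbreviation "single \<equiv> Poly_Mapping.single"

section \<open>Substitution homomorphisms\<close>

definition coeff_hom :: "('a::comm_ring_1 \<Rightarrow> 'b::comm_ring_1) \<Rightarrow> bool" where
  "coeff_hom C \<longleftrightarrow> C 0 = 0 \<and> C 1 = 1 \<and> (\<forall>a b. C (a + b) = C a + C b \<and> C (a * b) = C a * C b)"

definition expo_hom :: "('e::comm_monoid_add \<Rightarrow> 'b::comm_ring_1) \<Rightarrow> bool" where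
  "expo_hom X \<longleftrightarrow> X 0 = 1 \<and> (\<forall>a b. X (a + b) = X a * X b)"

text \<open>The common form of the substitutions \<open>xeval\<close>, \<open>yev\<close> and
  \<open>hat\<close>: \<open>C\<close> acts on coefficients and \<open>X\<close> on
  exponents.\<close>

definition pm_eval :: "('a::comm_ring_1 \<Rightarrow> 'b::comm_ring_1) \<Rightarrow> ('e \<Rightarrow> 'b) \<Rightarrow> ('e \<Rightarrow>\<^sub>0 'a) \<Rightarrow> 'b" where
  "pm_eval C X F = (\<Sum>e\<in>keys F. C (lookup F e) * X e)"

lemma sum_monomials: "(\<Sum>e\<in>keys F. single e (lookup F e)) = F"
proof (rule poly_mapping_eqI)
  fix e
  have "lookup (\<Sum>k\<in>keys F. single k (lookup F k)) e
      = (\<Sum>k\<in>keys F. if k = e then lookup F k else 0)"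
    by (simp add: lookup_sum lookup_single when_def)
  also have "\<dots> = lookup F e" by (simp add: sum.delta in_keys_iff)
  finally show "lookup (\<Sum>k\<in>keys F. single k (lookup F k)) e = lookup F e" .
qed

lemma times_monomials:
  fixes F G :: "'e::comm_monoid_add \<Rightarrow>\<^sub>0 'a::comm_ring_1"
  shows "F * G = (\<Sum>a\<in>keys F. \<Sum>b\<in>keys G. single (a + b) (lookup F a * lookup G b))"
  by (subst (1 2) sum_monomials[symmetric]) (simp only: sum_product mult_single)

lemma pm_eval_superset:
  assumes "C 0 = 0" "finite A" "keys F \<subseteq> A"
  shows "pm_eval C X F = (\<Sum>e\<in>A. C (lookup F e) * X e)"
  unfolding pm_eval_def
  by (rule sum.mono_neutral_left) (use assms in \<open>auto simp: in_keys_iff\<close>)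

context
  fixes C :: "'a::comm_ring_1 \<Rightarrow> 'b::comm_ring_1" and X :: "'e::comm_monoid_add \<Rightarrow> 'b"
  assumes C: "coeff_hom C" and X: "expo_hom X"
begin

lemma pm_eval_single: "pm_eval C X (single e c) = C c * X e"
  using pm_eval_superset[of C "{e}" "single e c" X] C
  by (simp add: coeff_hom_def)

lemma pm_eval_0: "pm_eval C X 0 = 0" by (simp add: pm_eval_def)

lemma pm_eval_1: "pm_eval C X 1 = 1"
  unfolding single_one[symmetric] pm_eval_single using C X by (simp add: coeff_hom_def expo_hom_def)

lemma pm_eval_add: "pm_eval C X (F + G) = pm_eval C X F + pm_eval C X G"
proof -
  let ?A = "keys F \<union> keys G"
  have z: "C 0 = 0" using C by (simp add: coeff_hom_def)
  have "pm_eval C X H = (\<Sum>e\<in>?A. C (lookup H e) * X e)" if "keys H \<subseteq> ?A" for H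
    using that by (intro pm_eval_superset z) auto
  moreover have "keys (F + G) \<subseteq> ?A" by (rule keys_add)
  ultimately show ?thesis
    using C by (simp add: lookup_add coeff_hom_def algebra_simps sum.distrib)
qed

lemma pm_eval_sum: "pm_eval C X (sum f A) = (\<Sum>x\<in>A. pm_eval C X (f x))"
  by (induction A rule: infinite_finite_induct) (auto simp: pm_eval_0 pm_eval_add)

lemma pm_eval_mult: "pm_eval C X (F * G) = pm_eval C X F * pm_eval C X G"
proof -
  have "pm_eval C X (F * G) = (\<Sum>a\<in>keys F. \<Sum>b\<in>keys G.
      C (lookup F a * lookup G b) * X (a + b))"
    by (simp only: times_monomials pm_eval_sum pm_eval_single)
  also have "\<dots> = pm_eval C X F * pm_eval C X G"
    using C X by (simp add: pm_eval_def sum_product coeff_hom_def expo_hom_def mult_ac)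
  finally show ?thesis .
qed

lemma pm_eval_minus: "pm_eval C X (F - G) = pm_eval C X F - pm_eval C X G"
  using pm_eval_add[of "F - G" G] by (simp add: algebra_simps)

lemma pm_eval_power: "pm_eval C X (F ^ n) = pm_eval C X F ^ n"
  by (induction n) (auto simp: pm_eval_1 pm_eval_mult)

lemma pm_eval_poly: "pm_eval C X (poly p z) = poly (map_poly (pm_eval C X) p) (pm_eval C X z)"
proof -
  have "degree (map_poly (pm_eval C X) p) \<le> degree p"
    by (rule degree_le) (simp add: coeff_map_poly pm_eval_0 coeff_eq_0)
  then have "poly (map_poly (pm_eval C X) p) y
      = (\<Sum>i\<le>degree p. coeff (map_poly (pm_eval C X) p) i * y ^ i)" for y
    unfolding poly_altdef by (intro sum.mono_neutral_left) (auto simp: coeff_eq_0)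
  then show ?thesis
    by (simp add: poly_altdef pm_eval_sum pm_eval_mult pm_eval_power coeff_map_poly pm_eval_0)
qed

end

text \<open>Finitely supported functions as a ring type; \<open>lookup\<close> links them to the
  coefficient functions in which the theorem is stated.\<close>

type_synonym ('n, 'm, 'k) lpm = "('n \<Rightarrow> int) \<times> ('m \<Rightarrow> nat) \<Rightarrow>\<^sub>0 'k"

lemma lsupp_lookup: "lsupp (lookup F) = keys F"
  by (auto simp: lsupp_def in_keys_iff)

lemma is_lpoly_lookup: "is_lpoly (lookup (F :: ('n, 'm, 'k::zero) lpm))"
  by (simp add: is_lpoly_def lsupp_lookup)

lemma lpolyE:
  assumes "is_lpoly f"
  obtains F :: "('n, 'm, 'k::zero) lpm" where "f = lookup F"
  using assms that[of "Abs_poly_mapping f"] by (simp add: is_lpoly_def lsupp_def)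

lemma lookup_mult_lp:
  "lookup (F * G) = lp_mult (lookup F) (lookup (G :: ('n, 'm, 'k::comm_ring_1) lpm))"
proof
  fix e
  let ?K = "keys F \<times> keys G"
  have "lookup (F * G) e = (\<Sum>p\<in>?K. if fst p + snd p = e then lookup F (fst p) * lookup G (snd p) else 0)"
    by (simp add: times_monomials lookup_sum lookup_single when_def sum.cartesian_product case_prod_beta)
  also have "\<dots> = (\<Sum>p\<in>{p \<in> ?K. fst p + snd p = e}. lookup F (fst p) * lookup G (snd p))"
    by (simp add: sum.If_cases Int_def)
  also have "{p \<in> ?K. fst p + snd p = e} = {(a, b). a \<in> lsupp (lookup F) \<and> b \<in> lsupp (lookup G)
        \<and> (\<lambda>j. fst a j + fst b j) = fst e \<and> (\<lambda>i. snd a i + snd b i) = snd e}"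
    by (auto simp: lsupp_lookup prod_eq_iff plus_fun_def)
  finally show "lookup (F * G) e = lp_mult (lookup F) (lookup G) e"
    by (simp add: lp_mult_def)
qed

definition pm_ideal :: "(('n \<Rightarrow> int) \<times> ('m \<Rightarrow> nat) \<Rightarrow> 'k::comm_ring_1) set \<Rightarrow> ('n, 'm, 'k) lpm set" where
  "pm_ideal I = {F. lookup F \<in> I}"

lemma ring_ideal_pm_ideal:
  fixes I :: "(('n \<Rightarrow> int) \<times> ('m \<Rightarrow> nat) \<Rightarrow> 'k::comm_ring_1) set"
  assumes "lp_ideal I"
  shows "ring_ideal (pm_ideal I)"
  unfolding ring_ideal_def pm_ideal_def
proof (intro conjI ballI allI; clarsimp)
  show "lookup (0 :: ('n, 'm, 'k) lpm) \<in> I"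
  proof -
    have "lookup (0 :: ('n, 'm, 'k) lpm) = (\<lambda>_. 0)" by auto
    then show ?thesis using assms by (simp add: lp_ideal_def)
  qed
next
  fix F G :: "('n, 'm, 'k) lpm" assume "lookup F \<in> I" "lookup G \<in> I"
  moreover have "lookup (F + G) = lp_add (lookup F) (lookup G)"
    by (auto simp: lp_add_def lookup_add)
  ultimately show "lookup (F + G) \<in> I" using assms by (simp add: lp_ideal_def)
next
  fix F G :: "('n, 'm, 'k) lpm" assume "lookup F \<in> I"
  then show "lookup (G * F) \<in> I"
    using assms is_lpoly_lookup[of G] by (simp add: lp_ideal_def lookup_mult_lp)
qed

definition cst :: "'k::comm_ring_1 \<Rightarrow> ('n, 'm, 'k) lpm" where
  "cst c = single 0 c"

definition xvar :: "'n \<Rightarrow> ('n, 'm, 'k::comm_ring_1) lpm" where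
  "xvar j = single ((\<lambda>j'. if j' = j then 1 else 0), 0) 1"

definition yvar :: "'m \<Rightarrow> ('n, 'm, 'k::comm_ring_1) lpm" where
  "yvar i = single (0, (\<lambda>i'. if i' = i then 1 else 0)) 1"

lemma single_1_power:
  "single (e::'e::comm_monoid_add) (1::'k::comm_ring_1) ^ n = single (\<Sum>k<n. e) 1"
  by (induction n) (simp_all add: mult_single add.commute)

lemma single_1_prod:
  "(\<Prod>x\<in>A. single (f x) (1::'k::comm_ring_1)) = single (\<Sum>x\<in>A. f x::'e::comm_monoid_add) 1"
  by (induction A rule: infinite_finite_induct) (simp_all add: mult_single)

lemma sum_fun_apply: "(\<Sum>x\<in>A. f x) y = (\<Sum>x\<in>A. f x y)" for f :: "'a \<Rightarrow> 'b \<Rightarrow> 'c::comm_monoid_add"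
  by (induction A rule: infinite_finite_induct) auto

lemma fst_sum: "fst (\<Sum>x\<in>A. f x) = (\<Sum>x\<in>A. fst (f x))" and snd_sum: "snd (\<Sum>x\<in>A. f x) = (\<Sum>x\<in>A. snd (f x))"
  for f :: "'a \<Rightarrow> 'b::comm_monoid_add \<times> 'c::comm_monoid_add"
  by (induction A rule: infinite_finite_induct) auto

lemma sum_const_expo:
  "(\<Sum>k<n. e) = ((\<lambda>j. int n * fst e j), (\<lambda>i. n * snd e i))" for e :: "('n \<Rightarrow> int) \<times> ('m \<Rightarrow> nat)"
  by (induction n) (auto simp: prod_eq_iff fun_eq_iff algebra_simps)

lemma monomial_factorization:
  fixes e :: "('n::finite \<Rightarrow> int) \<times> ('m::finite \<Rightarrow> nat)"
  assumes "\<And>j. fst e j \<ge> 0"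
  shows "single e c = cst c * (\<Prod>j\<in>UNIV. xvar j ^ nat (fst e j)) * (\<Prod>i\<in>UNIV. yvar i ^ snd e i)"
    (is "_ = ?r")
proof -
  have x: "(\<Prod>j\<in>UNIV. xvar j ^ nat (fst e j)) = (single (fst e, 0) 1 :: ('n, 'm, 'a) lpm)"
    unfolding xvar_def single_1_power single_1_prod sum_const_expo
    using assms by (intro arg_cong[of _ _ "\<lambda>e. single e 1"])
      (auto simp: prod_eq_iff fst_sum snd_sum fun_eq_iff sum_fun_apply if_distrib sum.delta cong: if_cong)
  have y: "(\<Prod>i\<in>UNIV. yvar i ^ snd e i) = (single (0, snd e) 1 :: ('n, 'm, 'a) lpm)"
    unfolding yvar_def single_1_power single_1_prod sum_const_expo
    by (intro arg_cong[of _ _ "\<lambda>e. single e 1"])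
      (auto simp: prod_eq_iff fst_sum snd_sum fun_eq_iff sum_fun_apply if_distrib sum.delta cong: if_cong)
  show ?thesis unfolding x y cst_def mult_single by (simp add: prod_eq_iff)
qed

lemma nonneg_mem_subring:
  fixes F :: "('n::finite, 'm::finite, 'k::comm_ring_1) lpm"
  assumes R: "subring R" and cst: "range cst \<subseteq> R" and x: "range xvar \<subseteq> R"
    and nonneg: "\<And>e j. e \<in> keys F \<Longrightarrow> fst e j \<ge> 0"
    and y: "range yvar \<subseteq> R \<or> (\<forall>e\<in>keys F. snd e = 0)"
  shows "F \<in> R"
proof -
  have "single e (lookup F e) \<in> R" if e: "e \<in> keys F" for e
  proof -
    have "(\<Prod>i\<in>UNIV. yvar i ^ snd e i) \<in> R"
      using y
    proof
      assume "range yvar \<subseteq> R"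
      then show ?thesis by (intro subring_prod[OF R] subring_power[OF R]) auto
    qed (use e subring_closed(1)[OF R] in auto)
    moreover have "(\<Prod>j\<in>UNIV. xvar j ^ nat (fst e j)) \<in> R"
      using x by (intro subring_prod[OF R] subring_power[OF R]) auto
    moreover have "cst (lookup F e) \<in> R" using cst by auto
    ultimately show ?thesis
      unfolding monomial_factorization[OF nonneg[OF e]] by (intro subring_closed[OF R])
  qed
  then have "(\<Sum>e\<in>keys F. single e (lookup F e)) \<in> R"
    by (intro subring_sum[OF R])
  then show ?thesis by (simp only: sum_monomials)
qed

lemma hom_pt_eval:
  fixes F :: "('n::finite, 'm::finite, 'k::comm_ring_1) lpm"
  assumes hom: "ring_hom_on P R \<phi>" and R: "subring R"
    and cst: "range cst \<subseteq> R" and x: "range xvar \<subseteq> R" and y: "range yvar \<subseteq> R"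
    and \<phi>: "\<And>c. \<phi> (cst c) = c"
    and nonneg: "\<And>e j. e \<in> keys F \<Longrightarrow> fst e j \<ge> 0"
  shows "\<phi> F = pt_eval (lookup F) (\<lambda>j. \<phi> (xvar j)) (\<lambda>i. \<phi> (yvar i))"
proof -
  note h = hom_basic[OF hom R] hom_power[OF hom R] hom_prod[OF hom R] hom_sum[OF hom R]
  have Y: "(\<Prod>i\<in>UNIV. yvar i ^ snd e i) \<in> R" for e :: "('n \<Rightarrow> int) \<times> ('m \<Rightarrow> nat)"
    using y by (intro subring_prod[OF R] subring_power[OF R]) auto
  have X: "(\<Prod>j\<in>UNIV. xvar j ^ nat (fst e j)) \<in> R" for e :: "('n \<Rightarrow> int) \<times> ('m \<Rightarrow> nat)"
    using x by (intro subring_prod[OF R] subring_power[OF R]) auto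
  have Cc: "cst c \<in> R" for c using cst by auto
  have mono: "\<phi> (single e (lookup F e)) = lookup F e
      * (\<Prod>j\<in>UNIV. \<phi> (xvar j) ^ nat (fst e j)) * (\<Prod>i\<in>UNIV. \<phi> (yvar i) ^ snd e i)
      \<and> single e (lookup F e) \<in> R" if e: "e \<in> keys F" for e
  proof
    have px: "\<phi> (\<Prod>j\<in>UNIV. xvar j ^ nat (fst e j)) = (\<Prod>j\<in>UNIV. \<phi> (xvar j) ^ nat (fst e j))"
      using x by (subst h(7)) (auto intro!: subring_power[OF R] prod.cong h(6))
    have py: "\<phi> (\<Prod>i\<in>UNIV. yvar i ^ snd e i) = (\<Prod>i\<in>UNIV. \<phi> (yvar i) ^ snd e i)"
      using y by (subst h(7)) (auto intro!: subring_power[OF R] prod.cong h(6))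
    show "\<phi> (single e (lookup F e)) = lookup F e
      * (\<Prod>j\<in>UNIV. \<phi> (xvar j) ^ nat (fst e j)) * (\<Prod>i\<in>UNIV. \<phi> (yvar i) ^ snd e i)"
      unfolding monomial_factorization[OF nonneg[OF e]]
      using h(4)[OF subring_closed(5)[OF R Cc X] Y] h(4)[OF Cc X] \<phi> px py by simp
    show "single e (lookup F e) \<in> R"
      unfolding monomial_factorization[OF nonneg[OF e]] by (intro subring_closed[OF R] X Y Cc)
  qed
  have "\<phi> F = \<phi> (\<Sum>e\<in>keys F. single e (lookup F e))"
    by (simp only: sum_monomials)
  also have "\<dots> = pt_eval (lookup F) (\<lambda>j. \<phi> (xvar j)) (\<lambda>i. \<phi> (yvar i))"
    unfolding pt_eval_def lsupp_lookup using mono by (subst h(8)) auto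
  finally show ?thesis .
qed

text \<open>Laurent polynomials free of \<open>y\<close>; negative exponents of \<open>x\<close> are
  allowed.\<close>

definition xpolys :: "('n, 'm, 'k::comm_ring_1) lpm set" where
  "xpolys = {F. \<forall>e\<in>keys F. snd e = 0}"

lemma subring_xpolys: "subring (xpolys :: ('n, 'm, 'k::comm_ring_1) lpm set)"
  unfolding subring_def
proof (intro conjI ballI)
  show "1 \<in> xpolys" by (auto simp: xpolys_def)
  fix F G :: "('n, 'm, 'k) lpm" assume FG: "F \<in> xpolys" "G \<in> xpolys"
  have "keys (F - G) \<subseteq> keys F \<union> keys G"
    by (auto simp: in_keys_iff lookup_minus)
  then show "F - G \<in> xpolys" using FG by (auto simp: xpolys_def)
  have "keys (F * G) \<subseteq> {a + b |a b. a \<in> keys F \<and> b \<in> keys G}"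
    by (rule keys_mult)
  then show "F * G \<in> xpolys" using FG by (fastforce simp: xpolys_def)
qed

section \<open>Weights of exponents and the substitution of powers of t\<close>

definition weight :: "('n::finite \<Rightarrow> real) \<Rightarrow> ('n \<Rightarrow> rat) \<Rightarrow> real" where
  "weight \<omega> \<alpha> = (\<Sum>j\<in>UNIV. \<omega> j * real_of_rat (\<alpha> j))"

definition rational_indep :: "('n::finite \<Rightarrow> real) \<Rightarrow> bool" where
  "rational_indep \<omega> \<longleftrightarrow> (\<forall>q. weight \<omega> q = 0 \<longrightarrow> q = 0)"

lemma weight_add: "weight \<omega> (\<alpha> + \<beta>) = weight \<omega> \<alpha> + weight \<omega> \<beta>"
  by (simp add: weight_def of_rat_add algebra_simps sum.distrib)

lemma weight_diff: "weight \<omega> (\<alpha> - \<beta>) = weight \<omega> \<alpha> - weight \<omega> \<beta>"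
  by (simp add: weight_def of_rat_diff algebra_simps sum_subtractf)

lemma weight_0 [simp]: "weight \<omega> 0 = 0"
  by (simp add: weight_def)

lemma weight_inject: "rational_indep \<omega> \<Longrightarrow> weight \<omega> \<alpha> = weight \<omega> \<beta> \<longleftrightarrow> \<alpha> = \<beta>"
  using weight_diff[of \<omega> \<alpha> \<beta>] unfolding rational_indep_def by (metis diff_self right_minus_eq)

definition rat_expo :: "('n \<Rightarrow> int) \<Rightarrow> ('n \<Rightarrow> rat)" where
  "rat_expo a = (\<lambda>j. of_int (a j))"

lemma rat_expo_add: "rat_expo (a + b) = rat_expo a + rat_expo b"
  and rat_expo_0: "rat_expo 0 = 0"
  by (auto simp: rat_expo_def fun_eq_iff)

lemma rat_expo_inject: "rat_expo a = rat_expo b \<longleftrightarrow> a = b"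
  by (auto simp: rat_expo_def fun_eq_iff)

text \<open>Substitutes t^(\<omega>\<cdot>a) for x^a and 1 for every \<open>y\<close>; it is meant
  for elements of \<open>xpolys\<close>.\<close>

definition xeval :: "('n::finite \<Rightarrow> real) \<Rightarrow> ('n, 'm, 'k::comm_ring_1) lpm \<Rightarrow> 'k lfs" where
  "xeval \<omega> = pm_eval (\<lambda>c. sconst c 0) (\<lambda>e. sconst 1 (weight \<omega> (rat_expo (fst e))))"

lemma xeval_hom:
  "coeff_hom (\<lambda>c::'k::comm_ring_1. sconst c 0)"
  "expo_hom (\<lambda>e::('n::finite \<Rightarrow> int) \<times> ('m \<Rightarrow> nat). sconst (1::'k::comm_ring_1) (weight \<omega> (rat_expo (fst e))))"
  by (simp_all add: coeff_hom_def expo_hom_def sconst_1 sconst_add sconst_mult rat_expo_add weight_add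
      rat_expo_0)

text \<open>Independence gives distinct monomials in \<open>x\<close> distinct exponents of t, so
  nothing cancels.\<close>

lemma xeval_nonzero:
  fixes F :: "('n::finite, 'm, 'k::comm_ring_1) lpm"
  assumes \<omega>: "rational_indep (\<omega> :: 'n \<Rightarrow> real)" and F: "F \<in> xpolys" "F \<noteq> 0"
  shows "xeval \<omega> F \<noteq> 0"
proof -
  obtain e where e: "e \<in> keys F" using F(2) by (metis all_not_in_conv keys_eq_empty)
  have inj: "weight \<omega> (rat_expo (fst e)) = weight \<omega> (rat_expo (fst e')) \<longleftrightarrow> e = e'"
    if "e' \<in> keys F" for e'
    using that e F(1) weight_inject[OF \<omega>] by (auto simp: rat_expo_inject prod_eq_iff xpolys_def)
  have "scoeff (xeval \<omega> F) (weight \<omega> (rat_expo (fst e)))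
      = (\<Sum>e'\<in>keys F. if e = e' then lookup F e' else 0)"
    unfolding xeval_def pm_eval_def scoeff_sum
    by (intro sum.cong refl) (simp add: sconst_mult inj)
  also have "\<dots> = lookup F e" using e by simp
  finally show ?thesis using e by (auto simp: in_keys_iff)
qed

lemma xpolys_domain:
  fixes F G :: "('n::finite, 'm, 'k::idom) lpm"
  assumes "rational_indep (\<omega> :: 'n \<Rightarrow> real)" "F \<in> xpolys" "G \<in> xpolys" "F \<noteq> 0" "G \<noteq> 0"
  shows "F * G \<noteq> 0"
proof
  assume "F * G = 0"
  moreover have "xeval \<omega> (F * G) = xeval \<omega> F * xeval \<omega> G"
    unfolding xeval_def by (rule pm_eval_mult[OF xeval_hom])
  moreover have "xeval \<omega> (0 :: ('n, 'm, 'k) lpm) = 0"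
    unfolding xeval_def by (rule pm_eval_0[OF xeval_hom])
  ultimately have "xeval \<omega> F * xeval \<omega> G = 0" by simp
  then show False using xeval_nonzero assms by (metis mult_eq_0_iff)
qed

text \<open>If no relation existed, a prime ideal containing \<open>I\<close> would meet \<open>K[x, y\<^sub>i]\<close> only in \<open>0\<close>, and
  infinitely many values of \<open>y\<^sub>i\<close> over a generic \<open>x\<close> would extend to points of the zero set.\<close>
lemma fibre_relation:
  fixes I :: "(('n::finite \<Rightarrow> int) \<times> ('m::finite \<Rightarrow> nat) \<Rightarrow> 'k::{alg_closed_field, field_char_0}) set"
  assumes \<omega>: "rational_indep (\<omega> :: 'n \<Rightarrow> real)" and ideal: "lp_ideal I" and adm: "N_admissible I"
  shows "\<exists>q. q \<noteq> 0 \<and> poly_over xpolys q \<and> poly q (yvar i) \<in> pm_ideal I"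
proof (rule ccontr)
  assume contra: "\<not> ?thesis"
  obtain g :: "('n \<Rightarrow> int) \<times> ('m \<Rightarrow> nat) \<Rightarrow> 'k" where g: "is_xpoly g" "g \<noteq> (\<lambda>_. 0)"
    and fin: "\<And>a. pt_eval g a (\<lambda>_. 0) \<noteq> 0 \<Longrightarrow> finite {b. (a, b) \<in> zero_set (poly_part I)}"
    using adm unfolding N_admissible_def by blast
  obtain G :: "('n, 'm, 'k) lpm" where G: "g = lookup G" using g(1) lpolyE by (auto simp: is_xpoly_def)
  have G0: "G \<noteq> 0" using g(2) G by auto
  have Gk: "\<And>e. e \<in> keys G \<Longrightarrow> (\<forall>j. fst e j \<ge> 0) \<and> snd e = 0"
    using g(1) by (auto simp: is_xpoly_def G lsupp_lookup fun_eq_iff)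
  let ?K = "range (cst :: 'k \<Rightarrow> ('n, 'm, 'k) lpm)"
  obtain ns :: "'n list" where ns: "set ns = UNIV" using finite_list[OF finite_UNIV] by blast
  obtain ms :: "'m list" where ms: "set ms = UNIV" using finite_list[OF finite_UNIV] by blast
  \<comment> \<open>The ring K[x] without inverses of the variables, because points of the zero set
    may have zero coordinates and \<open>poly_part\<close> has nonnegative exponents only.\<close>
  define Rx where "Rx = adjs ?K (map xvar ns)"
  define R1 where "R1 = adj Rx (yvar i)"
  define R2 where "R2 = adjs R1 (map yvar ms)"
  have K: "subring ?K"
    unfolding subring_def
  proof (intro conjI ballI)
    have "1 = (cst 1 :: ('n, 'm, 'k) lpm)" by (simp add: cst_def)
    then show "1 \<in> ?K" by blast
    fix a b assume "a \<in> ?K" "b \<in> ?K"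
    then obtain c d where "a = cst c" "b = cst d" by blast
    then have "a - b = cst (c - d)" "a * b = cst (c * d)"
      by (simp_all add: cst_def single_diff mult_single)
    then show "a - b \<in> ?K" "a * b \<in> ?K" by blast+
  qed
  have xp: "?K \<subseteq> xpolys" "set (map xvar ns) \<subseteq> (xpolys :: ('n, 'm, 'k) lpm set)"
    by (auto simp: xpolys_def cst_def xvar_def prod_eq_iff split: if_splits)
  have Rx: "subring Rx" "?K \<subseteq> Rx" "range xvar \<subseteq> Rx" "Rx \<subseteq> xpolys"
    unfolding Rx_def using adjs_properties[OF K, where zs="map xvar ns"]
      adjs_properties(4)[OF K subring_xpolys xp] ns by auto
  have R1: "subring R1" "Rx \<subseteq> R1" "yvar i \<in> R1"
    unfolding R1_def using adj_properties[OF Rx(1)] by blast+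
  have R2: "subring R2" "R1 \<subseteq> R2" "range yvar \<subseteq> R2"
    unfolding R2_def using adjs_properties[OF R1(1), where zs="map yvar ms"] ms by auto
  have nz: "a * b \<noteq> 0" if "a \<in> Rx" "b \<in> Rx" "a \<noteq> 0" "b \<noteq> 0" for a b
    using that xpolys_domain[OF \<omega>] Rx(4) by blast
  \<comment> \<open>The values at y_i of nonzero polynomials over K[x]. A common element with the
    ideal would be a relation; leading coefficients from a domain make \<open>S\<close> closed under
    products.\<close>
  define S where "S = {poly q (yvar i) | q. poly_over Rx q \<and> q \<noteq> 0}"
  have "pm_ideal I \<inter> S = {}"
  proof -
    have "poly q (yvar i) \<notin> pm_ideal I" if "poly_over Rx q" "q \<noteq> 0" for q
      using contra that Rx(4) by (auto simp: poly_over_def)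
    then show ?thesis by (auto simp: S_def)
  qed
  moreover have "1 \<in> S"
    unfolding S_def using poly_over_closed(7)[OF Rx(1) subring_closed(1)[OF Rx(1)]]
    by (intro CollectI exI[of _ "[:1:]"]) auto
  moreover have "a * b \<in> S" if ab: "a \<in> S" "b \<in> S" for a b
  proof -
    obtain p q where pq: "a = poly p (yvar i)" "b = poly q (yvar i)" "poly_over Rx p" "poly_over Rx q"
        "p \<noteq> 0" "q \<noteq> 0"
      using ab by (auto simp: S_def)
    have "lead_coeff p * lead_coeff q \<noteq> 0"
      using pq by (intro nz) (auto simp: poly_over_def)
    then have "coeff (p * q) (degree p + degree q) \<noteq> 0" by (simp add: coeff_mult_degree_sum)
    then have "p * q \<noteq> 0" by auto
    then show ?thesis unfolding S_def using pq poly_over_closed(4)[OF Rx(1) pq(3,4)]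
      by (intro CollectI exI[of _ "p * q"]) auto
  qed
  ultimately obtain P where P: "prime_ideal P" "pm_ideal I \<subseteq> P" "P \<inter> S = {}"
    using prime_ideal_avoiding[OF ring_ideal_pm_ideal[OF ideal], of S] by blast
  have PI: "ring_ideal P" using P by (simp add: prime_ideal_def)
  have zero: "q = 0" if "poly_over Rx q" "poly q (yvar i) \<in> P" for q
    using that P(3) by (auto simp: S_def)
  have zero': "a = 0" if "a \<in> Rx" "a \<in> P" for a
    using zero[of "[:a:]"] that poly_over_closed(7)[OF Rx(1)] by simp
  \<comment> \<open>For the remaining variables only the existence of an extension matters, so 1
    serves as the element to be kept nonzero.\<close>
  have "1 \<in> R2" "1 \<notin> P" using subring_closed(1)[OF R2(1)] P(1) by (auto simp: prime_ideal_def)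
  then obtain h where h: "h \<in> R1" "h \<notin> P"
    and ext: "\<And>\<phi>::_ \<Rightarrow> 'k. ring_hom_on P R1 \<phi> \<Longrightarrow> \<phi> h \<noteq> 0 \<Longrightarrow>
      \<exists>\<psi>. ring_hom_on P R2 \<psi> \<and> (\<forall>a\<in>R1. \<psi> a = \<phi> a)"
    using extension_chain[OF P(1) R1(1), of 1 "map yvar ms", where 'k='k] unfolding R2_def by blast
  obtain q where q: "h = poly q (yvar i)" "poly_over Rx q" using h by (auto simp: R1_def adj_def)
  have "q \<noteq> 0" using h q ideal_closed(1)[OF PI] by auto
  define a0 where "a0 = lead_coeff q"
  have a0: "a0 \<in> Rx" "a0 \<noteq> 0" using q \<open>q \<noteq> 0\<close> by (auto simp: a0_def poly_over_def)
  have GR: "G \<in> Rx" by (rule nonneg_mem_subring[OF Rx(1-3)]) (use Gk in auto)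
  \<comment> \<open>\<open>G\<close> keeps the base point in the open set with finite fibres, and
    \<open>a0\<close> keeps the image of \<open>q\<close> from vanishing identically.\<close>
  have "G * a0 \<noteq> 0" using nz[OF GR a0(1) G0 a0(2)] .
  then have "G * a0 \<in> adjs ?K (map xvar ns)" "G * a0 \<notin> P"
    using zero' subring_closed(5)[OF Rx(1) GR a0(1)] unfolding Rx_def by blast+
  then obtain k where k: "k \<in> ?K" "k \<notin> P" and ext0: "\<And>\<phi>::_ \<Rightarrow> 'k. ring_hom_on P ?K \<phi> \<Longrightarrow> \<phi> k \<noteq> 0 \<Longrightarrow>
      \<exists>\<psi>. ring_hom_on P Rx \<psi> \<and> \<psi> (G * a0) \<noteq> 0 \<and> (\<forall>a\<in>?K. \<psi> a = \<phi> a)"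
    using extension_chain[OF P(1) K, of "G * a0" "map xvar ns", where 'k='k] unfolding Rx_def by blast
  define \<phi>0 where "\<phi>0 F = lookup F 0" for F :: "('n, 'm, 'k) lpm"
  have \<phi>0: "\<phi>0 (cst c) = c" for c by (simp add: \<phi>0_def cst_def)
  have "ring_hom_on P ?K \<phi>0"
    unfolding ring_hom_on_def
  proof (intro conjI ballI)
    show "\<phi>0 1 = 1" by (simp add: \<phi>0_def lookup_one)
    fix a b assume "a \<in> ?K" "b \<in> ?K"
    then obtain c d where "a = cst c" "b = cst d" by blast
    then show "\<phi>0 (a + b) = \<phi>0 a + \<phi>0 b" "\<phi>0 (a * b) = \<phi>0 a * \<phi>0 b"
      by (simp_all add: cst_def \<phi>0_def mult_single lookup_add)
  next
    fix a assume "a \<in> ?K \<inter> P"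
    then have "a = 0" using zero' Rx(2) by blast
    then show "\<phi>0 a = 0" by (simp add: \<phi>0_def)
  qed
  moreover have "\<phi>0 k \<noteq> 0" using k \<phi>0 ideal_closed(1)[OF PI] by (auto simp: cst_def)
  ultimately obtain \<phi> where \<phi>: "ring_hom_on P Rx \<phi>" "\<phi> (G * a0) \<noteq> 0" "\<And>c. \<phi> (cst c) = c"
    using ext0 \<phi>0 by (metis rangeI)
  have \<phi>G: "\<phi> G \<noteq> 0" "\<phi> a0 \<noteq> 0" using \<phi>(2) hom_basic(4)[OF \<phi>(1) Rx(1) GR a0(1)] by auto
  define p where "p = map_poly \<phi> q"
  have "coeff p (degree q) \<noteq> 0" using \<phi>G(2) hom_poly(1)[OF \<phi>(1) Rx(1)] by (simp add: p_def a0_def)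
  then have p0: "p \<noteq> 0" by auto
  define a where "a j = \<phi> (xvar j)" for j
  \<comment> \<open>The homomorphism on K[x], hence the base point, stays fixed; every value b of
    y_i off the roots of \<open>p\<close> extends to a point of the zero set.\<close>
  have point: "\<exists>v. (a, v) \<in> zero_set (poly_part I) \<and> v i = b \<and> pt_eval g a v \<noteq> 0" if b: "poly p b \<noteq> 0" for b
  proof -
    have ann: "poly (map_poly \<phi> r) b = 0" if "poly_over Rx r" "poly r (yvar i) \<in> P" for r
      using zero[OF that] by simp
    obtain \<chi> where \<chi>: "ring_hom_on P R1 \<chi>" "\<And>r. poly_over Rx r \<Longrightarrow> \<chi> (poly r (yvar i)) = poly (map_poly \<phi> r) b"
        "\<And>c. c \<in> Rx \<Longrightarrow> \<chi> c = \<phi> c"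
      using hom_extend[OF \<phi>(1) Rx(1) ann PI] unfolding R1_def by blast
    have "\<chi> h \<noteq> 0" using \<chi>(2) q b by (simp add: p_def)
    then obtain \<psi> where \<psi>: "ring_hom_on P R2 \<psi>" "\<And>c. c \<in> R1 \<Longrightarrow> \<psi> c = \<chi> c"
      using ext \<chi>(1) by blast
    have \<psi>x: "\<psi> c = \<phi> c" if "c \<in> Rx" for c using \<psi>(2) \<chi>(3) R1(2) that by auto
    have inR2: "?K \<subseteq> R2" "range xvar \<subseteq> R2" using Rx R1 R2 by blast+
    have \<psi>c: "\<psi> (cst c) = c" for c
    proof -
      have "cst c \<in> Rx" using Rx(2) by blast
      then show ?thesis using \<psi>x \<phi>(3) by simp
    qed
    have "xvar j \<in> Rx" for j using Rx(3) by blast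
    then have xa: "(\<lambda>j. \<psi> (xvar j)) = a" using \<psi>x by (auto simp: a_def)
    define v where "v = (\<lambda>i. \<psi> (yvar i))"
    have ev: "\<psi> F = pt_eval (lookup F) a v" if "\<And>e j. e \<in> keys F \<Longrightarrow> fst e j \<ge> 0" for F
      using hom_pt_eval[OF \<psi>(1) R2(1) inR2 R2(3) \<psi>c that] unfolding xa v_def by simp
    have "pt_eval f a v = 0" if f: "f \<in> poly_part I" for f
    proof -
      have "f \<in> I" using f by (simp add: poly_part_def)
      then have "is_lpoly f" using ideal by (auto simp: lp_ideal_def)
      then obtain F :: "('n, 'm, 'k) lpm" where F: "f = lookup F" by (rule lpolyE)
      have Fk: "\<And>e j. e \<in> keys F \<Longrightarrow> fst e j \<ge> 0"
        using f by (auto simp: poly_part_def F lsupp_lookup)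
      have "F \<in> P" using P(2) \<open>f \<in> I\<close> by (auto simp: pm_ideal_def F)
      moreover have "F \<in> R2" by (rule nonneg_mem_subring[OF R2(1) inR2 Fk]) (use R2(3) in auto)
      ultimately have "\<psi> F = 0" using hom_basic(5)[OF \<psi>(1) R2(1)] by blast
      then show ?thesis using ev[OF Fk] F by simp
    qed
    then have "(a, v) \<in> zero_set (poly_part I)" by (simp add: zero_set_def)
    moreover have "v i = b"
    proof -
      have "poly_over Rx [:0, 1:]" using subring_closed[OF Rx(1)]
        by (auto simp: poly_over_def coeff_pCons split: nat.splits)
      then have "\<chi> (yvar i) = poly (map_poly \<phi> [:0, 1:]) b" using \<chi>(2)[of "[:0, 1:]"] by simp
      also have "\<dots> = b" using hom_basic(1,2)[OF \<phi>(1) Rx(1)] by (simp add: map_poly_pCons)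
      finally show ?thesis using \<psi>(2)[OF R1(3)] by (simp add: v_def)
    qed
    moreover have "pt_eval g a v \<noteq> 0" using ev[of G] Gk \<psi>x[OF GR] \<phi>G G by auto
    ultimately show ?thesis by blast
  qed
  have fp: "finite {b. poly p b = 0}" using p0 by (rule poly_roots_finite)
  have inf: "infinite {b. poly p b \<noteq> 0}"
  proof
    assume "finite {b. poly p b \<noteq> 0}"
    then have "finite ({b. poly p b = 0} \<union> {b. poly p b \<noteq> 0})" using fp by blast
    moreover have "{b. poly p b = 0} \<union> {b. poly p b \<noteq> 0} = UNIV" by auto
    ultimately show False using infinite_UNIV_char_0[where 'a='k] by simp
  qed
  then obtain b0 where "poly p b0 \<noteq> 0" by (metis (mono_tags, lifting) finite.emptyI empty_Collect_eq)
  then obtain v0 where "pt_eval g a v0 \<noteq> 0" using point by blast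
  moreover have "pt_eval g a v0 = pt_eval g a (\<lambda>_. 0)"
    unfolding pt_eval_def G lsupp_lookup using Gk by (intro sum.cong refl) auto
  ultimately have "finite {v. (a, v) \<in> zero_set (poly_part I)}" using fin by simp
  then have "finite ((\<lambda>v. v i) ` {v. (a, v) \<in> zero_set (poly_part I)})" by (rule finite_imageI)
  moreover have "{b. poly p b \<noteq> 0} \<subseteq> (\<lambda>v. v i) ` {v. (a, v) \<in> zero_set (poly_part I)}"
    using point by blast
  ultimately show False using inf finite_subset by blast
qed

section \<open>Lifting initial solutions\<close>

lemma lookup_times_sum:
  "lookup (F * G) b = (\<Sum>x\<in>keys F. \<Sum>y\<in>keys G. if x + y = b then lookup F x * lookup G y else 0)"
  for F G :: "'e::comm_monoid_add \<Rightarrow>\<^sub>0 'a::comm_ring_1"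
  by (simp add: times_monomials lookup_sum lookup_single when_def)

definition Const :: "'a::zero \<Rightarrow> ('m \<Rightarrow> nat) \<Rightarrow>\<^sub>0 'a" where
  "Const l = single 0 l"

lemma lookup_Const_mult [simp]: "lookup (Const l * F) b = l * lookup F b"
  for F :: "('m \<Rightarrow> nat) \<Rightarrow>\<^sub>0 'a::comm_ring_1"
proof -
  have "Const l * F = (\<Sum>y\<in>keys F. single y (l * lookup F y))"
    unfolding Const_def
    by (subst (1) sum_monomials[of F, symmetric]) (simp only: sum_distrib_left mult_single add_0_left)
  then show ?thesis
    by (simp add: lookup_sum lookup_single when_def in_keys_iff sum.delta')
qed

lemma Const_simps:
  "Const 0 = 0" "Const 1 = 1" "Const (a + b) = Const a + Const b" "Const (a * b) = Const a * Const b"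
  "Const (- a) = - Const a" "Const (a - b) = Const a - Const b" for a b :: "'a::comm_ring_1"
  by (simp_all add: Const_def single_add mult_single single_uminus single_diff)

lemma Const_sum: "Const (sum f A) = (\<Sum>x\<in>A. Const (f x :: 'a::comm_ring_1))"
  by (induction A rule: infinite_finite_induct) (auto simp: Const_simps)

lemma Const_prod: "Const (prod f A) = (\<Prod>x\<in>A. Const (f x :: 'a::comm_ring_1))"
  by (induction A rule: infinite_finite_induct) (auto simp: Const_simps)

lemma Const_power: "Const (a ^ n) = (Const a :: ('m \<Rightarrow> nat) \<Rightarrow>\<^sub>0 'a::comm_ring_1) ^ n"
  by (induction n) (auto simp: Const_simps)

definition yv :: "'m \<Rightarrow> ('m \<Rightarrow> nat) \<Rightarrow>\<^sub>0 'a::comm_ring_1" where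
  "yv i = single (\<lambda>i'. if i' = i then 1 else 0) 1"

definition yev :: "('m::finite \<Rightarrow> 'a::comm_ring_1) \<Rightarrow> (('m \<Rightarrow> nat) \<Rightarrow>\<^sub>0 'a) \<Rightarrow> 'a" where
  "yev \<phi> = pm_eval (\<lambda>x. x) (\<lambda>b. \<Prod>i\<in>UNIV. \<phi> i ^ b i)"

lemma yev_hom: "coeff_hom (\<lambda>x::'a::comm_ring_1. x)"
  "expo_hom (\<lambda>b. \<Prod>i\<in>UNIV. (\<phi> :: 'm::finite \<Rightarrow> 'a::comm_ring_1) i ^ b i)"
  by (simp_all add: coeff_hom_def expo_hom_def power_add prod.distrib)

lemmas yev_add = pm_eval_add[OF yev_hom, folded yev_def]
  and yev_mult = pm_eval_mult[OF yev_hom, folded yev_def]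
  and yev_minus = pm_eval_minus[OF yev_hom, folded yev_def]
  and yev_single = pm_eval_single[OF yev_hom, folded yev_def]

lemma yev_Const: "yev \<phi> (Const l) = l"
  by (simp add: Const_def yev_single)

lemma yev_yv: "yev \<phi> (yv i) = \<phi> i"
proof -
  have "(\<Prod>x\<in>UNIV. \<phi> x ^ (if x = i then 1 else 0)) = (\<Prod>x\<in>UNIV. if x = i then \<phi> x else 1)"
    by (intro prod.cong) auto
  then show ?thesis by (simp add: yv_def yev_single)
qed

lemma single_as_product:
  fixes b :: "'m::finite \<Rightarrow> nat"
  shows "single b l = Const l * (\<Prod>i\<in>UNIV. yv i ^ b i :: ('m \<Rightarrow> nat) \<Rightarrow>\<^sub>0 'a::comm_ring_1)"
proof -
  have *: "(\<Sum>k<n. e) = (\<lambda>i. n * e i)" for e :: "'m \<Rightarrow> nat" and n :: nat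
    by (induction n) (auto simp: fun_eq_iff)
  have "(\<Prod>i\<in>UNIV. yv i ^ b i :: ('m \<Rightarrow> nat) \<Rightarrow>\<^sub>0 'a) = single b 1"
    unfolding yv_def single_1_power single_1_prod *
    by (intro arg_cong[of _ _ "\<lambda>e. single e 1"])
      (auto simp: fun_eq_iff sum_fun_apply if_distrib sum.delta cong: if_cong)
  then show ?thesis by (simp add: Const_def mult_single)
qed

text \<open>Congruences modulo an ideal pass through sums, products and powers, so each variable may
  be replaced by a series congruent to it.\<close>

lemma congruence_eval:
  fixes F :: "('m::finite \<Rightarrow> nat) \<Rightarrow>\<^sub>0 'a::comm_ring_1"
  assumes Q: "ring_ideal Q" and r: "\<And>i. yv i - Const (r i) \<in> Q"
  shows "F - Const (yev r F) \<in> Q"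
proof -
  have mult: "a * b - a' * b' \<in> Q" if "a - a' \<in> Q" "b - b' \<in> Q" for a b a' b'
  proof -
    have "(a - a') * b + a' * (b - b') \<in> Q" using that ideal_closed[OF Q] by blast
    then show ?thesis by (simp add: algebra_simps)
  qed
  have pow: "a ^ n - a' ^ n \<in> Q" if "a - a' \<in> Q" for a a' n
    by (induction n) (auto intro!: mult that simp: ideal_closed(1)[OF Q])
  have prd: "prod f A - prod g A \<in> Q" if "\<And>x. f x - g x \<in> Q" for f g and A :: "'m set"
    by (induction A rule: infinite_finite_induct) (auto intro!: mult that simp: ideal_closed(1)[OF Q])
  have "Const l * (\<Prod>i\<in>UNIV. yv i ^ b i) - Const l * (\<Prod>i\<in>UNIV. Const (r i) ^ b i) \<in> Q" for l and b :: "'m \<Rightarrow> nat"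
    by (intro mult prd pow r) (simp add: ideal_closed(1)[OF Q])
  then have "(\<Sum>b\<in>keys F. Const (lookup F b) * (\<Prod>i\<in>UNIV. yv i ^ b i)
      - Const (lookup F b) * (\<Prod>i\<in>UNIV. Const (r i) ^ b i)) \<in> Q"
    by (intro ideal_sum[OF Q]) auto
  also have "(\<Sum>b\<in>keys F. Const (lookup F b) * (\<Prod>i\<in>UNIV. yv i ^ b i)
      - Const (lookup F b) * (\<Prod>i\<in>UNIV. Const (r i) ^ b i))
    = (\<Sum>b\<in>keys F. single b (lookup F b)) - Const (yev r F)"
    by (simp add: sum_subtractf single_as_product yev_def pm_eval_def Const_sum Const_simps Const_prod Const_power)
  finally show ?thesis by (simp only: sum_monomials)
qed

definition xscale :: "('n::finite \<Rightarrow> real) \<Rightarrow> ('n \<Rightarrow> int) \<Rightarrow> real" where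
  "xscale \<omega> a = weight \<omega> (rat_expo a)"

definition hat :: "('n::finite \<Rightarrow> real) \<Rightarrow> ('n, 'm, 'k::comm_ring_1) lpm \<Rightarrow> ('m \<Rightarrow> nat) \<Rightarrow>\<^sub>0 'k lfs" where
  "hat \<omega> = pm_eval (\<lambda>c. Const (sconst c 0)) (\<lambda>e. single (snd e) (sconst 1 (xscale \<omega> (fst e))))"

lemma hat_hom:
  "coeff_hom (\<lambda>c::'k::comm_ring_1. Const (sconst c 0))"
  "expo_hom (\<lambda>e::('n::finite \<Rightarrow> int) \<times> ('m \<Rightarrow> nat). single (snd e) (sconst (1::'k::comm_ring_1) (xscale \<omega> (fst e))))"
  by (simp_all add: coeff_hom_def expo_hom_def Const_def sconst_1 sconst_add sconst_mult single_add
      mult_single xscale_def rat_expo_add weight_add rat_expo_0)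

lemmas hat_add = pm_eval_add[OF hat_hom, folded hat_def]
  and hat_0 = pm_eval_0[OF hat_hom, folded hat_def]
  and hat_sum = pm_eval_sum[OF hat_hom, folded hat_def]
  and hat_mult = pm_eval_mult[OF hat_hom, folded hat_def]
  and hat_minus = pm_eval_minus[OF hat_hom, folded hat_def]
  and hat_poly = pm_eval_poly[OF hat_hom, folded hat_def]

lemma hat_single: "hat \<omega> (single e c) = single (snd e) (sconst c (xscale \<omega> (fst e)))"
  unfolding hat_def pm_eval_single[OF hat_hom] by (simp add: Const_def mult_single sconst_mult)

lemma hat_yvar: "hat \<omega> (yvar i) = yv i"
  by (simp add: yvar_def hat_single yv_def xscale_def rat_expo_0 sconst_1)

lemma hat_as_sum: "hat \<omega> F = (\<Sum>e\<in>keys F. single (snd e) (sconst (lookup F e) (xscale \<omega> (fst e))))"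
proof -
  have "hat \<omega> F = hat \<omega> (\<Sum>e\<in>keys F. single e (lookup F e))" by (simp only: sum_monomials)
  then show ?thesis by (simp only: hat_sum hat_single)
qed

lemma lookup_hat:
  "lookup (hat \<omega> F) b = (\<Sum>e\<in>keys F. if snd e = b then sconst (lookup F e) (xscale \<omega> (fst e)) else 0)"
  by (simp add: hat_as_sum lookup_sum lookup_single when_def)

lemma hat_xpolys: "F \<in> xpolys \<Longrightarrow> hat \<omega> F = Const (xeval \<omega> F)"
  unfolding hat_as_sum xeval_def pm_eval_def Const_sum
  by (intro sum.cong refl) (auto simp: xpolys_def Const_def sconst_mult xscale_def)

text \<open>The coefficient of y^b kept as a Laurent polynomial in \<open>x\<close>, so that row
  operations with it do not leave the original ring and ideal.\<close>

definition ycoeff :: "('n, 'm, 'k::comm_ring_1) lpm \<Rightarrow> ('m \<Rightarrow> nat) \<Rightarrow> ('n, 'm, 'k) lpm" where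
  "ycoeff F b = (\<Sum>e\<in>keys F. if snd e = b then single (fst e, 0) (lookup F e) else 0)"

lemma hat_ycoeff: "hat \<omega> (ycoeff F b) = Const (lookup (hat \<omega> F) b)"
  unfolding ycoeff_def lookup_hat hat_sum Const_sum
  by (intro sum.cong refl) (auto simp: hat_single hat_0 Const_def)

section \<open>Good elements at the monomial point\<close>

lemma vge_cancel:
  fixes F G :: "'k::idom lfs"
  assumes "vge (x + v) (F * G)" "vge v G" "scoeff G v \<noteq> 0"
  shows "vge x F"
proof (cases "F = 0")
  case False
  then obtain m where m: "vge m F" "scoeff F m \<noteq> 0" by (rule leading_exponentE)
  have "scoeff (F * G) (m + v) \<noteq> 0" using scoeff_times_leading[OF m(1) assms(2)] m assms by simp
  then have "m \<ge> x" using vgeD[OF assms(1), of "m + v"] by force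
  then show ?thesis using m vge_mono by blast
qed simp

text \<open>The monomial point has coordinates \<open>c\<^sub>i t ^ \<eta>\<^sub>i\<close>. Monomials \<open>y ^ b\<close> involving a coordinate
  with \<open>c\<^sub>i = 0\<close> have infinite weight and impose no condition.\<close>
locale monomial_point =
  fixes \<omega> :: "'n::finite \<Rightarrow> real" and c :: "'m::finite \<Rightarrow> 'k::idom" and \<eta> :: "'m \<Rightarrow> real"
begin

definition fin :: "('m \<Rightarrow> nat) \<Rightarrow> bool" where
  "fin b \<longleftrightarrow> (\<forall>i. c i = 0 \<longrightarrow> b i = 0)"

definition wt :: "('m \<Rightarrow> nat) \<Rightarrow> real" where
  "wt b = (\<Sum>i\<in>UNIV. real (b i) * \<eta> i)"

definition ev :: "(('m \<Rightarrow> nat) \<Rightarrow>\<^sub>0 'k lfs) \<Rightarrow> 'k lfs" where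
  "ev = yev (\<lambda>i. sconst (c i) (\<eta> i))"

text \<open>A lower bound for the weighted Gauss order, the minimum over monomials of finite weight
  of the order of the coefficient plus \<open>wt b\<close>.\<close>

definition norm_ge :: "real \<Rightarrow> (('m \<Rightarrow> nat) \<Rightarrow>\<^sub>0 'k lfs) \<Rightarrow> bool" where
  "norm_ge w F \<longleftrightarrow> (\<forall>b. fin b \<longrightarrow> vge (w - wt b) (lookup F b))"

text \<open>The order of the value is never below the weighted order (\<open>norm_ge_ev\<close>). A
  witness w forces both to equal w, so the lowest terms do not cancel at the point.\<close>

definition good :: "(('m \<Rightarrow> nat) \<Rightarrow>\<^sub>0 'k lfs) \<Rightarrow> bool" where
  "good F \<longleftrightarrow> (\<exists>w. norm_ge w F \<and> scoeff (ev F) w \<noteq> 0)"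

lemma wt_add: "wt (a + b) = wt a + wt b"
  by (simp add: wt_def algebra_simps sum.distrib)

lemma prod_sconst: "(\<Prod>i\<in>A. sconst (c i) (\<eta> i) ^ b i) = sconst (\<Prod>i\<in>A. c i ^ b i) (\<Sum>i\<in>A. real (b i) * \<eta> i)"
  by (induction A rule: infinite_finite_induct) (auto simp: sconst_1 sconst_power sconst_mult)

lemma point_power: "(\<Prod>i\<in>UNIV. sconst (c i) (\<eta> i) ^ b i) = sconst (\<Prod>i\<in>UNIV. c i ^ b i) (wt b)"
  by (simp add: prod_sconst wt_def)

lemma coeff_power_nonzero: "(\<Prod>i\<in>UNIV. c i ^ b i) \<noteq> 0 \<longleftrightarrow> fin b"
  by (auto simp: fin_def)

lemma ev_altdef: "ev F = (\<Sum>b\<in>keys F. lookup F b * sconst (\<Prod>i\<in>UNIV. c i ^ b i) (wt b))"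
  by (simp add: ev_def yev_def pm_eval_def point_power)

lemmas ev_add = yev_add[of "\<lambda>i. sconst (c i) (\<eta> i)", folded ev_def]
  and ev_mult = yev_mult[of "\<lambda>i. sconst (c i) (\<eta> i)", folded ev_def]
  and ev_minus = yev_minus[of "\<lambda>i. sconst (c i) (\<eta> i)", folded ev_def]
  and ev_Const = yev_Const[of "\<lambda>i. sconst (c i) (\<eta> i)", folded ev_def]
  and ev_yv = yev_yv[of "\<lambda>i. sconst (c i) (\<eta> i)", folded ev_def]

lemma norm_ge_ev:
  assumes "norm_ge w F" shows "vge w (ev F)"
  unfolding ev_altdef
proof (rule vge_sum)
  fix b
  show "vge w (lookup F b * sconst (\<Prod>i\<in>UNIV. c i ^ b i) (wt b))"
  proof (cases "fin b")
    case True
    then have "vge ((w - wt b) + wt b) (lookup F b * sconst (\<Prod>i\<in>UNIV. c i ^ b i) (wt b))"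
      using assms by (intro vge_times vge_sconst) (auto simp: norm_ge_def)
    then show ?thesis by simp
  next
    case False
    then have "(\<Prod>i\<in>UNIV. c i ^ b i) = 0" using coeff_power_nonzero by blast
    then show ?thesis by (simp only: sconst_0 mult_zero_right vge_0)
  qed
qed

lemma norm_ge_mult:
  assumes "norm_ge v F" "norm_ge w G" shows "norm_ge (v + w) (F * G)"
  unfolding norm_ge_def
proof (intro allI impI)
  fix b assume b: "fin b"
  show "vge (v + w - wt b) (lookup (F * G) b)"
    unfolding lookup_times_sum
  proof (intro vge_sum)
    fix x y
    show "vge (v + w - wt b) (if x + y = b then lookup F x * lookup G y else 0)"
    proof (cases "x + y = b")
      case True
      then have "fin x" "fin y" using b by (auto simp: fin_def)
      then have "vge ((v - wt x) + (w - wt y)) (lookup F x * lookup G y)"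
        using assms by (intro vge_times) (auto simp: norm_ge_def)
      moreover have "(v - wt x) + (w - wt y) = v + w - wt b" using True wt_add[of x y] by simp
      ultimately show ?thesis using True by simp
    qed simp
  qed
qed

lemma norm_ge_diff: "norm_ge w F \<Longrightarrow> norm_ge w G \<Longrightarrow> norm_ge w (F - G)"
  by (simp add: norm_ge_def lookup_minus vge_diff)

lemma norm_ge_Const: "vge w l \<Longrightarrow> norm_ge w (Const l)"
  by (auto simp: norm_ge_def Const_def lookup_single when_def wt_def)

text \<open>Weighted lower bounds add under multiplication, and at the point leading coefficients
  multiply in a domain.\<close>

lemma good_mult:
  assumes "good F" "good G" shows "good (F * G)"
proof -
  obtain v w where vw: "norm_ge v F" "scoeff (ev F) v \<noteq> 0" "norm_ge w G" "scoeff (ev G) w \<noteq> 0"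
    using assms by (auto simp: good_def)
  have "scoeff (ev (F * G)) (v + w) = scoeff (ev F) v * scoeff (ev G) w"
    unfolding ev_mult by (intro scoeff_times_leading norm_ge_ev vw)
  then show ?thesis using vw norm_ge_mult unfolding good_def by (metis mult_eq_0_iff)
qed

lemma good_Const: "l \<noteq> 0 \<Longrightarrow> good (Const l)"
  unfolding good_def using norm_ge_Const ev_Const by (metis leading_exponentE)

text \<open>A combination with series coefficients, given as a list of rows so that elimination can
  proceed by induction on their number.\<close>

definition comb :: "('k lfs \<times> ('n, 'm, 'k) lpm) list \<Rightarrow> ('m \<Rightarrow> nat) \<Rightarrow>\<^sub>0 'k lfs" where
  "comb xs = sum_list (map (\<lambda>(l, F). Const l * hat \<omega> F) xs)"

lemma comb_simps: "comb [] = 0" "comb ((l, F) # xs) = Const l * hat \<omega> F + comb xs"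
    "comb (xs @ ys) = comb xs + comb ys"
  by (simp_all add: comb_def)

text \<open>A row all of whose monomials have infinite weight is invisible both to the value at the
  point and to the weighted order.\<close>

lemma not_good_negligible:
  assumes "\<And>b. fin b \<Longrightarrow> lookup U b = 0" "\<not> good G"
  shows "\<not> good (Const l * U + G)"
proof
  assume "good (Const l * U + G)"
  then obtain w where w: "norm_ge w (Const l * U + G)" "scoeff (ev (Const l * U + G)) w \<noteq> 0"
    by (auto simp: good_def)
  have "ev U = 0"
  proof -
    have "lookup U b * sconst (\<Prod>i\<in>UNIV. c i ^ b i) (wt b) = 0" for b
      using assms(1)[of b] coeff_power_nonzero[of b] by (cases "fin b") (auto simp del: prod_zero_iff)
    then show ?thesis unfolding ev_altdef by (intro sum.neutral) blast
  qed
  then have "scoeff (ev G) w \<noteq> 0" using w(2) by (simp add: ev_add ev_mult)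
  moreover have "norm_ge w G" using w(1) assms(1) by (simp add: norm_ge_def lookup_add)
  ultimately show False using assms(2) by (auto simp: good_def)
qed

text \<open>Among the finitely many monomials of finite weight, b0 is one where order plus weight is
  least; that minimum is p.\<close>

lemma pivot:
  assumes "fin b" "lookup U b \<noteq> 0"
  obtains p b0 where "fin b0" "norm_ge p U" "scoeff (lookup U b0) (p - wt b0) \<noteq> 0"
proof -
  define S where "S = {b \<in> keys U. fin b}"
  have S: "finite S" "S \<noteq> {}" using assms by (auto simp: S_def in_keys_iff)
  have "\<forall>b\<in>S. \<exists>m. vge m (lookup U b) \<and> scoeff (lookup U b) m \<noteq> 0"
    using leading_exponentE by (metis (mono_tags, lifting) S_def in_keys_iff mem_Collect_eq)
  then obtain m where m: "\<And>b. b \<in> S \<Longrightarrow> vge (m b) (lookup U b) \<and> scoeff (lookup U b) (m b) \<noteq> 0" by metis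
  define p where "p = Min ((\<lambda>b. m b + wt b) ` S)"
  have "p \<in> (\<lambda>b. m b + wt b) ` S" unfolding p_def using S by (intro Min_in) auto
  then obtain b0 where b0: "b0 \<in> S" "p = m b0 + wt b0" by blast
  have "norm_ge p U"
    unfolding norm_ge_def
  proof (intro allI impI)
    fix b assume b: "fin b"
    show "vge (p - wt b) (lookup U b)"
    proof (cases "b \<in> S")
      case True
      then have "p \<le> m b + wt b" unfolding p_def using S by (intro Min_le) auto
      then show ?thesis using m[OF True] vge_mono[of "m b" "lookup U b" "p - wt b"] by simp
    next
      case False
      then show ?thesis using b by (simp add: S_def in_keys_iff)
    qed
  qed
  then show ?thesis using that[of b0 p] b0 m[OF b0(1)] by (simp add: S_def)
qed

text \<open>Fraction-free Gaussian elimination with a pivot of least weight: the pivot row is orthogonal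
  to the remaining rows for the weighted valuation, so no cancellation can create a good element.\<close>
lemma not_good_comb:
  assumes A: "ring_ideal A" and bad: "\<And>F. F \<in> A \<Longrightarrow> \<not> good (hat \<omega> F)"
    and xs: "snd ` set xs \<subseteq> A"
  shows "\<not> good (comb xs)"
  using xs
proof (induction "length xs" arbitrary: xs)
  case 0
  then show ?case by (auto simp: comb_simps good_def ev_altdef)
next
  case (Suc n)
  then obtain l1 F1 rest where xs: "xs = (l1, F1) # rest"
    by (metis length_Suc_conv prod.exhaust)
  have F1: "F1 \<in> A" and rest: "snd ` set rest \<subseteq> A" "n = length rest" using Suc xs by auto
  define U where "U = hat \<omega> F1"
  show ?case
  proof (cases "\<forall>b. fin b \<longrightarrow> lookup U b = 0")
    case True
    then show ?thesis
      using not_good_negligible[of U "comb rest" l1] Suc.hyps(1)[OF rest(2,1)]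
      unfolding xs comb_simps U_def by blast
  next
    case False
    then obtain p b0 where p: "fin b0" "norm_ge p U" "scoeff (lookup U b0) (p - wt b0) \<noteq> 0"
      using pivot by blast
    define a where "a = lookup U b0"
    define v where "v = p - wt b0"
    have a: "vge v a" "scoeff a v \<noteq> 0" using p by (simp_all add: norm_ge_def a_def v_def)
    \<comment> \<open>Cross-multiplication by the coefficients of y^b0 clears this monomial from
      every other row; both multipliers are Laurent polynomials in \<open>x\<close>, so the rows
      remain in \<open>A\<close>.\<close>
    define red where "red F = ycoeff F1 b0 * F - ycoeff F b0 * F1" for F
    have hred: "hat \<omega> (red F) = Const a * hat \<omega> F - Const (lookup (hat \<omega> F) b0) * U" for F
      by (simp add: red_def hat_minus hat_mult hat_ycoeff a_def U_def)
    define ys where "ys = map (\<lambda>(l, F). (l, red F)) rest"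
    have "red F \<in> A" if "F \<in> A" for F
      unfolding red_def by (intro ideal_closed(6)[OF A] ideal_closed(3)[OF A] that F1)
    then have ys: "snd ` set ys \<subseteq> A" "n = length ys"
      using rest unfolding ys_def by auto
    have ys_b0: "lookup (comb ys) b0 = 0"
    proof -
      have "lookup (comb (map (\<lambda>(l, F). (l, red F)) zs)) b0 = 0" for zs
        by (induction zs) (auto simp: comb_simps lookup_add hred lookup_minus a_def)
      then show ?thesis by (simp add: ys_def)
    qed
    have "\<exists>m. Const a * comb zs = comb (map (\<lambda>(l, F). (l, red F)) zs) + Const m * U" for zs
    proof (induction zs)
      case Nil
      show ?case by (rule exI[of _ 0]) (simp add: comb_simps Const_simps)
    next
      case (Cons z zs)
      obtain l F where z: "z = (l, F)" by fastforce
      obtain m where m: "Const a * comb zs = comb (map (\<lambda>(l, F). (l, red F)) zs) + Const m * U"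
        using Cons.IH by blast
      show ?case
        by (rule exI[of _ "m + l * lookup (hat \<omega> F) b0"])
          (simp add: z comb_simps distrib_left m hred Const_simps algebra_simps)
    qed
    then obtain m0 where m0: "Const a * comb rest = comb ys + Const m0 * U" unfolding ys_def by blast
    define m where "m = a * l1 + m0"
    have E: "Const a * comb xs = comb ys + Const m * U"
      by (simp add: xs comb_simps distrib_left m0 m_def Const_simps U_def algebra_simps)
    show ?thesis
    proof
      assume "good (comb xs)"
      then obtain w where w: "norm_ge w (comb xs)" "scoeff (ev (comb xs)) w \<noteq> 0" by (auto simp: good_def)
      have nE: "norm_ge (v + w) (Const a * comb xs)" by (intro norm_ge_mult norm_ge_Const a w)
      have sE: "scoeff (ev (Const a * comb xs)) (v + w) \<noteq> 0"
        using scoeff_times_leading[OF a(1) norm_ge_ev[OF w(1)]] a w by (simp add: ev_mult ev_Const)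
      \<comment> \<open>The reduced rows have no y^b0 term, so the bound at b0 concerns the
        multiplier of the pivot row alone and cannot be the result of a cancellation.\<close>
      have "lookup (Const a * comb xs) b0 = m * a" unfolding E by (simp add: lookup_add ys_b0 a_def)
      moreover have "vge (v + w - wt b0) (lookup (Const a * comb xs) b0)"
        using nE p(1) unfolding norm_ge_def by blast
      ultimately have "vge (v + w - wt b0) (m * a)" by (simp only:)
      then have "vge ((w - wt b0) + v) (m * a)" by (simp add: algebra_simps)
      then have m: "vge (w - wt b0) m" using a by (rule vge_cancel)
      have eq: "(w - wt b0) + p = v + w" by (simp add: v_def)
      have nm: "norm_ge (v + w) (Const m * U)"
        using norm_ge_mult[OF norm_ge_Const[OF m] p(2)] eq by simp
      \<comment> \<open>The pivot row is not good, so its value has no term of exponent p, and its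
        multiple contributes nothing at v + w. The reduced combination alone would have to be
        good.\<close>
      have "scoeff (ev U) p = 0" using bad[OF F1] p(2) by (auto simp: good_def U_def)
      then have "scoeff (ev (Const m * U)) (v + w) = 0"
        using vge_gt_times[OF m norm_ge_ev[OF p(2)]] eq by (simp add: ev_mult ev_Const)
      then have "scoeff (ev (comb ys)) (v + w) \<noteq> 0" using sE E by (simp add: ev_add)
      moreover have "norm_ge (v + w) (comb ys)" using norm_ge_diff[OF nE nm] E by simp
      ultimately have "good (comb ys)" by (auto simp: good_def)
      then show False using Suc.hyps(1)[OF ys(2,1)] by blast
    qed
  qed
qed

section \<open>The ideal generated over series coefficients\<close>

definition extension_ideal :: "('n, 'm, 'k) lpm set \<Rightarrow> (('m \<Rightarrow> nat) \<Rightarrow>\<^sub>0 'k lfs) set" where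
  "extension_ideal A = {comb xs | xs. snd ` set xs \<subseteq> A}"

lemma extension_ideal_properties:
  assumes A: "ring_ideal A"
  shows "ring_ideal (extension_ideal A)" "F \<in> A \<Longrightarrow> hat \<omega> F \<in> extension_ideal A"
proof -
  have zero: "0 \<in> extension_ideal A"
    unfolding extension_ideal_def by (intro CollectI exI[of _ "[]"]) (simp add: comb_simps)
  have add: "G + H \<in> extension_ideal A" if GH: "G \<in> extension_ideal A" "H \<in> extension_ideal A" for G H
  proof -
    obtain xs ys where "G = comb xs" "H = comb ys" "snd ` set xs \<subseteq> A" "snd ` set ys \<subseteq> A"
      using GH by (auto simp: extension_ideal_def)
    then show ?thesis unfolding extension_ideal_def
      by (intro CollectI exI[of _ "xs @ ys"]) (auto simp: comb_simps)
  qed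
  have mono: "single b l * G \<in> extension_ideal A" if G: "G \<in> extension_ideal A" for b l G
  proof -
    obtain xs where xs: "G = comb xs" "snd ` set xs \<subseteq> A" using G by (auto simp: extension_ideal_def)
    define M :: "('n, 'm, 'k) lpm" where "M = single (0, b) 1"
    have s: "single b l = Const l * hat \<omega> M"
      by (simp add: M_def hat_single Const_def mult_single xscale_def rat_expo_0 sconst_1)
    have "single b l * comb zs = comb (map (\<lambda>(l', F). (l * l', M * F)) zs)" for zs
      by (induction zs) (auto simp: comb_simps distrib_left s hat_mult Const_simps mult_ac)
    moreover have "snd ` set (map (\<lambda>(l', F). (l * l', M * F)) xs) \<subseteq> A"
      using xs(2) ideal_closed(3)[OF A] by auto
    ultimately show ?thesis unfolding extension_ideal_def xs(1) by blast
  qed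
  have sums: "(\<And>x. x \<in> S \<Longrightarrow> f x \<in> extension_ideal A) \<Longrightarrow> sum f S \<in> extension_ideal A" for f and S :: "('m \<Rightarrow> nat) set"
    by (induction S rule: infinite_finite_induct) (auto intro: zero add)
  have "H * G \<in> extension_ideal A" if G: "G \<in> extension_ideal A" for G H
  proof -
    have "H * G = (\<Sum>b\<in>keys H. single b (lookup H b) * G)"
      by (subst sum_monomials[of H, symmetric]) (rule sum_distrib_right)
    then show ?thesis using mono[OF G] sums by simp
  qed
  then show "ring_ideal (extension_ideal A)" using zero add by (auto simp: ring_ideal_def)
  show "F \<in> A \<Longrightarrow> hat \<omega> F \<in> extension_ideal A"
    unfolding extension_ideal_def
    by (intro CollectI exI[of _ "[(1, F)]"]) (simp add: comb_simps Const_simps)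
qed

definition leads :: "'m \<Rightarrow> 'k lfs \<Rightarrow> bool" where
  "leads i r \<longleftrightarrow> (if c i = 0 then r = 0 else vge (\<eta> i) r \<and> scoeff r (\<eta> i) = c i)"

text \<open>The value at the point is c_i t^(\<eta> i) - r. A wrong coefficient of t^(\<eta> i)
  shows at w = \<eta> i. A term of r of lower order, or any term at all if c i = 0 and y_i has
  infinite weight, shows at the order of r.\<close>

lemma good_coordinate:
  assumes "\<not> leads i r" shows "good (yv i - Const r)"
proof -
  let ?d = "\<lambda>i'. if i' = i then 1 else (0::nat)"
  have wtd: "wt ?d = \<eta> i"
  proof -
    have "wt ?d = (\<Sum>i'\<in>UNIV. if i' = i then \<eta> i' else 0)" unfolding wt_def by (intro sum.cong) auto
    then show ?thesis by simp
  qed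
  have ny: "norm_ge w (yv i)" if "c i = 0 \<or> w \<le> \<eta> i" for w
  proof (unfold norm_ge_def, intro allI impI)
    fix b assume "fin b"
    show "vge (w - wt b) (lookup (yv i :: ('m \<Rightarrow> nat) \<Rightarrow>\<^sub>0 'k lfs) b)"
    proof (cases "b = ?d")
      case True
      then have "w \<le> \<eta> i" using \<open>fin b\<close> that by (auto simp: fin_def split: if_splits)
      then show ?thesis using True wtd by (simp add: yv_def one_lfs_def vge_sconst)
    next
      case False
      then show ?thesis by (simp add: yv_def lookup_single when_def)
    qed
  qed
  have e: "ev (yv i - Const r) = sconst (c i) (\<eta> i) - r" by (simp add: ev_minus ev_yv ev_Const)
  show ?thesis
  proof (cases "c i \<noteq> 0 \<and> vge (\<eta> i) r")
    case True
    then have "scoeff r (\<eta> i) \<noteq> c i" using assms by (auto simp: leads_def)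
    then show ?thesis unfolding good_def
      using ny[of "\<eta> i"] True e by (intro exI[of _ "\<eta> i"]) (auto intro!: norm_ge_diff norm_ge_Const)
  next
    case False
    then have "r \<noteq> 0" using assms by (auto simp: leads_def)
    then obtain m where m: "vge m r" "scoeff r m \<noteq> 0" by (rule leading_exponentE)
    have le: "c i = 0 \<or> m < \<eta> i" using False m vge_mono by (metis leI)
    then have "norm_ge m (yv i - Const r)" using ny[of m] m by (intro norm_ge_diff norm_ge_Const) auto
    moreover have "scoeff (ev (yv i - Const r)) m \<noteq> 0" using m le by (auto simp: e)
    ultimately show ?thesis by (auto simp: good_def)
  qed
qed

end

section \<open>Products over roots and the lift of a solution\<close>

lemma map_poly_Const_mult: "map_poly Const (p * q) = map_poly Const p * map_poly Const (q :: 'a::comm_ring_1 poly)"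
  by (simp add: poly_eq_iff coeff_map_poly Const_simps coeff_mult Const_sum)

lemma (in divisible_group) polyT_synthetic_div:
  "polyT p \<Longrightarrow> r \<in> T \<Longrightarrow> polyT (synthetic_div p r) \<and> poly p r \<in> T"
  by (induction p) (auto simp: polyT_0 T_0 polyT_pCons intro: T_add T_mult)

locale lifting = monomial_point \<omega> c \<eta> + divisible_group D
  for \<omega> :: "'n::finite \<Rightarrow> real" and c :: "'m::finite \<Rightarrow> 'k::{alg_closed_field, field_char_0}"
    and \<eta> :: "'m \<Rightarrow> real" and D :: "real set" +
  assumes D_eq: "D = range (weight \<omega>)" and indep: "rational_indep \<omega>"
begin

text \<open>Each root r in \<open>T\<close> contributes a good element of Q + (z - r). Multiplying
  them over the linear factors of p gives a good element of Q + (p(z)), the remaining nonzero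
  constant factor being good itself.\<close>

lemma good_root:
  fixes p :: "'k lfs poly"
  assumes "p \<noteq> 0" "polyT p" and Q: "ring_ideal Q"
    and roots: "\<And>r. r \<in> T \<Longrightarrow> \<exists>x\<in>Q. \<exists>y. good (x + y * (z - Const r))"
  shows "\<exists>x\<in>Q. \<exists>y. good (x + y * poly (map_poly Const p) z)"
  using assms(1,2)
proof (induction "degree p" arbitrary: p)
  case 0
  then obtain a where a: "p = [:a:]" using degree_eq_zeroE by metis
  then have "good (Const a)" using 0 good_Const by simp
  then have "good (0 + 1 * poly (map_poly Const p) z)" by (simp add: a map_poly_pCons Const_simps)
  then show ?case using ideal_closed(1)[OF Q] by blast
next
  case (Suc n)
  obtain r where r: "r \<in> T" "poly p r = 0" using T_root[OF Suc.prems(2)] Suc.hyps(2) by auto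
  define p' where "p' = synthetic_div p r"
  have pp: "p = [:-r, 1:] * p'" using synthetic_div_correct'[of r p] r by (simp add: p'_def)
  have "n = degree p'" using degree_synthetic_div[of p r] Suc.hyps(2) by (simp add: p'_def)
  moreover have "p' \<noteq> 0" using Suc.prems(1) pp by (metis mult_zero_right)
  moreover have "polyT p'" using polyT_synthetic_div[OF Suc.prems(2) r(1)] by (simp add: p'_def)
  ultimately obtain x' y' where x': "x' \<in> Q" "good (x' + y' * poly (map_poly Const p') z)"
    using Suc.hyps(1) by blast
  obtain x y where x: "x \<in> Q" "good (x + y * (z - Const r))" using roots[OF r(1)] by blast
  let ?P = "poly (map_poly Const p') z"
  have P: "poly (map_poly Const p) z = (z - Const r) * ?P"
    unfolding pp map_poly_Const_mult poly_mult by (simp add: map_poly_pCons Const_simps)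
  have "good ((x + y * (z - Const r)) * (x' + y' * ?P))" using good_mult x x' by blast
  also have "(x + y * (z - Const r)) * (x' + y' * ?P)
      = (x * (x' + y' * ?P) + (y * (z - Const r)) * x') + (y * y') * poly (map_poly Const p) z"
    unfolding P by (simp add: algebra_simps)
  finally have "good (x * (x' + y' * ?P) + y * (z - Const r) * x' + y * y' * poly (map_poly Const p) z)" .
  moreover have "x * (x' + y' * ?P) + y * (z - Const r) * x' \<in> Q"
    by (intro ideal_closed(2)[OF Q] ideal_closed(3,4)[OF Q] x(1) x'(1))
  ultimately show ?case by blast
qed

lemma xeval_T: "xeval \<omega> F \<in> T"
proof -
  have "weight \<omega> a \<in> D" for a by (simp add: D_eq)
  then show ?thesis
    unfolding xeval_def pm_eval_def by (intro T_sum T_mult T_sconst D_zero)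
qed

text \<open>Adjoining the relations \<open>y\<^sub>i = r\<^sub>i\<close> one coordinate at a time, a good element exists in each
  resulting ideal, hence in the extended ideal itself.\<close>
lemma lift_solution:
  assumes A: "ring_ideal A" and bad: "\<And>F. F \<in> A \<Longrightarrow> \<not> good (hat \<omega> F)"
    and rel: "\<And>i. \<exists>q. q \<noteq> 0 \<and> poly_over xpolys q \<and> poly q (yvar i) \<in> A"
  shows "\<exists>r. (\<forall>i. r i \<in> T \<and> leads i (r i)) \<and> (\<forall>F\<in>A. yev r (hat \<omega> F) = 0)"
proof (rule ccontr)
  assume contra: "\<not> ?thesis"
  let ?L = "extension_ideal A"
  \<comment> \<open>\<open>S\<close> holds the coordinates for which no relation between the
    variable and a series has been adjoined yet.\<close>
  have claim: "\<exists>G\<in>Q. good G"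
    if "ring_ideal Q" "?L \<subseteq> Q" "\<And>i. i \<notin> S \<Longrightarrow> \<exists>r\<in>T. yv i - Const r \<in> Q" for S Q
    using finite[of S] that
  proof (induction S arbitrary: Q)
    case empty
    \<comment> \<open>All coordinates are fixed to a grid point. Either some element of
      \<open>A\<close> has a nonzero value there, which is then a good constant in \<open>Q\<close>,
      or the point is a common zero, and some coordinate with the wrong first term gives a good
      relation.\<close>
    then obtain r where r: "\<And>i. r i \<in> T" "\<And>i. yv i - Const (r i) \<in> Q" by (metis empty_iff)
    show ?case
    proof (cases "\<exists>F\<in>A. yev r (hat \<omega> F) \<noteq> 0")
      case True
      then obtain F where F: "F \<in> A" "yev r (hat \<omega> F) \<noteq> 0" by blast
      have h: "hat \<omega> F \<in> Q" using extension_ideal_properties(2)[OF A F(1)] empty.prems by blast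
      have "hat \<omega> F - Const (yev r (hat \<omega> F)) \<in> Q" using congruence_eval[OF empty.prems(1) r(2)] .
      then have "Const (yev r (hat \<omega> F)) \<in> Q" using ideal_closed(6)[OF empty.prems(1) h] by fastforce
      then show ?thesis using good_Const[OF F(2)] by blast
    next
      case False
      then obtain i where "\<not> leads i (r i)" using contra r(1) by blast
      then show ?thesis using good_coordinate r(2) by blast
    qed
  next
    case (insert i S)
    note Q = insert.prems(1)
    have "\<exists>x\<in>Q. \<exists>y. good (x + y * (yv i - Const r))" if r: "r \<in> T" for r
    proof -
      let ?z = "yv i - Const r"
      define X where "X = {x + y * ?z | x y. x \<in> Q}"
      have X: "ring_ideal X" "Q \<subseteq> X" "?z \<in> X" unfolding X_def by (rule ideal_adjoin[OF Q])+
      have "\<exists>r\<in>T. yv i' - Const r \<in> X" if "i' \<notin> S" for i'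
      proof (cases "i' = i")
        case True
        then show ?thesis using r X(3) by blast
      next
        case False
        then show ?thesis using insert.prems(3)[of i'] that X(2) by blast
      qed
      then have "\<exists>G\<in>X. good G" using insert.prems(2) X(1,2) by (intro insert.IH) auto
      then show ?thesis by (auto simp: X_def)
    qed
    moreover obtain q where q: "q \<noteq> 0" "poly_over xpolys q" "poly q (yvar i) \<in> A" using rel by blast
    define p where "p = map_poly (xeval \<omega>) q"
    have x0: "xeval \<omega> (0 :: ('n, 'm, 'k) lpm) = 0" unfolding xeval_def by (rule pm_eval_0[OF xeval_hom])
    have cp: "coeff p j = xeval \<omega> (coeff q j)" for j by (simp add: p_def coeff_map_poly x0)
    have "xeval \<omega> (lead_coeff q) \<noteq> 0"
      using q by (intro xeval_nonzero[OF indep]) (auto simp: poly_over_def)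
    then have "p \<noteq> 0" using cp by (metis coeff_0)
    moreover have "polyT p" by (simp add: polyT_def cp xeval_T)
    ultimately obtain x y where xy: "x \<in> Q" "good (x + y * poly (map_poly Const p) (yv i))"
      using good_root[OF _ _ Q, of p "yv i"] by blast
    have "map_poly Const p = map_poly (hat \<omega>) q"
      using q(2) by (simp add: poly_eq_iff coeff_map_poly Const_simps hat_0 cp hat_xpolys poly_over_def)
    then have "poly (map_poly Const p) (yv i) = hat \<omega> (poly q (yvar i))"
      by (simp add: hat_poly hat_yvar)
    \<comment> \<open>p(y_i) is the image of an element of \<open>A\<close> and already belongs to
      \<open>Q\<close>, so the good element of Q + (p(y_i)) belongs to \<open>Q\<close> too.\<close>
    then have "poly (map_poly Const p) (yv i) \<in> Q"
      using extension_ideal_properties(2)[OF A q(3)] insert.prems(2) by auto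
    then have "x + y * poly (map_poly Const p) (yv i) \<in> Q"
      using xy(1) ideal_closed[OF Q] by blast
    then show ?case using xy(2) by blast
  qed
  have "\<exists>G\<in>?L. good G"
    by (rule claim[of ?L UNIV]) (use extension_ideal_properties(1)[OF A] in auto)
  then show False using not_good_comb[OF A bad] by (auto simp: extension_ideal_def)
qed

end

section \<open>Puiseux series as series with real exponents\<close>

definition left_finite :: "('n::finite \<Rightarrow> real) \<Rightarrow> (('n \<Rightarrow> rat) \<Rightarrow> 'k::zero) \<Rightarrow> bool" where
  "left_finite \<omega> \<phi> \<longleftrightarrow> (\<forall>c. finite {\<alpha>. \<phi> \<alpha> \<noteq> 0 \<and> weight \<omega> \<alpha> \<le> c})"

text \<open>Replaces x^\<alpha> by t^(\<omega>\<cdot>\<alpha>). The inverse of \<open>weight\<close>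
  is meaningful under independence, and \<open>Abs_lfs\<close> for left-finite arguments.\<close>

definition emb :: "('n::finite \<Rightarrow> real) \<Rightarrow> (('n \<Rightarrow> rat) \<Rightarrow> 'k::zero) \<Rightarrow> 'k lfs" where
  "emb \<omega> \<phi> = Abs_lfs (\<lambda>r. if r \<in> range (weight \<omega>) then \<phi> (inv (weight \<omega>) r) else 0)"

lemma weight_uminus: "weight \<omega> (- \<alpha>) = - weight \<omega> \<alpha>"
  using weight_diff[of \<omega> 0 \<alpha>] by simp

lemma weight_sum: "weight \<omega> (\<Sum>x\<in>A. f x) = (\<Sum>x\<in>A. weight \<omega> (f x))"
proof (induction A rule: infinite_finite_induct)
  case (infinite A)
  show ?case unfolding sum.infinite[OF infinite] by (rule weight_0)
next
  case empty
  show ?case unfolding sum.empty by (rule weight_0)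
next
  case (insert x A)
  show ?case unfolding sum.insert[OF insert.hyps] weight_add insert.IH ..
qed

lemma divisible_group_weight:
  assumes "rational_indep (\<omega> :: 'n::finite \<Rightarrow> real)"
  shows "divisible_group (range (weight \<omega>))"
proof
  show "0 \<in> range (weight \<omega>)" by (rule range_eqI[of _ _ 0]) simp
  fix a b assume "a \<in> range (weight \<omega>)"
  then obtain \<alpha> where a: "a = weight \<omega> \<alpha>" by blast
  show "- a \<in> range (weight \<omega>)" by (rule range_eqI[of _ _ "- \<alpha>"]) (simp add: a weight_uminus)
  show "a / real n \<in> range (weight \<omega>)" for n :: nat
    by (rule range_eqI[of _ _ "\<lambda>j. \<alpha> j / of_nat n"])
       (simp add: a weight_def sum_divide_distrib of_rat_divide)
  assume "b \<in> range (weight \<omega>)"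
  then obtain \<beta> where "b = weight \<omega> \<beta>" by blast
  then show "a + b \<in> range (weight \<omega>)" by (intro range_eqI[of _ _ "\<alpha> + \<beta>"]) (simp add: a weight_add)
next
  define \<delta> :: "'n \<Rightarrow> rat" where "\<delta> = (\<lambda>_. 1)"
  have "\<delta> \<noteq> 0" by (simp add: \<delta>_def fun_eq_iff)
  then have "weight \<omega> \<delta> \<noteq> 0" using assms unfolding rational_indep_def by blast
  then have "weight \<omega> \<delta> > 0 \<or> weight \<omega> (- \<delta>) > 0" by (auto simp: weight_uminus)
  then show "\<exists>d\<in>range (weight \<omega>). d > 0" by blast
qed

lemma scoeff_emb:
  assumes \<omega>: "rational_indep \<omega>" and "left_finite \<omega> \<phi>"
  shows "scoeff (emb \<omega> \<phi>) (weight \<omega> \<alpha>) = \<phi> \<alpha>" "r \<notin> range (weight \<omega>) \<Longrightarrow> scoeff (emb \<omega> \<phi>) r = 0"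
proof -
  have inj: "inj (weight \<omega>)" using weight_inject[OF \<omega>] by (auto simp: inj_def)
  have "scoeff (emb \<omega> \<phi>) = (\<lambda>r. if r \<in> range (weight \<omega>) then \<phi> (inv (weight \<omega>) r) else 0)"
    unfolding emb_def
  proof (rule scoeff_Abs)
    fix c
    have "{r. r \<le> c \<and> (if r \<in> range (weight \<omega>) then \<phi> (inv (weight \<omega>) r) else 0) \<noteq> 0}
        \<subseteq> weight \<omega> ` {\<alpha>. \<phi> \<alpha> \<noteq> 0 \<and> weight \<omega> \<alpha> \<le> c}"
      using inj by (auto split: if_splits)
    then show "finite {r. r \<le> c \<and> (if r \<in> range (weight \<omega>) then \<phi> (inv (weight \<omega>) r) else 0) \<noteq> 0}"
      by (rule finite_subset) (use assms(2) in \<open>simp add: left_finite_def\<close>)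
  qed
  then show "scoeff (emb \<omega> \<phi>) (weight \<omega> \<alpha>) = \<phi> \<alpha>" "r \<notin> range (weight \<omega>) \<Longrightarrow> scoeff (emb \<omega> \<phi>) r = 0"
    using inj by auto
qed

lemma left_finite_scoeff:
  assumes "rational_indep \<omega>"
  shows "left_finite \<omega> (\<lambda>\<alpha>. scoeff r (weight \<omega> \<alpha>))"
  unfolding left_finite_def
proof
  fix c
  have "{\<alpha>. scoeff r (weight \<omega> \<alpha>) \<noteq> 0 \<and> weight \<omega> \<alpha> \<le> c} = weight \<omega> -` {s. s \<le> c \<and> scoeff r s \<noteq> 0}"
    by auto
  moreover have "inj (weight \<omega>)" using weight_inject[OF assms] by (auto simp: inj_def)
  ultimately show "finite {\<alpha>. scoeff r (weight \<omega> \<alpha>) \<noteq> 0 \<and> weight \<omega> \<alpha> \<le> c}"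
    using finite_vimageI[OF finite_scoeff] by simp
qed

lemma emb_scoeff:
  assumes "rational_indep \<omega>" "\<And>s. scoeff r s \<noteq> 0 \<Longrightarrow> s \<in> range (weight \<omega>)"
  shows "emb \<omega> (\<lambda>\<alpha>. scoeff r (weight \<omega> \<alpha>)) = r"
proof (rule lfs_eqI)
  fix s
  show "scoeff (emb \<omega> (\<lambda>\<alpha>. scoeff r (weight \<omega> \<alpha>))) s = scoeff r s"
    using scoeff_emb[OF assms(1) left_finite_scoeff[OF assms(1), of r]] assms(2)[of s]
    by (cases "s \<in> range (weight \<omega>)") auto
qed

text \<open>A point of the cone of bounded weight has bounded cone coefficients, since no nonzero rational
  generator has weight \<open>0\<close>.\<close>
lemma left_finite_ps_valid:
  fixes \<phi> :: "('n::finite \<Rightarrow> rat) \<Rightarrow> 'k::zero"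
  assumes \<omega>: "rational_indep \<omega>" and "ps_valid \<omega> \<phi>"
  shows "left_finite \<omega> \<phi>"
  unfolding left_finite_def
proof
  fix c
  obtain k :: nat and \<gamma> :: "'n \<Rightarrow> rat" and V where k: "k > 0" "\<And>\<alpha> j. \<alpha> \<in> lsupp \<phi> \<Longrightarrow> of_nat k * \<alpha> j \<in> \<int>"
    and V: "finite V" "\<And>s. s \<in> rcone V \<Longrightarrow> (\<Sum>j\<in>UNIV. s j * \<omega> j) \<ge> 0"
    and cone: "\<And>\<alpha>. \<alpha> \<in> lsupp \<phi> \<Longrightarrow> (\<lambda>j. real_of_rat (\<alpha> j + \<gamma> j)) \<in> rcone V"
    using assms(2) unfolding ps_valid_def by blast
  have wV: "weight \<omega> v > 0 \<or> v = 0" if v: "v \<in> V" for v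
  proof -
    have "(\<lambda>j. real_of_rat (v j)) \<in> rcone V"
      unfolding rcone_def
    proof (intro CollectI exI conjI)
      show "\<forall>u\<in>V. (if u = v then 1 else 0 :: real) \<ge> 0" by simp
      show "(\<lambda>j. real_of_rat (v j)) = (\<lambda>j. \<Sum>u\<in>V. (if u = v then 1 else 0) * real_of_rat (u j))"
        using V(1) v by (simp add: if_distrib[of "\<lambda>x. x * _"] cong: if_cong)
    qed
    then have "(\<Sum>j\<in>UNIV. real_of_rat (v j) * \<omega> j) \<ge> 0" using V(2) by blast
    then have "weight \<omega> v \<ge> 0" by (simp add: weight_def mult.commute)
    then show ?thesis using \<omega> unfolding rational_indep_def by (metis less_eq_real_def)
  qed
  \<comment> \<open>\<open>C\<close> bounds the weight of \<alpha> + \<gamma>, \<open>B j\<close>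
    the size of \<alpha> j, and \<open>N\<close> the numerators over the denominator k. A zero
    generator causes a division by zero in \<open>B\<close>, but there the other factor is
    0.\<close>
  define C where "C = c + weight \<omega> \<gamma>"
  define B where "B j = (\<Sum>v\<in>V. (C / weight \<omega> v) * \<bar>real_of_rat (v j)\<bar>) + \<bar>real_of_rat (\<gamma> j)\<bar>" for j
  define N where "N = Max (range (\<lambda>j. \<lceil>real k * B j\<rceil>))"
  define Z where "Z = (PiE UNIV (\<lambda>_. {- N..N}) :: ('n \<Rightarrow> int) set)"
  have "finite Z" unfolding Z_def by (intro finite_PiE) auto
  have "{\<alpha>. \<phi> \<alpha> \<noteq> 0 \<and> weight \<omega> \<alpha> \<le> c} \<subseteq> (\<lambda>z j. of_int (z j) / of_nat k) ` Z"
  proof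
    fix \<alpha> assume "\<alpha> \<in> {\<alpha>. \<phi> \<alpha> \<noteq> 0 \<and> weight \<omega> \<alpha> \<le> c}"
    then have \<alpha>: "\<alpha> \<in> lsupp \<phi>" "weight \<omega> \<alpha> \<le> c" by (auto simp: lsupp_def)
    obtain d where d: "\<And>v. v \<in> V \<Longrightarrow> d v \<ge> 0"
        and eq: "(\<lambda>j. real_of_rat (\<alpha> j + \<gamma> j)) = (\<lambda>j. \<Sum>v\<in>V. d v * real_of_rat (v j))"
      using cone[OF \<alpha>(1)] unfolding rcone_def by blast
    have eqj: "real_of_rat (\<alpha> j + \<gamma> j) = (\<Sum>v\<in>V. d v * real_of_rat (v j))" for j
      using fun_cong[OF eq, of j] .
    have "weight \<omega> (\<alpha> + \<gamma>) = (\<Sum>j\<in>UNIV. \<omega> j * (\<Sum>v\<in>V. d v * real_of_rat (v j)))"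
      by (simp add: weight_def eqj)
    also have "\<dots> = (\<Sum>j\<in>UNIV. \<Sum>v\<in>V. d v * (\<omega> j * real_of_rat (v j)))"
      by (simp add: sum_distrib_left mult_ac)
    also have "\<dots> = (\<Sum>v\<in>V. d v * weight \<omega> v)"
      by (subst sum.swap) (simp add: weight_def sum_distrib_left)
    finally have sumw: "(\<Sum>v\<in>V. d v * weight \<omega> v) \<le> C" using \<alpha>(2) by (simp add: weight_add C_def)
    have dv: "d v * \<bar>real_of_rat (v j)\<bar> \<le> (C / weight \<omega> v) * \<bar>real_of_rat (v j)\<bar>" if v: "v \<in> V" for v j
    proof (cases "v = 0")
      case False
      then have pos: "weight \<omega> v > 0" using wV v by blast
      have "0 \<le> d u * weight \<omega> u" if "u \<in> V" for u
        using d[OF that] wV[OF that] by auto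
      then have "d v * weight \<omega> v \<le> (\<Sum>u\<in>V. d u * weight \<omega> u)"
        using V(1) v by (intro member_le_sum) auto
      then have "d v \<le> C / weight \<omega> v" using sumw pos by (simp add: pos_le_divide_eq)
      then show ?thesis by (intro mult_right_mono) auto
    qed simp
    have bound: "\<bar>real_of_rat (\<alpha> j)\<bar> \<le> B j" for j
    proof -
      have "\<bar>real_of_rat (\<alpha> j + \<gamma> j)\<bar> \<le> (\<Sum>v\<in>V. \<bar>d v * real_of_rat (v j)\<bar>)"
        unfolding eqj by (rule sum_abs)
      also have "\<dots> \<le> (\<Sum>v\<in>V. (C / weight \<omega> v) * \<bar>real_of_rat (v j)\<bar>)"
        using dv d by (intro sum_mono) (simp add: abs_mult)
      finally show ?thesis unfolding B_def of_rat_add by linarith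
    qed
    have "\<forall>j. \<exists>z. of_nat k * \<alpha> j = of_int z" using k(2)[OF \<alpha>(1)] by (metis Ints_cases)
    then obtain z where z: "\<And>j. of_nat k * \<alpha> j = of_int (z j)" by metis
    have "z j \<in> {- N..N}" for j
    proof -
      have "real_of_int (z j) = real k * real_of_rat (\<alpha> j)"
        using arg_cong[OF z[of j], of real_of_rat] by (simp add: of_rat_mult)
      then have "\<bar>real_of_int (z j)\<bar> \<le> real k * B j"
        using bound[of j] by (simp add: abs_mult mult_left_mono)
      then have "\<bar>z j\<bar> \<le> \<lceil>real k * B j\<rceil>" by linarith
      also have "\<dots> \<le> N" unfolding N_def by (intro Max_ge) auto
      finally show ?thesis by auto
    qed
    then have "z \<in> Z" by (auto simp: Z_def)
    moreover have "\<alpha> = (\<lambda>j. of_int (z j) / of_nat k)"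
    proof
      fix j show "\<alpha> j = of_int (z j) / of_nat k" using z[of j, symmetric] k(1) by simp
    qed
    ultimately show "\<alpha> \<in> (\<lambda>z j. of_int (z j) / of_nat k) ` Z" by blast
  qed
  then show "finite {\<alpha>. \<phi> \<alpha> \<noteq> 0 \<and> weight \<omega> \<alpha> \<le> c}"
    using \<open>finite Z\<close> finite_subset by blast
qed

section \<open>From series back to Puiseux series\<close>

lemma common_denominator:
  assumes "finite (S :: rat set)"
  shows "\<exists>k::nat. k > 0 \<and> (\<forall>q\<in>S. of_nat k * q \<in> \<int>)"
  using assms
proof (induction S)
  case empty
  show ?case by (rule exI[of _ 1]) simp
next
  case (insert q S)
  then obtain k :: nat where k: "k > 0" "\<And>q. q \<in> S \<Longrightarrow> of_nat k * q \<in> \<int>" by blast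
  obtain a b where ab: "b > 0" "q = of_int a / of_int b" by (metis quotient_of_denom_pos quotient_of_div surj_pair)
  have nb: "(of_nat (nat b) :: rat) = of_int b" using ab(1) by simp
  show ?case
  proof (intro exI[of _ "k * nat b"] conjI ballI)
    show "k * nat b > 0" using k ab by simp
    fix p assume "p \<in> insert q S"
    then show "of_nat (k * nat b) * p \<in> \<int>"
    proof
      assume p: "p = q"
      have "of_int b * q = of_int a" using ab by simp
      then have "of_nat (k * nat b) * p = of_nat k * of_int a"
        by (simp only: p of_nat_mult nb mult.assoc)
      moreover have "of_nat k * of_int a \<in> (\<int> :: rat set)" by (intro Ints_mult) auto
      ultimately show ?thesis by metis
    next
      assume "p \<in> S"
      then have "of_nat k * p \<in> \<int>" using k by blast
      then have "of_int b * (of_nat k * p) \<in> \<int>" by (rule Ints_mult[OF Ints_of_int])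
      moreover have "of_nat (k * nat b) * p = of_int b * (of_nat k * p)"
        by (simp only: of_nat_mult nb mult_ac)
      ultimately show ?thesis by metis
    qed
  qed
qed

text \<open>Lifts a sum of weights to the exponent vector it comes from, with natural multiplicities
  as coefficients.\<close>

lemma mon_weight:
  assumes "x \<in> mon (weight \<omega> ` V)" "finite V"
  shows "\<exists>d :: _ \<Rightarrow> nat. x = weight \<omega> (\<lambda>j. \<Sum>v\<in>V. of_nat (d v) * v j)"
  using assms(1)
proof (induction rule: mon.induct)
  case zero
  show ?case by (rule exI[of _ "\<lambda>_. 0"]) (simp add: weight_def)
next
  case (add x u)
  then obtain d :: "_ \<Rightarrow> nat" and v where d: "x = weight \<omega> (\<lambda>j. \<Sum>v\<in>V. of_nat (d v) * v j)" and v: "v \<in> V" "u = weight \<omega> v"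
    by blast
  have "(\<lambda>j. \<Sum>u\<in>V. of_nat ((d(v := Suc (d v))) u) * u j) = (\<lambda>j. \<Sum>v\<in>V. of_nat (d v) * v j) + v"
  proof
    fix j
    have "(\<Sum>u\<in>V. of_nat ((d(v := Suc (d v))) u) * u j) = (\<Sum>u\<in>V. of_nat (d u) * u j + (if u = v then u j else 0))"
      by (intro sum.cong refl) (auto simp: algebra_simps)
    then show "(\<Sum>u\<in>V. of_nat ((d(v := Suc (d v))) u) * u j) = ((\<lambda>j. \<Sum>v\<in>V. of_nat (d v) * v j) + v) j"
      using assms(2) v(1) by (simp add: sum.distrib)
  qed
  then show ?case using d v by (intro exI[of _ "d(v := Suc (d v))"]) (simp only: weight_add)
qed

text \<open>Exponents lie in g plus natural combinations of the finite set V of lifted generators.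
  The coordinates of g and V have a common denominator, V spans the cone, and -g is the shift;
  positive weights of V make the cone nonnegative.\<close>

lemma ps_valid_T:
  fixes r :: "'k::comm_ring_1 lfs" and \<omega> :: "'n::finite \<Rightarrow> real"
  assumes \<omega>: "rational_indep \<omega>" and "r \<in> divisible_group.T (range (weight \<omega>))"
  shows "ps_valid \<omega> (\<lambda>\<alpha>. scoeff r (weight \<omega> \<alpha>))"
proof -
  interpret divisible_group "range (weight \<omega>)" by (rule divisible_group_weight[OF \<omega>])
  obtain \<gamma> W where W: "\<gamma> \<in> range (weight \<omega>)" "finite W" "W \<subseteq> range (weight \<omega>)" "W \<subseteq> {0<..}"
    "\<And>s. scoeff r s \<noteq> 0 \<Longrightarrow> s - \<gamma> \<in> mon W"
    using TE[OF assms(2)] by blast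
  obtain g where g: "\<gamma> = weight \<omega> g" using W(1) by blast
  obtain V where V: "finite V" "W = weight \<omega> ` V" using finite_subset_image[OF W(2,3)] by blast
  have rep: "\<exists>d :: _ \<Rightarrow> nat. \<alpha> = g + (\<lambda>j. \<Sum>v\<in>V. of_nat (d v) * v j)"
    if \<alpha>: "scoeff r (weight \<omega> \<alpha>) \<noteq> 0" for \<alpha>
  proof -
    obtain d :: "_ \<Rightarrow> nat" where "weight \<omega> \<alpha> - \<gamma> = weight \<omega> (\<lambda>j. \<Sum>v\<in>V. of_nat (d v) * v j)"
      using mon_weight[of _ \<omega> V] W(5)[OF \<alpha>] V by blast
    then have "weight \<omega> \<alpha> = weight \<omega> (g + (\<lambda>j. \<Sum>v\<in>V. of_nat (d v) * v j))"
      by (simp add: weight_add g)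
    then show ?thesis using weight_inject[OF \<omega>] by blast
  qed
  have "finite (\<Union>u\<in>insert g V. range u)" using V(1) by simp
  then obtain k :: nat where k: "k > 0" "\<And>u j. u \<in> insert g V \<Longrightarrow> of_nat k * u j \<in> \<int>"
    using common_denominator by (metis (no_types, lifting) UN_I rangeI)
  show ?thesis
    unfolding ps_valid_def
  proof (intro conjI exI[of _ k] exI[of _ "- g"] exI[of _ V] ballI allI k(1) V(1))
    fix \<alpha> j assume "\<alpha> \<in> lsupp (\<lambda>\<alpha>. scoeff r (weight \<omega> \<alpha>))"
    then obtain d :: "_ \<Rightarrow> nat" where d: "\<alpha> = g + (\<lambda>j. \<Sum>v\<in>V. of_nat (d v) * v j)"
      using rep by (auto simp: lsupp_def)
    have "of_nat k * \<alpha> j = of_nat k * g j + (\<Sum>v\<in>V. of_nat (d v) * (of_nat k * v j))"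
      by (simp add: d distrib_left sum_distrib_left mult_ac)
    also have "\<dots> \<in> \<int>"
      by (intro Ints_add Ints_sum Ints_mult[OF Ints_of_nat] k(2)) auto
    finally show "of_nat k * \<alpha> j \<in> \<int>" .
  next
    fix s assume "s \<in> rcone V"
    then obtain d where d: "\<And>v. v \<in> V \<Longrightarrow> d v \<ge> 0" "s = (\<lambda>j. \<Sum>v\<in>V. d v * real_of_rat (v j))"
      by (auto simp: rcone_def)
    have "s j * \<omega> j = (\<Sum>v\<in>V. d v * (\<omega> j * real_of_rat (v j)))" for j
      unfolding d(2) sum_distrib_right by (simp only: mult_ac)
    then have "(\<Sum>j\<in>UNIV. s j * \<omega> j) = (\<Sum>j\<in>UNIV. \<Sum>v\<in>V. d v * (\<omega> j * real_of_rat (v j)))"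
      by simp
    also have "\<dots> = (\<Sum>v\<in>V. d v * weight \<omega> v)"
      by (subst sum.swap) (simp add: weight_def sum_distrib_left)
    also have "\<dots> \<ge> 0"
    proof (rule sum_nonneg)
      fix v assume v: "v \<in> V"
      then have "weight \<omega> v > 0" using W(4) V(2) by auto
      then show "0 \<le> d v * weight \<omega> v" using d(1)[OF v] by simp
    qed
    finally show "(\<Sum>j\<in>UNIV. s j * \<omega> j) \<ge> 0" .
  next
    fix \<alpha> assume "\<alpha> \<in> lsupp (\<lambda>\<alpha>. scoeff r (weight \<omega> \<alpha>))"
    then obtain d :: "_ \<Rightarrow> nat" where d: "\<alpha> = g + (\<lambda>j. \<Sum>v\<in>V. of_nat (d v) * v j)"
      using rep by (auto simp: lsupp_def)
    show "(\<lambda>j. real_of_rat (\<alpha> j + (- g) j)) \<in> rcone V"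
      unfolding rcone_def
      by (intro CollectI exI[of _ "\<lambda>v. real (d v)"]) (auto simp: d of_rat_sum of_rat_mult)
  qed
qed

section \<open>Products and evaluation of Puiseux series\<close>

definition exponent_tuples :: "'j set \<Rightarrow> ('j \<Rightarrow> ('n \<Rightarrow> rat) \<Rightarrow> 'k::zero) \<Rightarrow> ('n \<Rightarrow> rat) \<Rightarrow> ('j \<Rightarrow> 'n \<Rightarrow> rat) set" where
  "exponent_tuples J \<psi> \<gamma> = {a \<in> PiE J (\<lambda>j. lsupp (\<psi> j)). (\<Sum>j\<in>J. a j) = \<gamma>}"

lemma ps_fprod_altdef: "ps_fprod J \<psi> \<gamma> = (\<Sum>a\<in>exponent_tuples J \<psi> \<gamma>. \<Prod>j\<in>J. \<psi> j (a j))"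
  by (simp add: ps_fprod_def exponent_tuples_def fun_eq_iff sum_fun_apply)

text \<open>Only exponents of the new factor that some tuple completes are kept; this index set
  turns out finite, whereas the whole support of the factor may be infinite.\<close>

lemma exponent_tuples_insert:
  assumes J: "finite J" "j \<notin> J"
  shows "bij_betw (\<lambda>(\<alpha>, a). a(j := \<alpha>))
     (SIGMA \<alpha>:{\<alpha> \<in> lsupp (\<psi> j). exponent_tuples J \<psi> (\<gamma> - \<alpha>) \<noteq> {}}. exponent_tuples J \<psi> (\<gamma> - \<alpha>))
     (exponent_tuples (insert j J) \<psi> \<gamma>)"
proof (rule bij_betwI[where g="\<lambda>b. (b j, restrict b J)"])
  have upd: "(\<Sum>i\<in>insert j J. (a(j := \<alpha>)) i) = \<alpha> + (\<Sum>i\<in>J. a i)" for a and \<alpha> :: "'b \<Rightarrow> rat"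
  proof -
    have "(\<Sum>i\<in>J. (a(j := \<alpha>)) i) = (\<Sum>i\<in>J. a i)" by (rule sum.cong) (use J(2) in auto)
    then show ?thesis unfolding sum.insert[OF J] by simp
  qed
  show "(\<lambda>(\<alpha>, a). a(j := \<alpha>)) \<in> (SIGMA \<alpha>:{\<alpha> \<in> lsupp (\<psi> j). exponent_tuples J \<psi> (\<gamma> - \<alpha>) \<noteq> {}}.
      exponent_tuples J \<psi> (\<gamma> - \<alpha>)) \<rightarrow> exponent_tuples (insert j J) \<psi> \<gamma>"
  proof clarify
    fix \<alpha> a assume \<alpha>: "\<alpha> \<in> lsupp (\<psi> j)" and a: "a \<in> exponent_tuples J \<psi> (\<gamma> - \<alpha>)"
    have "a(j := \<alpha>) \<in> PiE (insert j J) (\<lambda>j. lsupp (\<psi> j))"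
      using \<alpha> a by (intro PiE_fun_upd) (auto simp: exponent_tuples_def)
    moreover have "(\<Sum>i\<in>insert j J. (a(j := \<alpha>)) i) = \<gamma>"
      unfolding upd using a by (simp add: exponent_tuples_def)
    ultimately show "a(j := \<alpha>) \<in> exponent_tuples (insert j J) \<psi> \<gamma>"
      by (simp only: exponent_tuples_def mem_Collect_eq)
  qed
  show "(\<lambda>b. (b j, restrict b J)) \<in> exponent_tuples (insert j J) \<psi> \<gamma> \<rightarrow>
      (SIGMA \<alpha>:{\<alpha> \<in> lsupp (\<psi> j). exponent_tuples J \<psi> (\<gamma> - \<alpha>) \<noteq> {}}. exponent_tuples J \<psi> (\<gamma> - \<alpha>))"
  proof
    fix b assume b: "b \<in> exponent_tuples (insert j J) \<psi> \<gamma>"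
    then have "restrict b J \<in> exponent_tuples J \<psi> (\<gamma> - b j)" "b j \<in> lsupp (\<psi> j)"
      using J by (auto simp: exponent_tuples_def)
    then show "(b j, restrict b J) \<in> (SIGMA \<alpha>:{\<alpha> \<in> lsupp (\<psi> j). exponent_tuples J \<psi> (\<gamma> - \<alpha>) \<noteq> {}}.
      exponent_tuples J \<psi> (\<gamma> - \<alpha>))" by auto
  qed
  fix x assume "x \<in> (SIGMA \<alpha>:{\<alpha> \<in> lsupp (\<psi> j). exponent_tuples J \<psi> (\<gamma> - \<alpha>) \<noteq> {}}. exponent_tuples J \<psi> (\<gamma> - \<alpha>))"
  then obtain \<alpha> a where x: "x = (\<alpha>, a)" "a \<in> PiE J (\<lambda>j. lsupp (\<psi> j))" by (auto simp: exponent_tuples_def)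
  have "restrict (a(j := \<alpha>)) J = a" using x(2) J(2) by (auto simp: restrict_def fun_eq_iff PiE_def extensional_def)
  then show "((case x of (\<alpha>, a) \<Rightarrow> a(j := \<alpha>)) j, restrict (case x of (\<alpha>, a) \<Rightarrow> a(j := \<alpha>)) J) = x"
    by (simp add: x(1))
next
  fix b assume "b \<in> exponent_tuples (insert j J) \<psi> \<gamma>"
  then have "b \<in> PiE (insert j J) (\<lambda>j. lsupp (\<psi> j))" by (simp add: exponent_tuples_def)
  then show "(case (b j, restrict b J) of (\<alpha>, a) \<Rightarrow> a(j := \<alpha>)) = b"
    by (auto simp: fun_eq_iff PiE_def extensional_def)
qed

text \<open>Finiteness belongs to the induction because a sum over an infinite index set is 0 by
  convention. The exponents of the other factors are bounded below, which bounds the weight of the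
  new one from above.\<close>

lemma scoeff_prod_emb:
  fixes \<psi> :: "'j \<Rightarrow> ('n::finite \<Rightarrow> rat) \<Rightarrow> 'k::comm_ring_1"
  assumes \<omega>: "rational_indep \<omega>" and J: "finite J" and lf: "\<And>j. j \<in> J \<Longrightarrow> left_finite \<omega> (\<psi> j)"
  shows "finite (exponent_tuples J \<psi> \<gamma>) \<and> scoeff (\<Prod>j\<in>J. emb \<omega> (\<psi> j)) (weight \<omega> \<gamma>) = ps_fprod J \<psi> \<gamma>"
  using J lf
proof (induction J arbitrary: \<gamma>)
  case empty
  have *: "exponent_tuples {} \<psi> \<gamma> = (if \<gamma> = 0 then {\<lambda>_. undefined} else {})"
    by (auto simp: exponent_tuples_def)
  then show ?case
    using weight_inject[OF \<omega>, of \<gamma> 0] by (simp add: ps_fprod_altdef scoeff_1)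
next
  case (insert j J)
  have IH: "finite (exponent_tuples J \<psi> \<delta>)" "scoeff (\<Prod>j\<in>J. emb \<omega> (\<psi> j)) (weight \<omega> \<delta>) = ps_fprod J \<psi> \<delta>" for \<delta>
    using insert by blast+
  have lfj: "left_finite \<omega> (\<psi> j)" using insert.prems by blast
  have "\<forall>i\<in>J. \<exists>m. \<forall>\<alpha>\<in>lsupp (\<psi> i). m \<le> weight \<omega> \<alpha>"
  proof
    fix i assume "i \<in> J"
    then have "left_finite \<omega> (\<psi> i)" using insert.prems by blast
    obtain m where "vge m (emb \<omega> (\<psi> i))" using vge_exists by blast
    then show "\<exists>m. \<forall>\<alpha>\<in>lsupp (\<psi> i). m \<le> weight \<omega> \<alpha>"
      using scoeff_emb(1)[OF \<omega> \<open>left_finite \<omega> (\<psi> i)\<close>] unfolding vge_def lsupp_def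
      by (metis mem_Collect_eq not_le)
  qed
  then obtain m where m: "\<And>i \<alpha>. i \<in> J \<Longrightarrow> \<alpha> \<in> lsupp (\<psi> i) \<Longrightarrow> m i \<le> weight \<omega> \<alpha>" by metis
  have low: "(\<Sum>i\<in>J. m i) \<le> weight \<omega> \<delta>" if ne: "exponent_tuples J \<psi> \<delta> \<noteq> {}" for \<delta>
  proof -
    obtain a where a: "a \<in> PiE J (\<lambda>j. lsupp (\<psi> j))" "(\<Sum>j\<in>J. a j) = \<delta>"
      using ne by (auto simp: exponent_tuples_def)
    have "(\<Sum>i\<in>J. m i) \<le> (\<Sum>i\<in>J. weight \<omega> (a i))" using a(1) m by (intro sum_mono) auto
    then show ?thesis using a(2) weight_sum[of \<omega> a J] by simp
  qed
  define B where "B = {\<alpha> \<in> lsupp (\<psi> j). exponent_tuples J \<psi> (\<gamma> - \<alpha>) \<noteq> {}}"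
  have "B \<subseteq> {\<alpha>. \<psi> j \<alpha> \<noteq> 0 \<and> weight \<omega> \<alpha> \<le> weight \<omega> \<gamma> - (\<Sum>i\<in>J. m i)}"
  proof
    fix \<alpha> assume "\<alpha> \<in> B"
    then show "\<alpha> \<in> {\<alpha>. \<psi> j \<alpha> \<noteq> 0 \<and> weight \<omega> \<alpha> \<le> weight \<omega> \<gamma> - (\<Sum>i\<in>J. m i)}"
      using low[of "\<gamma> - \<alpha>"] by (auto simp: B_def lsupp_def weight_diff)
  qed
  then have finB: "finite B" using lfj finite_subset unfolding left_finite_def by blast
  note bij = exponent_tuples_insert[OF insert.hyps(1,2), of \<psi> \<gamma>, folded B_def]
  have "finite (SIGMA \<alpha>:B. exponent_tuples J \<psi> (\<gamma> - \<alpha>))" using finB IH by auto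
  then have "finite (exponent_tuples (insert j J) \<psi> \<gamma>)" using bij bij_betw_finite by blast
  moreover have "ps_fprod (insert j J) \<psi> \<gamma> = (\<Sum>\<alpha>\<in>B. \<psi> j \<alpha> * ps_fprod J \<psi> (\<gamma> - \<alpha>))"
  proof -
    have "ps_fprod (insert j J) \<psi> \<gamma> = (\<Sum>(\<alpha>, a)\<in>(SIGMA \<alpha>:B. exponent_tuples J \<psi> (\<gamma> - \<alpha>)).
        \<Prod>i\<in>insert j J. \<psi> i ((a(j := \<alpha>)) i))"
      unfolding ps_fprod_altdef by (subst sum.reindex_bij_betw[OF bij, symmetric]) (simp add: case_prod_beta)
    also have "\<dots> = (\<Sum>(\<alpha>, a)\<in>(SIGMA \<alpha>:B. exponent_tuples J \<psi> (\<gamma> - \<alpha>)). \<psi> j \<alpha> * (\<Prod>i\<in>J. \<psi> i (a i)))"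
    proof (intro sum.cong refl, clarify)
      fix \<alpha> a
      have "(\<Prod>i\<in>J. \<psi> i ((a(j := \<alpha>)) i)) = (\<Prod>i\<in>J. \<psi> i (a i))"
        by (rule prod.cong) (use insert.hyps in auto)
      then show "(\<Prod>i\<in>insert j J. \<psi> i ((a(j := \<alpha>)) i)) = \<psi> j \<alpha> * (\<Prod>i\<in>J. \<psi> i (a i))"
        using insert.hyps by simp
    qed
    also have "\<dots> = (\<Sum>\<alpha>\<in>B. \<Sum>a\<in>exponent_tuples J \<psi> (\<gamma> - \<alpha>). \<psi> j \<alpha> * (\<Prod>i\<in>J. \<psi> i (a i)))"
      using finB IH by (subst sum.Sigma) auto
    finally show ?thesis by (simp add: ps_fprod_altdef sum_distrib_left)
  qed
  moreover have "scoeff (\<Prod>i\<in>insert j J. emb \<omega> (\<psi> i)) (weight \<omega> \<gamma>) = (\<Sum>\<alpha>\<in>B. \<psi> j \<alpha> * ps_fprod J \<psi> (\<gamma> - \<alpha>))"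
  proof -
    let ?G = "\<Prod>i\<in>J. emb \<omega> (\<psi> i)"
    have "scoeff (emb \<omega> (\<psi> j) * ?G) (weight \<omega> \<gamma>)
        = (\<Sum>s\<in>weight \<omega> ` B. scoeff (emb \<omega> (\<psi> j)) s * scoeff ?G (weight \<omega> \<gamma> - s))"
    proof (rule scoeff_times_sum)
      fix s assume s: "scoeff (emb \<omega> (\<psi> j)) s \<noteq> 0" "scoeff ?G (weight \<omega> \<gamma> - s) \<noteq> 0"
      then obtain \<alpha> where \<alpha>: "s = weight \<omega> \<alpha>" using scoeff_emb(2)[OF \<omega> lfj] by blast
      have "\<alpha> \<in> lsupp (\<psi> j)" using s(1) scoeff_emb(1)[OF \<omega> lfj] by (simp add: \<alpha> lsupp_def)
      moreover have "ps_fprod J \<psi> (\<gamma> - \<alpha>) \<noteq> 0" using s(2) IH(2)[of "\<gamma> - \<alpha>"] by (simp add: \<alpha> weight_diff)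
      then have "exponent_tuples J \<psi> (\<gamma> - \<alpha>) \<noteq> {}" by (auto simp: ps_fprod_altdef)
      ultimately show "s \<in> weight \<omega> ` B" by (auto simp: B_def \<alpha>)
    qed (use finB in simp)
    also have "\<dots> = (\<Sum>\<alpha>\<in>B. scoeff (emb \<omega> (\<psi> j)) (weight \<omega> \<alpha>) * scoeff ?G (weight \<omega> (\<gamma> - \<alpha>)))"
      using weight_inject[OF \<omega>] by (subst sum.reindex) (auto simp: inj_on_def weight_diff)
    finally show ?thesis using insert.hyps scoeff_emb(1)[OF \<omega> lfj] IH(2) by simp
  qed
  ultimately show ?case by simp
qed

lemma (in divisible_group) supp_in_times: "supp_in D F \<Longrightarrow> supp_in D G \<Longrightarrow> supp_in D (F * G)"
  for F G :: "'a::comm_ring_1 lfs"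
  unfolding supp_in_def
proof (intro allI impI)
  fix r assume F: "\<forall>r. scoeff F r \<noteq> 0 \<longrightarrow> r \<in> D" and G: "\<forall>r. scoeff G r \<noteq> 0 \<longrightarrow> r \<in> D" and "scoeff (F * G) r \<noteq> 0"
  then obtain s where "scoeff F s \<noteq> 0" "scoeff G (r - s) \<noteq> 0" using scoeff_times_nonzero by blast
  then have "s + (r - s) \<in> D" using F G by (intro D_add) auto
  then show "r \<in> D" by simp
qed

lemma (in divisible_group) supp_in_prod:
  "(\<And>x. x \<in> A \<Longrightarrow> supp_in D (f x :: 'a::comm_ring_1 lfs)) \<Longrightarrow> supp_in D (prod f A)"
proof (induction A rule: infinite_finite_induct)
  case (insert x A)
  then show ?case by (simp add: supp_in_times)
qed (auto simp: supp_in_def scoeff_1 D_zero)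

lemmas yev_sum = pm_eval_sum[OF yev_hom, folded yev_def]

lemma yev_hat: "yev r (hat \<omega> F) = (\<Sum>e\<in>keys F. sconst (lookup F e) (xscale \<omega> (fst e)) * (\<Prod>i\<in>UNIV. r i ^ snd e i))"
  by (simp only: hat_as_sum yev_sum yev_single)

text \<open>At exponents \<omega>\<cdot>\<gamma> the two evaluations have the same coefficients, and
  at all other exponents the series has none, as every factor is supported on weights.\<close>

lemma ps_eval_zero_iff:
  fixes F :: "('n::finite, 'm::finite, 'k::comm_ring_1) lpm"
  assumes \<omega>: "rational_indep \<omega>" and lf: "\<And>i. left_finite \<omega> (\<phi> i)"
  shows "ps_eval (lookup F) \<phi> = (\<lambda>_. 0) \<longleftrightarrow> yev (\<lambda>i. emb \<omega> (\<phi> i)) (hat \<omega> F) = 0"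
proof -
  interpret divisible_group "range (weight \<omega>)" by (rule divisible_group_weight[OF \<omega>])
  let ?E = "yev (\<lambda>i. emb \<omega> (\<phi> i)) (hat \<omega> F)"
  have coeff: "scoeff ?E (weight \<omega> \<gamma>) = ps_eval (lookup F) \<phi> \<gamma>" for \<gamma>
  proof -
    have "scoeff (sconst (lookup F e) (xscale \<omega> (fst e)) * (\<Prod>i\<in>UNIV. emb \<omega> (\<phi> i) ^ snd e i)) (weight \<omega> \<gamma>)
        = lookup F e * ps_fprod {(i, k). k < snd e i} (\<lambda>(i, k). \<phi> i) (\<lambda>j. \<gamma> j - of_int (fst e j))" for e
    proof -
      let ?J = "{(i, k). k < snd e i}"
      have J: "?J = Sigma UNIV (\<lambda>i. {..<snd e i})" by auto
      have finJ: "finite ?J" unfolding J by auto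
      have "(\<Prod>x\<in>?J. emb \<omega> ((\<lambda>(i, k). \<phi> i) x)) = (\<Prod>i\<in>UNIV. \<Prod>k<snd e i. emb \<omega> (\<phi> i))"
        unfolding J by (subst prod.Sigma) (auto simp: case_prod_beta)
      then have "(\<Prod>i\<in>UNIV. emb \<omega> (\<phi> i) ^ snd e i) = (\<Prod>x\<in>?J. emb \<omega> ((\<lambda>(i, k). \<phi> i) x))" by simp
      moreover have "weight \<omega> \<gamma> - xscale \<omega> (fst e) = weight \<omega> (\<lambda>j. \<gamma> j - of_int (fst e j))"
        unfolding xscale_def weight_diff[symmetric] by (simp add: rat_expo_def fun_diff_def)
      moreover have "scoeff (\<Prod>x\<in>?J. emb \<omega> ((\<lambda>(i, k). \<phi> i) x)) (weight \<omega> \<delta>) = ps_fprod ?J (\<lambda>(i, k). \<phi> i) \<delta>" for \<delta>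
        using scoeff_prod_emb[OF \<omega> finJ, of "\<lambda>(i, k). \<phi> i" \<delta>] lf by auto
      ultimately show ?thesis by simp
    qed
    then show ?thesis by (simp add: yev_hat scoeff_sum ps_eval_def lsupp_lookup)
  qed
  have "supp_in (range (weight \<omega>)) (emb \<omega> (\<phi> i) ^ n)" for i n
  proof (induction n)
    case 0
    show ?case by (simp add: supp_in_def scoeff_1 D_zero)
  next
    case (Suc n)
    have "supp_in (range (weight \<omega>)) (emb \<omega> (\<phi> i))"
      using scoeff_emb(2)[OF \<omega> lf] by (auto simp: supp_in_def)
    then show ?case using Suc by (simp add: supp_in_times)
  qed
  then have "supp_in (range (weight \<omega>)) (sconst (lookup F e) (xscale \<omega> (fst e)) * (\<Prod>i\<in>UNIV. emb \<omega> (\<phi> i) ^ snd e i))" for e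
    by (intro supp_in_times supp_in_prod) (auto simp: supp_in_def xscale_def split: if_splits)
  then have off: "scoeff ?E r = 0" if "r \<notin> range (weight \<omega>)" for r
    using that by (auto simp: yev_hat scoeff_sum supp_in_def intro!: sum.neutral)
  show ?thesis
  proof
    assume z: "ps_eval (lookup F) \<phi> = (\<lambda>_. 0)"
    show "?E = 0"
    proof (rule lfs_eqI)
      fix r show "scoeff ?E r = scoeff 0 r"
        using off[of r] coeff z by (cases "r \<in> range (weight \<omega>)") auto
    qed
  next
    assume "?E = 0"
    then show "ps_eval (lookup F) \<phi> = (\<lambda>_. 0)" using coeff by (simp add: fun_eq_iff)
  qed
qed

lemma emb_monom:
  assumes \<omega>: "rational_indep (\<omega> :: 'n::finite \<Rightarrow> real)"
  shows "emb \<omega> (ps_monom c \<alpha>) = sconst c (weight \<omega> \<alpha>)" "ps_valid \<omega> (ps_monom (c::'k::comm_ring_1) \<alpha>)"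
proof -
  interpret divisible_group "range (weight \<omega>)" by (rule divisible_group_weight[OF \<omega>])
  have eq: "ps_monom c \<alpha> = (\<lambda>\<alpha>'. scoeff (sconst c (weight \<omega> \<alpha>)) (weight \<omega> \<alpha>'))"
    by (auto simp: ps_monom_def weight_inject[OF \<omega>])
  show "emb \<omega> (ps_monom c \<alpha>) = sconst c (weight \<omega> \<alpha>)"
    unfolding eq by (rule emb_scoeff[OF \<omega>]) (auto split: if_splits)
  show "ps_valid \<omega> (ps_monom c \<alpha>)"
    unfolding eq by (rule ps_valid_T[OF \<omega>]) (rule T_sconst, simp)
qed

text \<open>The kernel of a ring homomorphism as an ideal in the sense of the statement; it serves
  as an upper bound for the generated initial ideal.\<close>

lemma lp_ideal_lookup_image:
  fixes E :: "('n, 'm, 'k::comm_ring_1) lpm \<Rightarrow> 'b::comm_ring_1"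
  assumes "E 0 = 0" "\<And>F G. E (F + G) = E F + E G" "\<And>F G. E (F * G) = E F * E G"
  shows "lp_ideal {lookup F | F. E F = 0}"
  unfolding lp_ideal_def
proof (intro conjI ballI allI impI)
  show "{lookup F | F. E F = 0} \<subseteq> {f. is_lpoly f}" using is_lpoly_lookup by blast
  have "(\<lambda>_. 0) = lookup (0 :: ('n, 'm, 'k) lpm)" by auto
  then show "(\<lambda>_. 0) \<in> {lookup F | F. E F = 0}" using assms(1) by blast
  fix f assume "f \<in> {lookup F | F. E F = 0}"
  then obtain F where F: "f = lookup F" "E F = 0" by blast
  {
    fix g assume "g \<in> {lookup F | F. E F = 0}"
    then obtain G where G: "g = lookup G" "E G = 0" by blast
    have "lp_add f g = lookup (F + G)" by (auto simp: F G lp_add_def lookup_add)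
    then show "lp_add f g \<in> {lookup F | F. E F = 0}" using F G assms(2)[of F G] by auto
  next
    fix g assume "is_lpoly (g :: ('n \<Rightarrow> int) \<times> ('m \<Rightarrow> nat) \<Rightarrow> 'k)"
    then obtain G :: "('n, 'm, 'k) lpm" where "g = lookup G" by (rule lpolyE)
    then have "lp_mult g f = lookup (G * F) \<and> E (G * F) = 0"
      using F assms(3)[of G F] lookup_mult_lp[of G F] by simp
    then show "lp_mult g f \<in> {lookup F | F. E F = 0}" by blast
  }
qed

section \<open>Initial forms at the monomial point\<close>

context lifting
begin

definition expo :: "('n \<Rightarrow> int) \<times> ('m \<Rightarrow> nat) \<Rightarrow> real" where
  "expo e = xscale \<omega> (fst e) + wt (snd e)"

definition order :: "'m \<Rightarrow> ereal" where
  "order i = (if c i = 0 then \<infinity> else ereal (\<eta> i))"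

lemma lp_wt_order: "lp_wt \<omega> order e = (if fin (snd e) then ereal (expo e) else \<infinity>)"
proof -
  have "eta_dot order (snd e) = (if fin (snd e) then ereal (wt (snd e)) else \<infinity>)"
  proof (cases "fin (snd e)")
    case True
    have "eta_dot order (snd e) = (\<Sum>i\<in>UNIV. ereal (real (snd e i) * \<eta> i))"
      unfolding eta_dot_def using True by (intro sum.cong refl) (auto simp: fin_def order_def mult.commute)
    then show ?thesis using True by (simp add: wt_def)
  next
    case False
    then obtain i where i: "c i = 0" "snd e i \<noteq> 0" by (auto simp: fin_def)
    then have "(if snd e i = 0 then 0 else order i * ereal (real (snd e i))) = \<infinity>"
      by (simp add: order_def)
    then have "eta_dot order (snd e) = \<infinity>"
      unfolding eta_dot_def sum_Pinfty by (intro conjI bexI[of _ i] finite UNIV_I)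
    then show ?thesis using False by simp
  qed
  moreover have "(\<Sum>j\<in>UNIV. \<omega> j * real_of_int (fst e j)) = xscale \<omega> (fst e)"
    by (simp add: xscale_def weight_def rat_expo_def)
  ultimately show ?thesis by (simp add: lp_wt_def expo_def)
qed

lemma ev_hat: "ev (hat \<omega> F) = (\<Sum>e\<in>keys F. sconst (lookup F e * (\<Prod>i\<in>UNIV. c i ^ snd e i)) (expo e))"
  unfolding ev_def yev_hat point_power by (simp add: sconst_mult expo_def)

lemma xscale_inject: "xscale \<omega> a = xscale \<omega> b \<longleftrightarrow> a = b"
  by (simp add: xscale_def weight_inject[OF indep] rat_expo_inject)

text \<open>For one power of \<open>y\<close>, different powers of \<open>x\<close> become different
  powers of t, so every monomial of \<open>F\<close> remains visible in \<open>hat\<close>.\<close>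

lemma norm_ge_hat: "norm_ge w (hat \<omega> F) \<longleftrightarrow> (\<forall>e\<in>keys F. fin (snd e) \<longrightarrow> w \<le> expo e)"
proof
  assume n: "norm_ge w (hat \<omega> F)"
  show "\<forall>e\<in>keys F. fin (snd e) \<longrightarrow> w \<le> expo e"
  proof (intro ballI impI)
    fix e assume e: "e \<in> keys F" "fin (snd e)"
    have "scoeff (lookup (hat \<omega> F) (snd e)) (xscale \<omega> (fst e))
        = (\<Sum>e'\<in>keys F. if e' = e then lookup F e' else 0)"
      unfolding lookup_hat scoeff_sum
      by (intro sum.cong refl) (auto simp: xscale_inject prod_eq_iff)
    also have "\<dots> \<noteq> 0" using e(1) by (simp add: in_keys_iff)
    finally have "xscale \<omega> (fst e) \<ge> w - wt (snd e)"
      using n e(2) vgeD unfolding norm_ge_def by (metis not_le)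
    then show "w \<le> expo e" by (simp add: expo_def)
  qed
next
  assume le: "\<forall>e\<in>keys F. fin (snd e) \<longrightarrow> w \<le> expo e"
  show "norm_ge w (hat \<omega> F)"
    unfolding norm_ge_def lookup_hat
  proof (intro allI impI vge_sum)
    fix b e assume "fin b" "e \<in> keys F"
    then show "vge (w - wt b) (if snd e = b then sconst (lookup F e) (xscale \<omega> (fst e)) else 0)"
      using le by (auto simp: expo_def intro!: vge_sconst)
  qed
qed

text \<open>All monomials of the initial form share the exponent m, so its value is \<kappa> t^m,
  with \<kappa> also the coefficient of t^m in the value of \<open>F\<close>. If no monomial has
  finite weight, the initial form is 0 by convention and \<open>F\<close> is not good.\<close>

lemma initial_form_vanishes:
  fixes F :: "('n, 'm, 'k) lpm"
  obtains F' where "lp_in \<omega> order (lookup F) = lookup F'" "ev (hat \<omega> F') = 0 \<longleftrightarrow> \<not> good (hat \<omega> F)"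
proof -
  let ?f = "lookup F"
  define S where "S = {e \<in> keys F. fin (snd e)}"
  have finS: "finite S" by (simp add: S_def)
  have ord: "lp_ord \<omega> order ?f = (INF e\<in>keys F. if fin (snd e) then ereal (expo e) else \<infinity>)"
    by (simp add: lp_ord_def lsupp_lookup lp_wt_order)
  show ?thesis
  proof (cases "S = {}")
    case True
    have nf: "\<not> fin (snd e)" if "e \<in> keys F" for e using True that unfolding S_def by blast
    have "lp_ord \<omega> order ?f = \<infinity>"
      unfolding ord using nf by (auto intro!: INF_eqI simp: top_ereal_def[symmetric])
    then have 1: "lp_in \<omega> order ?f = lookup 0" by (auto simp: lp_in_def)
    have "lookup (hat \<omega> F) b = 0" if "fin b" for b
      unfolding lookup_hat using nf that by (intro sum.neutral) auto
    then have "\<not> good (Const 1 * hat \<omega> F + 0)"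
      by (intro not_good_negligible) (auto simp: good_def ev_altdef)
    then have 2: "\<not> good (hat \<omega> F)" by (simp add: Const_simps)
    have "ev (hat \<omega> (0 :: ('n, 'm, 'k) lpm)) = 0" by (simp add: hat_0 ev_altdef)
    then show ?thesis using 1 2 that[of 0] by simp
  next
    case False
    define m where "m = Min (expo ` S)"
    have mS: "m \<in> expo ` S" unfolding m_def using finS False by (intro Min_in) auto
    have mle: "m \<le> expo e" if "e \<in> S" for e unfolding m_def using finS that by (intro Min_le) auto
    have om: "lp_ord \<omega> order ?f = ereal m"
      unfolding ord
    proof (rule antisym)
      obtain e where e: "e \<in> S" "m = expo e" using mS by blast
      have "(INF e\<in>keys F. if fin (snd e) then ereal (expo e) else \<infinity>) \<le> (if fin (snd e) then ereal (expo e) else \<infinity>)"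
        using e by (intro INF_lower) (simp add: S_def)
      then show "(INF e\<in>keys F. if fin (snd e) then ereal (expo e) else \<infinity>) \<le> ereal m"
        using e by (simp add: S_def)
      show "ereal m \<le> (INF e\<in>keys F. if fin (snd e) then ereal (expo e) else \<infinity>)"
        using mle by (intro INF_greatest) (auto simp: S_def)
    qed
    define in_set where "in_set = {e \<in> keys F. fin (snd e) \<and> expo e = m}"
    have inf: "lp_in \<omega> order ?f = (\<lambda>e. if e \<in> in_set then lookup F e else 0)"
      by (auto simp: lp_in_def om lp_wt_order in_set_def lsupp_lookup fun_eq_iff in_keys_iff)
    then have "is_lpoly (lp_in \<omega> order ?f)"
      by (auto simp: is_lpoly_def lsupp_def in_set_def intro: finite_subset[OF _ finite_keys[of F]])
    then obtain F' :: "('n, 'm, 'k) lpm" where F': "lp_in \<omega> order ?f = lookup F'" by (rule lpolyE)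
    have lF': "lookup F' e = (if e \<in> in_set then lookup F e else 0)" for e
      using fun_cong[OF inf, of e] F' by simp
    have kF': "keys F' = in_set" by (auto simp: in_keys_iff lF' in_set_def split: if_splits)
    define \<kappa> where "\<kappa> = (\<Sum>e\<in>in_set. lookup F e * (\<Prod>i\<in>UNIV. c i ^ snd e i))"
    have "ev (hat \<omega> F') = (\<Sum>e\<in>in_set. sconst (lookup F e * (\<Prod>i\<in>UNIV. c i ^ snd e i)) m)"
      unfolding ev_hat kF' by (intro sum.cong refl) (auto simp: lF' in_set_def)
    then have evF': "ev (hat \<omega> F') = sconst \<kappa> m"
      by (auto intro!: lfs_eqI simp: scoeff_sum \<kappa>_def)
    have "scoeff (ev (hat \<omega> F)) m = (\<Sum>e\<in>keys F. if m = expo e then lookup F e * (\<Prod>i\<in>UNIV. c i ^ snd e i) else 0)"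
      unfolding ev_hat scoeff_sum by (intro sum.cong refl) simp
    also have "\<dots> = \<kappa>"
      unfolding \<kappa>_def
    proof (rule sum.mono_neutral_cong_right)
      show "\<forall>e\<in>keys F - in_set. (if m = expo e then lookup F e * (\<Prod>i\<in>UNIV. c i ^ snd e i) else 0) = 0"
      proof
        fix e assume e: "e \<in> keys F - in_set"
        then have "\<not> fin (snd e) \<or> expo e \<noteq> m" by (auto simp: in_set_def)
        then show "(if m = expo e then lookup F e * (\<Prod>i\<in>UNIV. c i ^ snd e i) else 0) = 0"
          using coeff_power_nonzero[of "snd e"] by (auto simp del: prod_zero_iff)
      qed
    qed (auto simp: in_set_def)
    finally have cm: "scoeff (ev (hat \<omega> F)) m = \<kappa>" .
    have nm: "norm_ge m (hat \<omega> F)" using mle by (auto simp: norm_ge_hat S_def)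
    have "good (hat \<omega> F) \<longleftrightarrow> \<kappa> \<noteq> 0"
    proof
      assume "good (hat \<omega> F)"
      then obtain w where w: "norm_ge w (hat \<omega> F)" "scoeff (ev (hat \<omega> F)) w \<noteq> 0" by (auto simp: good_def)
      have "m \<le> w" using norm_ge_ev[OF nm] w(2) by (metis vgeD not_le)
      moreover have "w \<le> m" using w(1) mS by (auto simp: norm_ge_hat S_def)
      ultimately show "\<kappa> \<noteq> 0" using w(2) cm by simp
    next
      assume "\<kappa> \<noteq> 0"
      then show "good (hat \<omega> F)" using nm cm by (auto simp: good_def)
    qed
    moreover have "sconst \<kappa> m = 0 \<longleftrightarrow> \<kappa> = 0"
    proof
      assume "sconst \<kappa> m = 0"
      then have "scoeff (sconst \<kappa> m) m = 0" by simp
      then show "\<kappa> = 0" by simp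
    qed simp
    ultimately show ?thesis using that[OF F'] evF' by simp
  qed
qed

lemma leading_power:
  assumes "vge a r" "scoeff r a = d"
  shows "vge (real n * a) (r ^ n) \<and> scoeff (r ^ n) (real n * a) = d ^ n"
proof (induction n)
  case (Suc n)
  then show ?case
    using vge_times[OF assms(1), of "real n * a" "r ^ n"] scoeff_times_leading[OF assms(1), of "real n * a" "r ^ n"] assms(2)
    by (simp add: algebra_simps)
qed (simp add: vge_def scoeff_1)

lemma leading_prod:
  assumes "finite A" "\<And>i. i \<in> A \<Longrightarrow> vge (a i) (r i) \<and> scoeff (r i) (a i) = d i"
  shows "vge (sum a A) (prod r A) \<and> scoeff (prod r A) (sum a A) = prod d A"
  using assms
proof (induction A)
  case (insert x A)
  then have x: "vge (a x) (r x)" "scoeff (r x) (a x) = d x" and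
    A: "vge (sum a A) (prod r A)" "scoeff (prod r A) (sum a A) = prod d A" by auto
  show ?case
    using vge_times[OF x(1) A(1)] scoeff_times_leading[OF x(1) A(1)] x(2) A(2) insert.hyps by simp
qed (simp add: vge_def scoeff_1)

text \<open>Under the bound w the coefficient of t^w in the value depends only on the first terms of
  the arguments. It is therefore the same at \<open>r\<close> as at the monomial point, and a zero
  at \<open>r\<close> kills it.\<close>

lemma leads_not_good:
  assumes r: "\<And>i. leads i (r i)" and zero: "yev r G = 0"
  shows "\<not> good G"
proof
  assume "good G"
  then obtain w where w: "norm_ge w G" "scoeff (ev G) w \<noteq> 0" by (auto simp: good_def)
  have "scoeff (lookup G b * (\<Prod>i\<in>UNIV. r i ^ b i)) w
      = scoeff (lookup G b * sconst (\<Prod>i\<in>UNIV. c i ^ b i) (wt b)) w" for b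
  proof (cases "fin b")
    case True
    have "vge (real (b i) * \<eta> i) (r i ^ b i) \<and> scoeff (r i ^ b i) (real (b i) * \<eta> i) = c i ^ b i" for i
    proof (cases "c i = 0")
      case True
      then have "b i = 0" using \<open>fin b\<close> by (simp add: fin_def)
      then show ?thesis by (simp add: vge_def scoeff_1)
    next
      case False
      then show ?thesis using r[of i] leading_power[of "\<eta> i" "r i"] by (simp add: leads_def)
    qed
    then have p: "vge (wt b) (\<Prod>i\<in>UNIV. r i ^ b i)" "scoeff (\<Prod>i\<in>UNIV. r i ^ b i) (wt b) = (\<Prod>i\<in>UNIV. c i ^ b i)"
      using leading_prod[of UNIV "\<lambda>i. real (b i) * \<eta> i" "\<lambda>i. r i ^ b i" "\<lambda>i. c i ^ b i"]
      by (simp_all add: wt_def)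
    have l: "vge (w - wt b) (lookup G b)" using w(1) True by (simp add: norm_ge_def)
    have "vge (wt b) (sconst (\<Prod>i\<in>UNIV. c i ^ b i) (wt b))" by (rule vge_sconst) simp
    then show ?thesis
      using scoeff_times_leading[OF l p(1)] scoeff_times_leading[OF l, of "wt b" "sconst (\<Prod>i\<in>UNIV. c i ^ b i) (wt b)"] p(2)
      by simp
  next
    case False
    then obtain i where i: "c i = 0" "b i \<noteq> 0" by (auto simp: fin_def)
    then have "r i = 0" using r[of i] by (simp add: leads_def)
    then have "(\<Prod>i\<in>UNIV. r i ^ b i) = 0" using i by (auto simp: prod_zero_iff)
    moreover have "(\<Prod>i\<in>UNIV. c i ^ b i) = 0" using False coeff_power_nonzero by blast
    ultimately show ?thesis by (simp only: sconst_0 mult_zero_right)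
  qed
  then have "scoeff (yev r G) w = scoeff (ev G) w"
    by (simp add: ev_altdef yev_def pm_eval_def scoeff_sum)
  then show False using w(2) zero by simp
qed

end

lemma ps_in_monom:
  assumes \<omega>: "rational_indep \<omega>" and c: "c \<noteq> 0"
    and lead: "vge (weight \<omega> \<alpha>) r" "scoeff r (weight \<omega> \<alpha>) = c"
  shows "ps_in \<omega> (\<lambda>\<alpha>. scoeff r (weight \<omega> \<alpha>)) = ps_monom c \<alpha>"
proof -
  let ?\<phi> = "\<lambda>\<alpha>. scoeff r (weight \<omega> \<alpha>)"
  have "ps_ord \<omega> ?\<phi> = ereal (weight \<omega> \<alpha>)"
    unfolding ps_ord_def weight_def[symmetric]
  proof (rule antisym)
    show "(INF \<alpha>\<in>lsupp ?\<phi>. ereal (weight \<omega> \<alpha>)) \<le> ereal (weight \<omega> \<alpha>)"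
      using lead c by (intro INF_lower) (simp add: lsupp_def)
    show "ereal (weight \<omega> \<alpha>) \<le> (INF \<alpha>\<in>lsupp ?\<phi>. ereal (weight \<omega> \<alpha>))"
      using vgeD[OF lead(1)] by (intro INF_greatest) (auto simp: lsupp_def not_less[symmetric])
  qed
  then show ?thesis
    unfolding ps_in_def weight_def[symmetric] ps_monom_def
    using lead c by (intro ext) (simp add: lsupp_def weight_inject[OF \<omega>])
qed

theorem theorem10p2:
  fixes I :: "(('n::finite \<Rightarrow> int) \<times> ('m::finite \<Rightarrow> nat) \<Rightarrow> 'k::{alg_closed_field, field_char_0}) set"
    and \<omega> :: "'n \<Rightarrow> real"
    and c :: "'m \<Rightarrow> 'k"
    and \<alpha> :: "'m \<Rightarrow> 'n \<Rightarrow> rat"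
  assumes \<omega>_indep: "\<And>q :: 'n \<Rightarrow> rat. (\<Sum>j\<in>UNIV. real_of_rat (q j) * \<omega> j) = 0 \<Longrightarrow> q = (\<lambda>_. 0)"
    and ideal: "lp_ideal I"
    and adm: "N_admissible I"
  shows "(\<exists>\<phi>. omega_solution \<omega> I \<phi> \<and> (\<lambda>i. ps_in \<omega> (\<phi> i)) = (\<lambda>i. ps_monom (c i) (\<alpha> i)))
     \<longleftrightarrow> ((\<omega>, (\<lambda>i. ps_ord \<omega> (ps_monom (c i) (\<alpha> i)))) \<in> tau I
          \<and> omega_solution \<omega> (lp_In \<omega> (\<lambda>i. ps_ord \<omega> (ps_monom (c i) (\<alpha> i))) I)
                              (\<lambda>i. ps_monom (c i) (\<alpha> i)))"
proof -
  have \<omega>: "rational_indep \<omega>"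
    unfolding rational_indep_def weight_def using \<omega>_indep by (auto simp: mult.commute zero_fun_def)
  define \<eta> where "\<eta> i = weight \<omega> (\<alpha> i)" for i
  interpret divisible_group "range (weight \<omega>)" by (rule divisible_group_weight[OF \<omega>])
  interpret lifting \<omega> c \<eta> "range (weight \<omega>)" by unfold_locales (simp_all add: \<omega>)
  let ?p = "\<lambda>i. ps_monom (c i) (\<alpha> i)"
  have ord: "(\<lambda>i. ps_ord \<omega> (?p i)) = order"
  proof
    fix i
    have "lsupp (?p i) = (if c i = 0 then {} else {\<alpha> i})" by (auto simp: lsupp_def ps_monom_def)
    then show "ps_ord \<omega> (?p i) = order i"
      by (simp add: ps_ord_def order_def \<eta>_def weight_def top_ereal_def)
  qed
  have valid: "ps_valid \<omega> (?p i)" for i by (rule emb_monom(2)[OF \<omega>])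
  have lf: "left_finite \<omega> (?p i)" for i by (rule left_finite_ps_valid[OF \<omega> valid])
  have eval: "ps_eval (lookup F) ?p = (\<lambda>_. 0) \<longleftrightarrow> ev (hat \<omega> F) = 0" for F :: "('n, 'm, 'k) lpm"
    unfolding ps_eval_zero_iff[OF \<omega> lf] by (simp add: emb_monom(1)[OF \<omega>] ev_def \<eta>_def)
  have lpI: "\<exists>F. f = lookup F \<and> F \<in> pm_ideal I" if "f \<in> I" for f
  proof -
    have "is_lpoly f" using ideal that by (auto simp: lp_ideal_def)
    then obtain F where "f = lookup F" by (rule lpolyE)
    then show ?thesis using that by (auto simp: pm_ideal_def)
  qed
  have bad_iff: "omega_solution \<omega> (lp_In \<omega> order I) ?p \<longleftrightarrow> (\<forall>F\<in>pm_ideal I. \<not> good (hat \<omega> F))"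
    (is "?sol \<longleftrightarrow> ?bad")
  proof
    assume sol: ?sol
    show ?bad
    proof
      fix F assume F: "F \<in> pm_ideal I"
      obtain F' where F': "lp_in \<omega> order (lookup F) = lookup F'" "ev (hat \<omega> F') = 0 \<longleftrightarrow> \<not> good (hat \<omega> F)"
        using initial_form_vanishes by blast
      have "lp_in \<omega> order (lookup F) \<in> lp_In \<omega> order I"
        unfolding lp_In_def lp_ideal_gen_def using F by (auto simp: pm_ideal_def)
      then have "ps_eval (lookup F') ?p = (\<lambda>_. 0)" using sol F'(1) by (simp add: omega_solution_def)
      then show "\<not> good (hat \<omega> F)" using eval F'(2) by blast
    qed
  next
    assume bad: ?bad
    \<comment> \<open>The kernel of evaluation at the point contains all initial forms, and also the
      variables of infinite order, whose value is 0.\<close>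
    define J where "J = {lookup F | F :: ('n, 'm, 'k) lpm. ev (hat \<omega> F) = 0}"
    have "lp_ideal J"
      unfolding J_def
      by (rule lp_ideal_lookup_image) (simp_all add: hat_0 ev_altdef[of 0] hat_add hat_mult ev_add ev_mult)
    moreover have "lp_in \<omega> order f \<in> J" if f: "f \<in> I" for f
    proof -
      obtain F where F: "f = lookup F" "F \<in> pm_ideal I" using lpI[OF f] by blast
      obtain F' where F': "lp_in \<omega> order (lookup F) = lookup F'" "ev (hat \<omega> F') = 0 \<longleftrightarrow> \<not> good (hat \<omega> F)"
        using initial_form_vanishes by blast
      then show ?thesis using bad F by (auto simp: J_def)
    qed
    moreover have "lp_var_y i \<in> J" if "order i = \<infinity>" for i
    proof -
      have "c i = 0" using that by (simp add: order_def split: if_splits)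
      then have "ev (hat \<omega> (yvar i :: ('n, 'm, 'k) lpm)) = 0" by (simp add: hat_yvar ev_yv)
      moreover have "lp_var_y i = lookup (yvar i :: ('n, 'm, 'k) lpm)"
        by (auto simp: lp_var_y_def yvar_def lp_monom_def lookup_single when_def zero_fun_def fun_eq_iff)
      ultimately show ?thesis by (auto simp: J_def)
    qed
    ultimately have "lp_In \<omega> order I \<subseteq> J"
      unfolding lp_In_def lp_ideal_gen_def by (intro Inter_lower) auto
    then show ?sol using eval valid by (fastforce simp: omega_solution_def J_def)
  qed
  \<comment> \<open>A monomial in coordinates with c i \<noteq> 0 has a nonzero value at the point,
    so it cannot lie in an ideal that vanishes there.\<close>
  have tau: "(\<omega>, order) \<in> tau I" if sol: "omega_solution \<omega> (lp_In \<omega> order I) ?p"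
    unfolding tau_def
  proof (clarify)
    fix d :: 'k and a \<beta>
    assume d: "d \<noteq> 0" "\<forall>i. i \<notin> Lam order \<longrightarrow> \<beta> i = 0" "lp_monom d (a, \<beta>) \<in> lp_In \<omega> order I"
    define F :: "('n, 'm, 'k) lpm" where "F = single (a, \<beta>) d"
    have "lookup F = lp_monom d (a, \<beta>)"
      by (auto simp: F_def lp_monom_def lookup_single when_def fun_eq_iff)
    then have "ps_eval (lookup F) ?p = (\<lambda>_. 0)" using sol d(3) by (simp add: omega_solution_def)
    then have "ev (hat \<omega> F) = 0" by (simp only: eval)
    moreover have "ev (hat \<omega> F) = sconst (d * (\<Prod>i\<in>UNIV. c i ^ \<beta> i)) (expo (a, \<beta>))"
      using d(1) by (simp add: ev_hat F_def)
    moreover have "fin \<beta>" using d(2) by (auto simp: fin_def Lam_def order_def)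
    then have "d * (\<Prod>i\<in>UNIV. c i ^ \<beta> i) \<noteq> 0" using d(1) coeff_power_nonzero by (metis mult_eq_0_iff)
    ultimately show False by (metis scoeff_0 scoeff_sconst)
  qed
  have "(\<exists>\<phi>. omega_solution \<omega> I \<phi> \<and> (\<lambda>i. ps_in \<omega> (\<phi> i)) = ?p) \<longleftrightarrow> (\<forall>F\<in>pm_ideal I. \<not> good (hat \<omega> F))"
    (is "?ex \<longleftrightarrow> ?bad")
  proof
    assume ?ex
    then obtain \<phi> where \<phi>: "omega_solution \<omega> I \<phi>" "\<And>i. ps_in \<omega> (\<phi> i) = ?p i" by (metis (no_types, lifting))
    have lf\<phi>: "left_finite \<omega> (\<phi> i)" for i
      using \<phi>(1) left_finite_ps_valid[OF \<omega>] by (auto simp: omega_solution_def)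
    note co = scoeff_emb[OF \<omega> lf\<phi>]
    define r where "r i = emb \<omega> (\<phi> i)" for i
    have r_eq: "r = (\<lambda>i. emb \<omega> (\<phi> i))" by (simp add: r_def fun_eq_iff)
    have "leads i (r i)" for i
    proof (cases "r i = 0")
      case True
      then have z: "\<phi> i \<beta> = 0" for \<beta> using co(1)[of i \<beta>] by (simp add: r_def)
      have "?p i (\<alpha> i) = 0" unfolding \<phi>(2)[of i, symmetric] by (simp add: ps_in_def z)
      then show ?thesis using True by (simp add: leads_def ps_monom_def)
    next
      case False
      then obtain m where m: "vge m (r i)" "scoeff (r i) m \<noteq> 0" by (rule leading_exponentE)
      then obtain \<beta> where \<beta>: "m = weight \<omega> \<beta>" using co(2) unfolding r_def by blast
      \<comment> \<open>Hence a nonzero coordinate has a first term with nonzero coefficient at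
        \<beta>; comparison with the prescribed monomial identifies both exponent and
        coefficient.\<close>
      have "\<phi> i = (\<lambda>\<alpha>. scoeff (r i) (weight \<omega> \<alpha>))" using co(1) by (auto simp: r_def)
      then have "ps_in \<omega> (\<phi> i) = ps_in \<omega> (\<lambda>\<alpha>. scoeff (r i) (weight \<omega> \<alpha>))" by (rule arg_cong)
      also have "\<dots> = ps_monom (\<phi> i \<beta>) \<beta>"
        by (rule ps_in_monom[OF \<omega>]) (use m co(1)[of i \<beta>] in \<open>auto simp: \<beta> r_def\<close>)
      finally have "ps_monom (\<phi> i \<beta>) \<beta> = ?p i" using \<phi>(2)[of i] by metis
      then have "ps_monom (\<phi> i \<beta>) \<beta> \<beta> = ?p i \<beta>" by (rule fun_cong)
      then have "(if \<beta> = \<alpha> i then c i else 0) = \<phi> i \<beta>" by (simp add: ps_monom_def)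
      moreover have "\<phi> i \<beta> = scoeff (r i) m" using co(1) by (simp add: r_def \<beta>)
      ultimately have "\<beta> = \<alpha> i" "c i = scoeff (r i) m" using m(2) by (auto split: if_splits)
      then show ?thesis using m \<beta> by (simp add: leads_def \<eta>_def)
    qed
    moreover have "yev r (hat \<omega> F) = 0" if "F \<in> pm_ideal I" for F
      using \<phi>(1) that ps_eval_zero_iff[where \<phi>=\<phi> and F=F, OF \<omega> lf\<phi>]
      by (auto simp: omega_solution_def pm_ideal_def r_eq)
    ultimately show ?bad using leads_not_good by blast
  next
    assume bad: ?bad
    have "\<exists>r. (\<forall>i. r i \<in> T \<and> leads i (r i)) \<and> (\<forall>F\<in>pm_ideal I. yev r (hat \<omega> F) = 0)"
      by (rule lift_solution[OF ring_ideal_pm_ideal[OF ideal]])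
        (use bad fibre_relation[OF \<omega> ideal adm] in auto)
    then obtain r where r: "\<And>i. r i \<in> T" "\<And>i. leads i (r i)" "\<And>F. F \<in> pm_ideal I \<Longrightarrow> yev r (hat \<omega> F) = 0"
      by blast
    define \<phi> where "\<phi> i = (\<lambda>\<beta>. scoeff (r i) (weight \<omega> \<beta>))" for i
    have lf\<phi>: "left_finite \<omega> (\<phi> i)" for i unfolding \<phi>_def by (rule left_finite_scoeff[OF \<omega>])
    have emb\<phi>: "emb \<omega> (\<phi> i) = r i" for i
      unfolding \<phi>_def using T_supp[OF r(1)] by (intro emb_scoeff[OF \<omega>])
    have "omega_solution \<omega> I \<phi>"
      unfolding omega_solution_def
    proof (intro conjI allI ballI)
      show "ps_valid \<omega> (\<phi> i)" for i unfolding \<phi>_def by (rule ps_valid_T[OF \<omega> r(1)])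
      fix f assume "f \<in> I"
      then obtain F where "f = lookup F" "F \<in> pm_ideal I" using lpI by blast
      then show "ps_eval f \<phi> = (\<lambda>_. 0)" using ps_eval_zero_iff[where \<phi>=\<phi> and F=F, OF \<omega> lf\<phi>] r(3)[of F] emb\<phi> by simp
    qed
    moreover have "ps_in \<omega> (\<phi> i) = ?p i" for i
    proof (cases "c i = 0")
      case True
      then have "r i = 0" using r(2)[of i] by (simp add: leads_def)
      then show ?thesis using True by (simp add: \<phi>_def ps_in_def ps_monom_def fun_eq_iff)
    next
      case False
      then show ?thesis
        unfolding \<phi>_def using r(2)[of i] by (intro ps_in_monom[OF \<omega>]) (auto simp: leads_def \<eta>_def)
    qed
    ultimately show ?ex by blast
  qed
  then show ?thesis using bad_iff tau unfolding ord by blast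
qed

end
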